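(* Let $G=(V,E)$ be a weighted directed graph with $n$ vertices, weights $w:E\to\mathbb{R}$, and a frozen set $E^-\subseteq E$ of negative edges such that every edge outside $E^-$ has non-negative weight; suppose $G$ has $k$ negative vertices, each having exactly one outgoing edge in $E^-$. Let $b\ge1$ and suppose that every ordered pair $(s,t)\in V\times V$ has betweenness at most $k/b$. Then there is a deterministic $O(kn^2/\sqrt b)$-time algorithm that outputs a graph $G'=(V',E')$ with $V'\supseteq V$, $E'\supseteq E$, together with a set of negative edges $E'^-\supseteq E^-$ of $G'$ (every edge of $E'\setminus E'^-$ having non-negative weight), such that (1) for all $s,t\in V$, $d_{G'}(s,t)=d_G(s,t)$; (2) for all $s,t\in V$ and every positive integer $h$, $d^{\,h-\lfloor h/3\rfloor}_{G'}(s,t)\le d^h_G(s,t)$; (3) $|V'|=n+k$, and there are no new negative vertices (the tails of edges in $E'^-$ are exactly the negative vertices of $G$).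
   Context: A negative vertex is a vertex with at least one outgoing edge in the designated negative-edge set. $d_G(s,t)$ is the ordinary shortest-path distance. For a positive integer $h$, the $h$-negative hop distance $d^h_G(s,t)$ is the minimum weight of an $s\to t$ path containing at most $h$ edges from the designated negative-edge set. $d^0(u,v)$ is the minimum weight of a $u\to v$ path using no edge of $E^-$, and $d^-(u,v)$ is the minimum weight of a $u\to v$ path in which every edge except possibly the first is outside $E^-$ (both in $G$). A vertex $v$ is between the ordered pair $(s,t)$ if $d^0(s,v)+d^-(v,t)<0$; the betweenness of $(s,t)$ is the number of such $v$.
   Formalization: The running time is proved as O(max(kn²/√b, 1+n+|E|)), i.e. at least the input size; the literal bound fails if k=0, or if all edges of E⁻ have non-negative weight, as b may then be arbitrarily large. If a simple graph has an E⁻ edge of negative weight it is O(kn²/√b). *)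

theory Defs
  imports Complex_Main "Graph_Theory.Digraph" "Graph_Theory.Shortest_Path"
begin

section \<open>Negative edges, hop distances and betweenness\<close>

text \<open>
  Graphs are the directed graphs of \<open>Graph_Theory\<close>, whose arcs have an identity of their own, so
  a new arc may be added next to an existing one with the same ends. Throughout, \<open>N\<close> is the
  designated set of negative arcs; arcs in \<open>N\<close> may have any real weight. As in \<open>wf_digraph.\<mu>\<close>, the
  library's shortest-path distance, distances are infima of costs of arc walks in the extended
  reals: they are \<open>\<infinity>\<close> if there is no admissible walk, and no absence of negative cycles is assumed.
\<close>

definition negative_vertices :: "('a, 'b) pre_digraph \<Rightarrow> 'b set \<Rightarrow> 'a set" where
  "negative_vertices G N = {v \<in> verts G. out_arcs G v \<inter> N \<noteq> {}}"

definition hop_dist ::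
  "('a, 'b) pre_digraph \<Rightarrow> ('b \<Rightarrow> real) \<Rightarrow> 'b set \<Rightarrow> nat \<Rightarrow> 'a \<Rightarrow> 'a \<Rightarrow> ereal" where
  "hop_dist G w N h s t =
     (INF p \<in> {p. pre_digraph.awalk G s p t \<and> length (filter (\<lambda>e. e \<in> N) p) \<le> h}.
        ereal (wf_digraph.awalk_cost w p))"

definition dist_zero ::
  "('a, 'b) pre_digraph \<Rightarrow> ('b \<Rightarrow> real) \<Rightarrow> 'b set \<Rightarrow> 'a \<Rightarrow> 'a \<Rightarrow> ereal" where
  "dist_zero G w N u v =
     (INF p \<in> {p. pre_digraph.awalk G u p v \<and> set p \<inter> N = {}}. ereal (wf_digraph.awalk_cost w p))"

definition dist_minus ::
  "('a, 'b) pre_digraph \<Rightarrow> ('b \<Rightarrow> real) \<Rightarrow> 'b set \<Rightarrow> 'a \<Rightarrow> 'a \<Rightarrow> ereal" where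
  "dist_minus G w N u v =
     (INF p \<in> {p. pre_digraph.awalk G u p v \<and> set (tl p) \<inter> N = {}}. ereal (wf_digraph.awalk_cost w p))"

definition betweenness ::
  "('a, 'b) pre_digraph \<Rightarrow> ('b \<Rightarrow> real) \<Rightarrow> 'b set \<Rightarrow> 'a \<Rightarrow> 'a \<Rightarrow> nat" where
  "betweenness G w N s t = card {v \<in> verts G. dist_zero G w N s v + dist_minus G w N v t < 0}"


section \<open>The machine model\<close>

text \<open>
  Algorithms are programs of a deterministic while language over a random access machine with
  natural-number memory and real memory (scalars and arrays, i.e. indirect addressing, for both).
  The arithmetic is that of the comparison-addition model: addition, (truncated) subtraction and
  comparison; in particular there is neither multiplication nor rounding of reals to integers.
  Every assignment and every evaluation of a test counts as one step. A fixed program contains only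
  finitely many expressions, so charging for each operation inside an expression instead would
  change the number of steps by at most a constant factor that depends on the program only.
\<close>

type_synonym vname = string

record state =
  nvar :: "vname \<Rightarrow> nat"
  rvar :: "vname \<Rightarrow> real"
  narr :: "vname \<Rightarrow> nat \<Rightarrow> nat"
  rarr :: "vname \<Rightarrow> nat \<Rightarrow> real"

datatype nexp =
    NConst nat
  | NVar vname
  | NArr vname nexp
  | NAdd nexp nexp
  | NSub nexp nexp

datatype rexp =
    RConst rat
  | RVar vname
  | RArr vname nexp
  | RAdd rexp rexp
  | RSub rexp rexp

datatype test =
    NLess nexp nexp
  | RLess rexp rexp
  | TNot test
  | TAnd test test

datatype com =
    Skip
  | NAssign vname nexp
  | RAssign vname rexp
  | NStore vname nexp nexp
  | RStore vname nexp rexp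
  | Seq com com
  | If test com com
  | While test com

fun nval :: "nexp \<Rightarrow> state \<Rightarrow> nat" where
  "nval (NConst c) s = c"
| "nval (NVar x) s = nvar s x"
| "nval (NArr a i) s = narr s a (nval i s)"
| "nval (NAdd e f) s = nval e s + nval f s"
| "nval (NSub e f) s = nval e s - nval f s"

fun rval :: "rexp \<Rightarrow> state \<Rightarrow> real" where
  "rval (RConst c) s = of_rat c"
| "rval (RVar x) s = rvar s x"
| "rval (RArr a i) s = rarr s a (nval i s)"
| "rval (RAdd e f) s = rval e s + rval f s"
| "rval (RSub e f) s = rval e s - rval f s"

fun tval :: "test \<Rightarrow> state \<Rightarrow> bool" where
  "tval (NLess e f) s \<longleftrightarrow> nval e s < nval f s"
| "tval (RLess e f) s \<longleftrightarrow> rval e s < rval f s"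
| "tval (TNot b) s \<longleftrightarrow> \<not> tval b s"
| "tval (TAnd b c) s \<longleftrightarrow> tval b s \<and> tval c s"

text \<open>\<open>exec c s T t\<close>: started in \<open>s\<close>, program \<open>c\<close> halts after exactly \<open>T\<close> steps in \<open>t\<close>.\<close>

inductive exec :: "com \<Rightarrow> state \<Rightarrow> nat \<Rightarrow> state \<Rightarrow> bool" where
  Skip: "exec Skip s 1 s"
| NAssign: "exec (NAssign x e) s 1 (s\<lparr>nvar := (nvar s)(x := nval e s)\<rparr>)"
| RAssign: "exec (RAssign x e) s 1 (s\<lparr>rvar := (rvar s)(x := rval e s)\<rparr>)"
| NStore: "exec (NStore a i e) s 1
    (s\<lparr>narr := (narr s)(a := (narr s a)(nval i s := nval e s))\<rparr>)"
| RStore: "exec (RStore a i e) s 1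
    (s\<lparr>rarr := (rarr s)(a := (rarr s a)(nval i s := rval e s))\<rparr>)"
| Seq: "exec c s T s' \<Longrightarrow> exec d s' U t \<Longrightarrow> exec (Seq c d) s (T + U) t"
| IfTrue: "tval b s \<Longrightarrow> exec c s T t \<Longrightarrow> exec (If b c d) s (1 + T) t"
| IfFalse: "\<not> tval b s \<Longrightarrow> exec d s T t \<Longrightarrow> exec (If b c d) s (1 + T) t"
| WhileFalse: "\<not> tval b s \<Longrightarrow> exec (While b c) s 1 s"
| WhileTrue: "tval b s \<Longrightarrow> exec c s T s' \<Longrightarrow> exec (While b c) s' U t \<Longrightarrow>
    exec (While b c) s (1 + T + U) t"

lemma exec_deterministic:
  "exec c s T t \<Longrightarrow> exec c s T' t' \<Longrightarrow> T = T' \<and> t = t'"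
proof (induction arbitrary: T' t' rule: exec.induct)
  case (Seq c s T s' d U t)
  from Seq.prems obtain T1 s1 U1 where
    "exec c s T1 s1" "exec d s1 U1 t'" "T' = T1 + U1"
    by (cases rule: exec.cases) auto
  then show ?case using Seq.IH by metis
next
  case (WhileTrue b s c T s' U t)
  from WhileTrue.prems WhileTrue.hyps obtain T1 s1 U1 where
    "exec c s T1 s1" "exec (While b c) s1 U1 t'" "T' = 1 + T1 + U1"
    by (cases rule: exec.cases) auto
  then show ?case using WhileTrue.IH by metis
next
  case (IfTrue b s c T t d)
  from IfTrue.prems IfTrue.hyps obtain T1 where "exec c s T1 t'" "T' = 1 + T1"
    by (cases rule: exec.cases) auto
  then show ?case using IfTrue.IH by metis
next
  case (IfFalse b s d T t c)
  from IfFalse.prems IfFalse.hyps obtain T1 where "exec d s T1 t'" "T' = 1 + T1"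
    by (cases rule: exec.cases) auto
  then show ?case using IfFalse.IH by metis
qed (erule exec.cases; simp)+


section \<open>Graphs in memory\<close>

text \<open>
  A graph with vertices \<open>{..<n}\<close> and arcs \<open>{..<m}\<close> is stored as a list of arcs, indexed by their
  number; input and output use the same format. All other memory initially contains zeros.
  The input size is \<open>1 + n + m\<close> up to a constant factor. A running time below it cannot be
  attained, so time bounds are understood as the maximum with the input size. This matters for the
  bound \<open>k * n\<^sup>2 / sqrt b\<close> only if \<open>k = 0\<close>, if there are more than \<open>n\<^sup>2\<close> (hence parallel) arcs, or if
  all arcs in \<open>N\<close> have non-negative weight: otherwise some \<open>u\<close> is between the ends of its negative
  arc, so \<open>b \<le> k\<close>.
\<close>

definition load_graph ::
  "(nat, nat) pre_digraph \<Rightarrow> (nat \<Rightarrow> real) \<Rightarrow> nat set \<Rightarrow> real \<Rightarrow> state" where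
  "load_graph G w N b =
     \<lparr>nvar = (\<lambda>_. 0)(''n'' := card (verts G), ''m'' := card (arcs G)),
      rvar = (\<lambda>_. 0)(''b'' := b),
      narr = (\<lambda>_ _. 0)
        (''tail'' := (\<lambda>e. if e \<in> arcs G then tail G e else 0),
         ''head'' := (\<lambda>e. if e \<in> arcs G then head G e else 0),
         ''neg'' := (\<lambda>e. if e \<in> arcs G \<inter> N then 1 else 0)),
      rarr = (\<lambda>_ _. 0)(''weight'' := (\<lambda>e. if e \<in> arcs G then w e else 0))\<rparr>"

definition stored_graph :: "state \<Rightarrow> (nat, nat) pre_digraph" where
  "stored_graph s =
     \<lparr>verts = {..<nvar s ''n''}, arcs = {..<nvar s ''m''},
      tail = narr s ''tail'', head = narr s ''head''\<rparr>"

definition stored_weight :: "state \<Rightarrow> nat \<Rightarrow> real" where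
  "stored_weight s = rarr s ''weight''"

definition stored_neg :: "state \<Rightarrow> nat set" where
  "stored_neg s = {e. e < nvar s ''m'' \<and> narr s ''neg'' e \<noteq> 0}"


section \<open>The output specification\<close>

definition extends_graph ::
  "('a, 'b) pre_digraph \<Rightarrow> ('b \<Rightarrow> real) \<Rightarrow> ('a, 'b) pre_digraph \<Rightarrow> ('b \<Rightarrow> real) \<Rightarrow> bool" where
  "extends_graph G w G' w' \<longleftrightarrow>
     wf_digraph G' \<and> verts G \<subseteq> verts G' \<and> arcs G \<subseteq> arcs G' \<and>
     (\<forall>e \<in> arcs G. tail G' e = tail G e \<and> head G' e = head G e \<and> w' e = w e)"

definition shortcut_graph ::
  "('a, 'b) pre_digraph \<Rightarrow> ('b \<Rightarrow> real) \<Rightarrow> 'b set \<Rightarrow>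
   ('a, 'b) pre_digraph \<Rightarrow> ('b \<Rightarrow> real) \<Rightarrow> 'b set \<Rightarrow> bool" where
  "shortcut_graph G w N G' w' N' \<longleftrightarrow>
     extends_graph G w G' w' \<and>
     N \<subseteq> N' \<and> N' \<subseteq> arcs G' \<and> (\<forall>e \<in> arcs G' - N'. 0 \<le> w' e) \<and>
     (\<forall>s \<in> verts G. \<forall>t \<in> verts G. wf_digraph.\<mu> G' w' s t = wf_digraph.\<mu> G w s t) \<and>
     (\<forall>s \<in> verts G. \<forall>t \<in> verts G. \<forall>h \<ge> 1.
        hop_dist G' w' N' (h - h div 3) s t \<le> hop_dist G w N h s t) \<and>
     card (verts G') = card (verts G) + card (negative_vertices G N) \<and>
     tail G' ` N' = negative_vertices G N"

end

theory Submission
  imports Defs "HOL-Library.Discrete_Functions"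
begin

text \<open>
  For every negative arc \<open>e\<close> from \<open>u\<close> to \<open>v\<close>, two Dijkstra searches over the non-negative arcs run
  in lockstep: one backwards from \<open>u\<close>, one forwards from \<open>v\<close> with initial distance \<open>w e\<close>. A round
  settles the next vertex of both searches; the searches stop as soon as the next two distances have
  a non-negative sum. All pairs settled before have \<open>u\<close> between them, so \<open>j\<close> rounds witness
  \<open>j\<^sup>2\<close> of the at most \<open>n\<^sup>2 * k / b\<close> incidences between negative vertices and pairs; hence there are
  \<open>O(k * n / sqrt b)\<close> rounds altogether, each of which costs \<open>O(n)\<close>.

  At the stop there is a number \<open>r\<close> such that unsettled vertices have distance at least \<open>r\<close> to \<open>u\<close>
  and at least \<open>- r\<close> from \<open>u\<close> through \<open>e\<close>. A new vertex \<open>z\<close> with potential \<open>r\<close> is joined by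
  non-negative arcs to the frontiers of both searches. In a walk with three consecutive negative arcs
  whose middle one is \<open>e\<close>, either both sides leave the settled regions, and \<open>e\<close> is replaced by the
  way through \<open>z\<close>; or one of the other two negative arcs is settled, and is merged with \<open>e\<close> into one
  new negative arc. In all cases three hops become two.

  If no negative arc has negative weight, the time bound may be as small as the input, and subdividing
  a copy of every negative arc suffices; otherwise \<open>b \<le> k\<close>.
\<close>

subsection \<open>Timed execution of programs\<close>

text \<open>Settling both sides at the same rate makes the count quadratic: with \<open>j\<close>
  settled vertices on each side all \<open>j * j\<close> settled pairs are witnesses, while a
  lopsided pair of searches could do much work for few of them. The stopping test settles all
  questions of sign at once: as the two smallest tentative distances have a non-negative sum, one
  number \<open>r\<close> separates them, and shifting by \<open>r\<close> makes both kinds of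
  frontier arcs non-negative. A shift at a new vertex changes no distance between old ones. A search
  has a cost of order \<open>n\<close> even if it settles nothing. Over all negative arcs this is
  \<open>k * n\<close>, which fits the bound because \<open>b \<le> k \<le> n\<close> gives
  \<open>sqrt b \<le> n\<close>. If no arc has negative weight, \<open>b\<close> may be arbitrarily
  large, which is why such inputs take another route. The searches read a matrix of cheapest arcs,
  so that settling a vertex costs O(n) even if there are many parallel arcs. Preparing it is linear
  in the input: only row offsets and the entries of actual arcs are written.\<close>

fun loop_free :: "com \<Rightarrow> bool" where
  "loop_free (Seq c d) \<longleftrightarrow> loop_free c \<and> loop_free d"
| "loop_free (If b c d) \<longleftrightarrow> loop_free c \<and> loop_free d"
| "loop_free (While b c) \<longleftrightarrow> False"
| "loop_free _ \<longleftrightarrow> True"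

text \<open>Only meant for loop-free programs; the equation for \<open>While\<close> is a dummy.
  Simplification with \<open>run\<close> replaces derivations in \<open>exec\<close>.\<close>

fun run :: "com \<Rightarrow> state \<Rightarrow> state" where
  "run Skip s = s"
| "run (NAssign x e) s = s\<lparr>nvar := (nvar s)(x := nval e s)\<rparr>"
| "run (RAssign x e) s = s\<lparr>rvar := (rvar s)(x := rval e s)\<rparr>"
| "run (NStore a i e) s = s\<lparr>narr := (narr s)(a := (narr s a)(nval i s := nval e s))\<rparr>"
| "run (RStore a i e) s = s\<lparr>rarr := (rarr s)(a := (rarr s a)(nval i s := rval e s))\<rparr>"
| "run (Seq c d) s = run d (run c s)"
| "run (If b c d) s = (if tval b s then run c s else run d s)"
| "run (While b c) s = s"

text \<open>An upper bound that depends on no state: a conditional is charged for both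
  branches.\<close>

fun steps :: "com \<Rightarrow> nat" where
  "steps (Seq c d) = steps c + steps d"
| "steps (If b c d) = 1 + steps c + steps d"
| "steps _ = 1"

definition runs :: "com \<Rightarrow> state \<Rightarrow> nat \<Rightarrow> state \<Rightarrow> bool" where
  "runs c s K t \<longleftrightarrow> (\<exists>T\<le>K. exec c s T t)"

lemma runs_mono: "runs c s K t \<Longrightarrow> K \<le> L \<Longrightarrow> runs c s L t"
  unfolding runs_def by (meson order_trans)

lemma runs_Seq: "runs c s K t \<Longrightarrow> runs d t L u \<Longrightarrow> runs (Seq c d) s (K + L) u"
  unfolding runs_def by (meson add_mono exec.Seq)

lemma runs_If:
  assumes "tval b s \<Longrightarrow> runs c s K t" "\<not> tval b s \<Longrightarrow> runs d s K t"
  shows "runs (If b c d) s (1 + K) t"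
proof (cases "tval b s")
  case True
  with assms obtain T where "T \<le> K" "exec c s T t" by (auto simp: runs_def)
  with True show ?thesis unfolding runs_def by (intro exI[of _ "1 + T"]) (auto intro: exec.IfTrue[simplified])
next
  case False
  with assms obtain T where "T \<le> K" "exec d s T t" by (auto simp: runs_def)
  with False show ?thesis unfolding runs_def by (intro exI[of _ "1 + T"]) (auto intro: exec.IfFalse[simplified])
qed

lemma runs_While_False: "\<not> tval b s \<Longrightarrow> runs (While b c) s 1 s"
  unfolding runs_def using exec.WhileFalse by blast

lemma runs_While_True:
  assumes "tval b s" "runs c s K t" "runs (While b c) t L u"
  shows "runs (While b c) s (1 + K + L) u"
proof -
  from assms obtain T U where "T \<le> K" "exec c s T t" "U \<le> L" "exec (While b c) t U u"
    by (auto simp: runs_def)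
  with assms(1) show ?thesis
    unfolding runs_def by (intro exI[of _ "1 + T + U"]) (auto intro: exec.WhileTrue[simplified])
qed

lemma runs_run: "loop_free c \<Longrightarrow> runs c s (steps c) (run c s)"
proof (induction c arbitrary: s)
  case (Seq c1 c2)
  then show ?case by (auto intro: runs_Seq)
next
  case (If b c1 c2)
  have "runs (If b c1 c2) s (1 + (steps c1 + steps c2)) (run (If b c1 c2) s)"
  proof (rule runs_If)
    show "runs c1 s (steps c1 + steps c2) (run (If b c1 c2) s)" if "tval b s"
      using that If runs_mono[of c1 s "steps c1"] by auto
    show "runs c2 s (steps c1 + steps c2) (run (If b c1 c2) s)" if "\<not> tval b s"
      using that If runs_mono[of c2 s "steps c2"] by auto
  qed
  then show ?case by simp
qed (auto simp: runs_def intro!: exI[of _ "Suc 0"]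
  intro: exec.Skip[simplified] exec.NAssign[simplified] exec.RAssign[simplified]
    exec.NStore[simplified] exec.RStore[simplified])

lemma runs_assign:
  "runs (NAssign x e) s 1 (run (NAssign x e) s)" "runs (RAssign x f) s 1 (run (RAssign x f) s)"
  "runs (NStore a i e) s 1 (run (NStore a i e) s)" "runs (RStore a i f) s 1 (run (RStore a i f) s)"
  using runs_run[of "NAssign x e" s] runs_run[of "RAssign x f" s] runs_run[of "NStore a i e" s]
    runs_run[of "RStore a i f" s] by simp_all

section \<open>Frame conditions and loop rules\<close>

fun mod_nvar :: "com \<Rightarrow> vname set" where
  "mod_nvar (NAssign x e) = {x}"
| "mod_nvar (Seq c d) = mod_nvar c \<union> mod_nvar d"
| "mod_nvar (If b c d) = mod_nvar c \<union> mod_nvar d"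
| "mod_nvar (While b c) = mod_nvar c"
| "mod_nvar _ = {}"

fun mod_rvar :: "com \<Rightarrow> vname set" where
  "mod_rvar (RAssign x e) = {x}"
| "mod_rvar (Seq c d) = mod_rvar c \<union> mod_rvar d"
| "mod_rvar (If b c d) = mod_rvar c \<union> mod_rvar d"
| "mod_rvar (While b c) = mod_rvar c"
| "mod_rvar _ = {}"

fun mod_narr :: "com \<Rightarrow> vname set" where
  "mod_narr (NStore a i e) = {a}"
| "mod_narr (Seq c d) = mod_narr c \<union> mod_narr d"
| "mod_narr (If b c d) = mod_narr c \<union> mod_narr d"
| "mod_narr (While b c) = mod_narr c"
| "mod_narr _ = {}"

fun mod_rarr :: "com \<Rightarrow> vname set" where
  "mod_rarr (RStore a i e) = {a}"
| "mod_rarr (Seq c d) = mod_rarr c \<union> mod_rarr d"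
| "mod_rarr (If b c d) = mod_rarr c \<union> mod_rarr d"
| "mod_rarr (While b c) = mod_rarr c"
| "mod_rarr _ = {}"

text \<open>A syntactic over-approximation of what a program writes. Both loop rules hand it to the
  loop body, so that invariants mention only what the loop changes.\<close>

definition frame :: "com \<Rightarrow> state \<Rightarrow> state \<Rightarrow> bool" where
  "frame c s t \<longleftrightarrow>
     (\<forall>x. x \<notin> mod_nvar c \<longrightarrow> nvar t x = nvar s x) \<and> (\<forall>x. x \<notin> mod_rvar c \<longrightarrow> rvar t x = rvar s x) \<and>
     (\<forall>a. a \<notin> mod_narr c \<longrightarrow> narr t a = narr s a) \<and> (\<forall>a. a \<notin> mod_rarr c \<longrightarrow> rarr t a = rarr s a)"

lemma exec_frame: "exec c s T t \<Longrightarrow> frame c s t"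
  by (induction rule: exec.induct) (auto simp: frame_def)

lemma runs_frame: "runs c s K t \<Longrightarrow> frame c s t"
  unfolding runs_def using exec_frame by blast

lemma run_frame: "loop_free c \<Longrightarrow> frame c s (run c s)"
  using runs_frame runs_run by blast

text \<open>The measure bounds the number of remaining iterations: each costs its test and at most
  \<open>K\<close> steps, and the leading 1 is the failing last test.\<close>

lemma While_rule:
  assumes "I s"
    and step: "\<And>t. frame (While b c) s t \<Longrightarrow> I t \<Longrightarrow> tval b t \<Longrightarrow>
      \<exists>t'. runs c t K t' \<and> I t' \<and> (measr t' :: nat) < measr t"
  shows "\<exists>t. runs (While b c) s (1 + (1 + K) * measr s) t \<and> I t \<and> \<not> tval b t"
proof -
  have "\<exists>t'. runs (While b c) t (1 + (1 + K) * measr t) t' \<and> I t' \<and> \<not> tval b t'"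
    if "frame (While b c) s t" "I t" for t
    using that
  proof (induction "measr t" arbitrary: t rule: less_induct)
    case less
    show ?case
    proof (cases "tval b t")
      case False
      then show ?thesis using less.prems runs_mono[OF runs_While_False[OF False]] by fastforce
    next
      case True
      from step[OF less.prems True] obtain t1
        where t1: "runs c t K t1" "I t1" "measr t1 < measr t" by blast
      have "frame (While b c) s t1"
        using less.prems(1) runs_frame[OF t1(1)] by (auto simp: frame_def)
      from less.hyps[OF t1(3) this t1(2)] obtain u
        where u: "runs (While b c) t1 (1 + (1 + K) * measr t1) u" "I u" "\<not> tval b u" by blast
      have "1 + K + (1 + (1 + K) * measr t1) = 1 + (1 + K) * Suc (measr t1)" by simp
      also have "\<dots> \<le> 1 + (1 + K) * measr t"
        using t1(3) by (intro add_left_mono mult_le_mono2) simp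
      finally show ?thesis
        using u runs_mono[OF runs_While_True[OF True t1(1) u(1)]] by blast
    qed
  qed
  then show ?thesis using \<open>I s\<close> by (simp add: frame_def)
qed

definition For :: "vname \<Rightarrow> nexp \<Rightarrow> nexp \<Rightarrow> com \<Rightarrow> com" where
  "For x lo hi c = Seq (NAssign x lo)
     (While (NLess (NVar x) hi) (Seq c (NAssign x (NAdd (NVar x) (NConst 1)))))"

lemma mod_For [simp]:
  "mod_nvar (For x lo hi c) = insert x (mod_nvar c)" "mod_rvar (For x lo hi c) = mod_rvar c"
  "mod_narr (For x lo hi c) = mod_narr c" "mod_rarr (For x lo hi c) = mod_rarr c"
  by (auto simp: For_def)

text \<open>\<open>K\<close> may vary with the counter, because the iterations of the loop over the
  negative arcs differ widely in cost. The 2 in each summand is test and increment, the other 2 is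
  initialisation and last test. The invariant is claimed after the increment.\<close>

lemma For_rule:
  assumes lo: "nval lo s = i0" "i0 \<le> j"
    and init: "I i0 (s\<lparr>nvar := (nvar s)(x := i0)\<rparr>)"
    and hi: "\<And>t. frame (For x lo hi c) s t \<Longrightarrow> nval hi t = j"
    and step: "\<And>i t. frame (For x lo hi c) s t \<Longrightarrow> i0 \<le> i \<Longrightarrow> i < j \<Longrightarrow> nvar t x = i \<Longrightarrow> I i t \<Longrightarrow>
      \<exists>t'. runs c t (K i) t' \<and> nvar t' x = i \<and> I (Suc i) (t'\<lparr>nvar := (nvar t')(x := Suc i)\<rparr>)"
  shows "\<exists>t. runs (For x lo hi c) s (2 + (\<Sum>i = i0..<j. K i + 2)) t \<and> I j t \<and>
    frame (For x lo hi c) s t"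
proof -
  let ?W = "While (NLess (NVar x) hi) (Seq c (NAssign x (NAdd (NVar x) (NConst 1))))"
  let ?F = "frame (For x lo hi c) s"
  have *: "\<exists>t'. runs ?W t (1 + (\<Sum>i = i..<j. K i + 2)) t' \<and> I j t' \<and> ?F t'"
    if "?F t" "i0 \<le> i" "i \<le> j" "nvar t x = i" "I i t" for i t
    using that
  proof (induction "j - i" arbitrary: i t)
    case 0
    then show ?case using runs_While_False[of "NLess (NVar x) hi" t] hi[of t] by auto
  next
    case (Suc d)
    then have "i < j" by simp
    from step[OF Suc.prems(1,2) this Suc.prems(4,5)] obtain t1 where
      t1: "runs c t (K i) t1" "nvar t1 x = i" "I (Suc i) (t1\<lparr>nvar := (nvar t1)(x := Suc i)\<rparr>)"
      by blast
    let ?t2 = "t1\<lparr>nvar := (nvar t1)(x := Suc i)\<rparr>"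
    have "runs (NAssign x (NAdd (NVar x) (NConst 1))) t1 1 ?t2"
      using runs_run[of "NAssign x (NAdd (NVar x) (NConst 1))" t1] t1(2) by simp
    note body = runs_Seq[OF t1(1) this]
    have "?F ?t2" using Suc.prems(1) runs_frame[OF t1(1)] by (auto simp: frame_def)
    moreover have "d = j - Suc i" "i0 \<le> Suc i" "Suc i \<le> j" using Suc by auto
    ultimately obtain u
      where u: "runs ?W ?t2 (1 + (\<Sum>i = Suc i..<j. K i + 2)) u" "I j u" "?F u"
      using Suc.hyps(1)[of "Suc i" ?t2] t1(3) by auto
    have "tval (NLess (NVar x) hi) t" using hi[OF Suc.prems(1)] Suc.prems(4) \<open>i < j\<close> by simp
    from runs_While_True[OF this body u(1)] show ?case
      using u(2,3) \<open>i < j\<close>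
      by (intro exI[of _ u]) (auto elim!: runs_mono simp: sum.atLeast_Suc_lessThan)
  qed
  let ?s = "s\<lparr>nvar := (nvar s)(x := i0)\<rparr>"
  have "?F ?s" by (simp add: frame_def)
  from *[OF this _ lo(2) _ init] obtain u
    where u: "runs ?W ?s (1 + (\<Sum>i = i0..<j. K i + 2)) u" "I j u" "?F u" by auto
  have "runs (NAssign x lo) s 1 ?s" using runs_run[of "NAssign x lo" s] lo(1) by simp
  from runs_Seq[OF this u(1)] show ?thesis
    using u(2,3) unfolding For_def by (intro exI[of _ u]) (auto elim!: runs_mono)
qed

lemma For_rule_const:
  assumes lo: "nval lo s = i0" "i0 \<le> j"
    and init: "I i0 (s\<lparr>nvar := (nvar s)(x := i0)\<rparr>)"
    and hi: "\<And>t. frame (For x lo hi c) s t \<Longrightarrow> nval hi t = j"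
    and lf: "loop_free c" "x \<notin> mod_nvar c"
    and step: "\<And>i t. frame (For x lo hi c) s t \<Longrightarrow> i0 \<le> i \<Longrightarrow> i < j \<Longrightarrow> nvar t x = i \<Longrightarrow> I i t \<Longrightarrow>
      I (Suc i) ((run c t)\<lparr>nvar := (nvar (run c t))(x := Suc i)\<rparr>)"
  shows "\<exists>t. runs (For x lo hi c) s (2 + (steps c + 2) * (j - i0)) t \<and> I j t \<and>
    frame (For x lo hi c) s t"
proof -
  have "\<exists>t'. runs c t (steps c) t' \<and> nvar t' x = i \<and> I (Suc i) (t'\<lparr>nvar := (nvar t')(x := Suc i)\<rparr>)"
    if t: "frame (For x lo hi c) s t" "i0 \<le> i" "i < j" "nvar t x = i" "I i t" for i t
  proof (intro exI conjI)
    show r: "runs c t (steps c) (run c t)" using runs_run[OF lf(1)] .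
    show "nvar (run c t) x = i" using runs_frame[OF r] lf(2) t(4) by (simp add: frame_def)
    show "I (Suc i) ((run c t)\<lparr>nvar := (nvar (run c t))(x := Suc i)\<rparr>)" using step[OF t] .
  qed
  then have "\<exists>t. runs (For x lo hi c) s (2 + (\<Sum>i = i0..<j. steps c + 2)) t \<and> I j t \<and>
      frame (For x lo hi c) s t"
    by (intro For_rule[where I = I and K = "\<lambda>_. steps c"] lo init hi)
  then show ?thesis by (simp add: mult.commute)
qed

subsection \<open>Bypassed negative arcs\<close>

text \<open>Upper bounds on both numbers instead of an extended-real infimum, so that concatenating
  walks just adds hops and costs.\<close>

definition reach ::
  "('a, 'b) pre_digraph \<Rightarrow> ('b \<Rightarrow> real) \<Rightarrow> 'b set \<Rightarrow> nat \<Rightarrow> 'a \<Rightarrow> 'a \<Rightarrow> real \<Rightarrow> bool" where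
  "reach G w N h x y c \<longleftrightarrow>
     (\<exists>q. pre_digraph.awalk G x q y \<and> length (filter (\<lambda>e. e \<in> N) q) \<le> h \<and> sum_list (map w q) \<le> c)"

lemma reach_mono: "reach G w N h x y c \<Longrightarrow> h \<le> h' \<Longrightarrow> c \<le> c' \<Longrightarrow> reach G w N h' x y c'"
  unfolding reach_def by force

lemma reach_trans:
  assumes "wf_digraph G" "reach G w N h x y c" "reach G w N h' y z c'"
  shows "reach G w N (h + h') x z (c + c')"
proof -
  interpret wf_digraph G by fact
  from assms obtain q q' where
    "awalk x q y" "length (filter (\<lambda>e. e \<in> N) q) \<le> h" "sum_list (map w q) \<le> c"
    "awalk y q' z" "length (filter (\<lambda>e. e \<in> N) q') \<le> h'" "sum_list (map w q') \<le> c'"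
    by (auto simp: reach_def)
  then show ?thesis unfolding reach_def by (intro exI[of _ "q @ q'"]) auto
qed

lemma reach_arc:
  assumes "wf_digraph G" "a \<in> arcs G" "a \<in> N \<Longrightarrow> 1 \<le> h"
  shows "reach G w N h (tail G a) (head G a) (w a)"
proof -
  interpret wf_digraph G by fact
  show ?thesis unfolding reach_def using assms by (intro exI[of _ "[a]"]) (auto simp: arc_implies_awalk)
qed

text \<open>The detour vertex \<open>z\<close> takes the place of the tail of \<open>e\<close>, shifted by the potential \<open>r\<close>. A walk
  into or out of \<open>e\<close> either gets to \<open>z\<close> without negative arcs, or its neighbouring negative
  arc is merged with \<open>e\<close>.\<close>

definition bypassed ::
  "('a, 'b) pre_digraph \<Rightarrow> ('b \<Rightarrow> real) \<Rightarrow> 'b set \<Rightarrow>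
   ('a, 'b) pre_digraph \<Rightarrow> ('b \<Rightarrow> real) \<Rightarrow> 'b set \<Rightarrow> 'b \<Rightarrow> bool" where
  "bypassed G w N G' w' N' e \<longleftrightarrow> (\<exists>z r.
     (\<forall>x p. pre_digraph.awalk G x p (tail G e) \<and> set p \<inter> N = {} \<longrightarrow>
        reach G' w' N' 0 x z (sum_list (map w p) - r) \<or>
        (\<forall>a \<in> N. head G a = x \<longrightarrow> reach G' w' N' 1 (tail G a) z (w a + sum_list (map w p) - r))) \<and>
     (\<forall>y p. pre_digraph.awalk G (head G e) p y \<and> set p \<inter> N = {} \<longrightarrow>
        reach G' w' N' 0 z y (w e + sum_list (map w p) + r) \<or>
        (\<forall>a \<in> N. tail G a = y \<longrightarrow>
           reach G' w' N' 1 (tail G e) (head G a) (w e + sum_list (map w p) + w a))))"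

section \<open>Trading three hops for two\<close>

lemma split_first_filter:
  assumes "length (filter P xs) = Suc j"
  obtains ys x zs where "xs = ys @ x # zs" "filter P ys = []" "P x" "length (filter P zs) = j"
proof -
  from assms obtain x us where "filter P xs = x # us" by (cases "filter P xs") auto
  then obtain ys zs where "xs = ys @ x # zs" "\<forall>u\<in>set ys. \<not> P u" "P x" "us = filter P zs"
    by (auto simp: filter_eq_Cons_iff)
  with that assms show ?thesis by (auto simp: filter_empty_conv)
qed

lemma extends_graph_awalk:
  assumes "extends_graph G w G' w'" "pre_digraph.awalk G x p y"
  shows "pre_digraph.awalk G' x p y \<and> sum_list (map w' p) = sum_list (map w p)"
  using assms(2)
proof (induction p arbitrary: x)
  case Nil
  then show ?case using assms(1) by (auto simp: pre_digraph.awalk_def pre_digraph.cas.simps extends_graph_def)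
next
  case (Cons a p)
  from Cons.prems have "x \<in> verts G" "a \<in> arcs G" "tail G a = x" "set p \<subseteq> arcs G"
    "pre_digraph.cas G (head G a) p y"
    by (auto simp: pre_digraph.awalk_def pre_digraph.cas.simps)
  moreover have "tail G' a = tail G a" "head G' a = head G a" "w' a = w a" "x \<in> verts G'" "a \<in> arcs G'"
    using calculation assms(1) by (auto simp: extends_graph_def)
  moreover have "pre_digraph.cas G' u p y" if "set p \<subseteq> arcs G" "pre_digraph.cas G u p y" for u
    using that assms(1)
    by (induction p arbitrary: u) (auto simp: pre_digraph.cas.simps extends_graph_def)
  moreover have "sum_list (map w' p) = sum_list (map w p)"
    using \<open>set p \<subseteq> arcs G\<close> assms(1)
    by (intro arg_cong[where f = sum_list] map_cong) (auto simp: extends_graph_def)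
  moreover have "set p \<subseteq> arcs G'" using \<open>set p \<subseteq> arcs G\<close> assms(1) by (auto simp: extends_graph_def)
  ultimately show ?case by (auto simp: pre_digraph.awalk_def pre_digraph.cas.simps)
qed

text \<open>No hop is added, because old arcs in \<open>N'\<close> were already in
  \<open>N\<close>.\<close>

lemma extends_graph_reach:
  assumes "extends_graph G w G' w'" "N' \<inter> arcs G \<subseteq> N" "pre_digraph.awalk G x p y"
  shows "reach G' w' N' (length (filter (\<lambda>e. e \<in> N) p)) x y (sum_list (map w p))"
proof -
  have "set p \<subseteq> arcs G" using assms(3) by (auto simp: pre_digraph.awalk_def)
  then have "length (filter (\<lambda>e. e \<in> N') p) \<le> length (filter (\<lambda>e. e \<in> N) p)"
    using assms(2) by (induction p) auto
  then show ?thesis using extends_graph_awalk[OF assms(1,3)] unfolding reach_def by auto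
qed

text \<open>A walk with \<open>j \<le> h\<close> negative arcs is rerouted within the budget of
  \<open>j\<close>; this lifts it to the budget of \<open>h\<close>.\<close>

lemma sub_div_3_mono:
  assumes "(i :: nat) \<le> j"
  shows "i - i div 3 \<le> j - j div 3"
  using assms
proof (induction rule: dec_induct)
  case (step j)
  then show ?case by (auto simp: div_Suc)
qed simp

text \<open>The induction removes three negative arcs at a time: for \<open>j = i + 3\<close> the
  budget is 2 more than that of \<open>i\<close>, so it suffices to cross the first three in two
  hops.\<close>

lemma bypassed_hops:
  assumes wf: "wf_digraph G" and ext: "extends_graph G w G' w'" and N': "N' \<inter> arcs G \<subseteq> N"
    and byp: "\<And>e. e \<in> N \<Longrightarrow> bypassed G w N G' w' N' e"
    and p: "pre_digraph.awalk G x p y" "length (filter (\<lambda>e. e \<in> N) p) = j"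
  shows "reach G' w' N' (j - j div 3) x y (sum_list (map w p))"
  using p
proof (induction j arbitrary: x p rule: less_induct)
  case (less j)
  interpret wf_digraph G by (fact wf)
  have wf': "wf_digraph G'" using ext by (simp add: extends_graph_def)
  note tr = reach_trans[OF wf']
  note walk = extends_graph_reach[OF ext N']
  show ?case
  proof (cases "j < 3")
    case True
    then show ?thesis using walk[OF less.prems(1)] less.prems(2) by simp
  next
    case False
    define i where "i = j - 3"
    have j: "j = Suc (Suc (Suc i))" using False by (simp add: i_def)
    obtain p0 e1 q1 where 1: "p = p0 @ e1 # q1" "filter (\<lambda>e. e \<in> N) p0 = []" "e1 \<in> N"
      "length (filter (\<lambda>e. e \<in> N) q1) = Suc (Suc i)"
      using split_first_filter less.prems(2) j by metis
    obtain p1 e2 q2 where 2: "q1 = p1 @ e2 # q2" "filter (\<lambda>e. e \<in> N) p1 = []" "e2 \<in> N"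
      "length (filter (\<lambda>e. e \<in> N) q2) = Suc i"
      using split_first_filter 1(4) by metis
    obtain p2 e3 p3 where 3: "q2 = p2 @ e3 # p3" "filter (\<lambda>e. e \<in> N) p2 = []" "e3 \<in> N"
      "length (filter (\<lambda>e. e \<in> N) p3) = i"
      using split_first_filter 2(4) by metis
    have w0: "awalk x p0 (tail G e1)" and e1: "e1 \<in> arcs G"
      and w1: "awalk (head G e1) p1 (tail G e2)" and e2: "e2 \<in> arcs G"
      and w2: "awalk (head G e2) p2 (tail G e3)" and e3: "e3 \<in> arcs G"
      and w3: "awalk (head G e3) p3 y"
      using less.prems(1) unfolding 1(1) 2(1) 3(1)
      by (auto simp: awalk_append_iff awalk_Cons_iff)
    have r0: "reach G' w' N' 0 x (tail G e1) (sum_list (map w p0))" using walk[OF w0] 1(2) by simp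
    have r1: "reach G' w' N' 0 (head G e1) (tail G e2) (sum_list (map w p1))"
      using walk[OF w1] 2(2) by simp
    have a1: "reach G' w' N' 1 (tail G e1) (head G e1) (w e1)"
      using walk[OF arc_implies_awalk[OF e1]] 1(3) by simp
    have a3: "reach G' w' N' 1 (tail G e3) (head G e3) (w e3)"
      using walk[OF arc_implies_awalk[OF e3]] 3(3) by simp
    have r3: "reach G' w' N' (i - i div 3) (head G e3) y (sum_list (map w p3))"
      using less.IH[OF _ w3 3(4)] j by simp
    let ?c = "w e1 + sum_list (map w p1) + (w e2 + sum_list (map w p2) + w e3)"
    have "set p1 \<inter> N = {}" "set p2 \<inter> N = {}" using 2(2) 3(2) by (auto simp: filter_empty_conv)
    \<comment> \<open>The middle arc provides \<open>z\<close> and \<open>r\<close> for both of its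
      sides, so the shift by \<open>r\<close> cancels on a passage through \<open>z\<close>.\<close>
    then obtain z r where
      zin: "reach G' w' N' 0 (head G e1) z (sum_list (map w p1) - r) \<or>
        reach G' w' N' 1 (tail G e1) z (w e1 + sum_list (map w p1) - r)" and
      zout: "reach G' w' N' 0 z (tail G e3) (w e2 + sum_list (map w p2) + r) \<or>
        reach G' w' N' 1 (tail G e2) (head G e3) (w e2 + sum_list (map w p2) + w e3)"
      using byp[OF 2(3)] w1 w2 1(3) 3(3) unfolding bypassed_def by blast
    \<comment> \<open>If \<open>e2\<close> and \<open>e3\<close> merge, the two hops are
      \<open>e1\<close> and the merged arc. Otherwise one hop leads to \<open>z\<close>, through
      \<open>e1\<close> alone or through \<open>e1\<close> merged with \<open>e2\<close>, and
      \<open>e3\<close> is the second hop.\<close>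
    from zout have "reach G' w' N' 2 (tail G e1) (head G e3) ?c"
    proof
      assume "reach G' w' N' 1 (tail G e2) (head G e3) (w e2 + sum_list (map w p2) + w e3)"
      from tr[OF tr[OF a1 r1] this] show ?thesis by (elim reach_mono) auto
    next
      assume out: "reach G' w' N' 0 z (tail G e3) (w e2 + sum_list (map w p2) + r)"
      from zin have "reach G' w' N' 1 (tail G e1) z (w e1 + sum_list (map w p1) - r)"
        using tr[OF a1, of 0 z "sum_list (map w p1) - r"] by (auto simp: add_diff_eq)
      from tr[OF tr[OF this out] a3] show ?thesis by (elim reach_mono) auto
    qed
    from tr[OF tr[OF r0 this] r3] show ?thesis
      by (elim reach_mono) (auto simp: 1(1) 2(1) 3(1) j)
  qed
qed

text \<open>The potential \<open>\<phi>\<close> makes every arc of the new graph the contraction of a walk of the old one.\<close>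

lemma shortcut_graphI:
  assumes wf: "wf_digraph G" and ext: "extends_graph G w G' w'"
    and N: "N \<subseteq> arcs G" "N \<subseteq> N'" "N' \<subseteq> arcs G'" "N' \<inter> arcs G \<subseteq> N"
    and nonneg: "\<And>e. e \<in> arcs G' - N' \<Longrightarrow> 0 \<le> w' e"
    and tails: "\<And>e. e \<in> N' \<Longrightarrow> tail G' e \<in> negative_vertices G N"
    and base: "\<And>x. x \<in> verts G \<Longrightarrow> base x = x \<and> \<phi> x = 0"
    and sound: "\<And>e. e \<in> arcs G' \<Longrightarrow> \<exists>p. pre_digraph.awalk G (base (tail G' e)) p (base (head G' e)) \<and>
      sum_list (map w p) = w' e + \<phi> (head G' e) - (\<phi> (tail G' e) :: real)"
    and byp: "\<And>e. e \<in> N \<Longrightarrow> bypassed G w N G' w' N' e"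
    and card: "card (verts G') = card (verts G) + card (negative_vertices G N)"
  shows "shortcut_graph G w N G' w' N'"
proof -
  interpret wf_digraph G by (fact wf)
  interpret G': wf_digraph G' using ext by (simp add: extends_graph_def)
  \<comment> \<open>The walks behind the single arcs concatenate and the potential differences
    telescope. Between two vertices of \<open>G\<close> they vanish, so no distance
    decreases.\<close>
  have lift: "\<exists>q. awalk (base x) q (base y) \<and> sum_list (map w q) = sum_list (map w' p) + \<phi> y - \<phi> x"
    if "G'.awalk x p y" "base x \<in> verts G" for x p y
    using that
  proof (induction p arbitrary: x)
    case Nil
    then show ?case by (auto simp: G'.awalk_Nil_iff awalk_Nil_iff intro!: exI[of _ "[]"])
  next
    case (Cons a p)
    then have a: "a \<in> arcs G'" "x = tail G' a" "G'.awalk (head G' a) p y"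
      by (auto simp: G'.awalk_Cons_iff)
    from sound[OF a(1)] obtain q1 where q1: "awalk (base x) q1 (base (head G' a))"
      "sum_list (map w q1) = w' a + \<phi> (head G' a) - \<phi> x" using a(2) by auto
    then have "base (head G' a) \<in> verts G" by (auto dest: awalk_last_in_verts)
    from Cons.IH[OF a(3) this] obtain q2 where "awalk (base (head G' a)) q2 (base y)"
      "sum_list (map w q2) = sum_list (map w' p) + \<phi> y - \<phi> (head G' a)" by auto
    with q1 show ?case by (intro exI[of _ "q1 @ q2"]) auto
  qed
  have mu: "G'.\<mu> w' x y = \<mu> w x y" if xy: "x \<in> verts G" "y \<in> verts G" for x y
  proof (rule antisym)
    show "G'.\<mu> w' x y \<le> \<mu> w x y"
      unfolding \<mu>_def G'.\<mu>_def awalk_cost_def G'.awalk_cost_def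
    proof (rule INF_mono)
      fix p assume "p \<in> {p. awalk x p y}"
      then show "\<exists>q\<in>{p. G'.awalk x p y}. ereal (sum_list (map w' q)) \<le> ereal (sum_list (map w p))"
        using extends_graph_awalk[OF ext, of x p y] by force
    qed
    show "\<mu> w x y \<le> G'.\<mu> w' x y"
      unfolding \<mu>_def G'.\<mu>_def awalk_cost_def G'.awalk_cost_def
    proof (rule INF_mono)
      fix p assume "p \<in> {p. G'.awalk x p y}"
      with lift[of x p y] base xy obtain q where "awalk x q y" "sum_list (map w q) = sum_list (map w' p)"
        by auto
      then show "\<exists>q\<in>{p. awalk x p y}. ereal (sum_list (map w q)) \<le> ereal (sum_list (map w' p))"
        by force
    qed
  qed
  have hop: "hop_dist G' w' N' (h - h div 3) x y \<le> hop_dist G w N h x y" for h x y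
    unfolding hop_dist_def awalk_cost_def G'.awalk_cost_def
  proof (rule INF_mono)
    fix p assume "p \<in> {p. awalk x p y \<and> length (filter (\<lambda>e. e \<in> N) p) \<le> h}"
    then have p: "awalk x p y" and h: "length (filter (\<lambda>e. e \<in> N) p) \<le> h" by auto
    define j where "j = length (filter (\<lambda>e. e \<in> N) p)"
    have "j \<le> h" using h by (simp add: j_def)
    then have "j - j div 3 \<le> h - h div 3" by (rule sub_div_3_mono)
    then have "reach G' w' N' (h - h div 3) x y (sum_list (map w p))"
      using bypassed_hops[OF wf ext N(4) byp p j_def[symmetric]] by (auto elim: reach_mono)
    then show "\<exists>q\<in>{p. G'.awalk x p y \<and> length (filter (\<lambda>e. e \<in> N') p) \<le> h - h div 3}.
        ereal (sum_list (map w' q)) \<le> ereal (sum_list (map w p))"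
      unfolding reach_def by auto
  qed
  have "negative_vertices G N \<subseteq> tail G' ` N'"
  proof
    fix v assume "v \<in> negative_vertices G N"
    then obtain e where e: "e \<in> arcs G" "e \<in> N" "tail G e = v"
      by (auto simp: negative_vertices_def out_arcs_def)
    then have "tail G' e = v" using ext by (auto simp: extends_graph_def)
    then show "v \<in> tail G' ` N'" using e N(2) by auto
  qed
  then have "tail G' ` N' = negative_vertices G N" using tails by auto
  then show ?thesis
    unfolding shortcut_graph_def using ext N nonneg mu hop card by auto
qed

subsection \<open>Two searches in lockstep\<close>

text \<open>The status \<open>st x\<close> is 0 for unreached, 1 for tentative and 2 for settled vertices.\<close>

definition side_inv ::
  "nat set \<Rightarrow> (nat \<Rightarrow> nat \<Rightarrow> bool) \<Rightarrow> (nat \<Rightarrow> nat \<Rightarrow> real) \<Rightarrow> (nat \<Rightarrow> real \<Rightarrow> bool) \<Rightarrow>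
   nat \<Rightarrow> real \<Rightarrow> (nat \<Rightarrow> nat) \<Rightarrow> (nat \<Rightarrow> real) \<Rightarrow> bool" where
  "side_inv X P W S src c st d \<longleftrightarrow>
     (\<forall>x\<in>X. st x \<le> 2 \<and> (st x \<noteq> 0 \<longrightarrow> S x (d x))) \<and> src \<in> X \<and> st src \<noteq> 0 \<and> d src \<le> c \<and>
     (\<forall>y\<in>X. \<forall>x\<in>X. st y = 2 \<and> P y x \<longrightarrow> st x \<noteq> 0 \<and> d x \<le> d y + W y x) \<and>
     (\<forall>y\<in>X. \<forall>x\<in>X. st y = 2 \<and> st x = 1 \<longrightarrow> d y \<le> d x)"

lemma side_invD:
  assumes "side_inv X P W S src c st d"
  shows "x \<in> X \<Longrightarrow> st x \<le> 2" "x \<in> X \<Longrightarrow> st x \<noteq> 0 \<Longrightarrow> S x (d x)"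
    "src \<in> X" "st src \<noteq> 0" "d src \<le> c"
    "y \<in> X \<Longrightarrow> x \<in> X \<Longrightarrow> st y = 2 \<Longrightarrow> P y x \<Longrightarrow> st x \<noteq> 0"
    "y \<in> X \<Longrightarrow> x \<in> X \<Longrightarrow> st y = 2 \<Longrightarrow> P y x \<Longrightarrow> d x \<le> d y + W y x"
  using assms unfolding side_inv_def by blast+

section \<open>Settling one vertex\<close>

definition improves ::
  "(nat \<Rightarrow> nat \<Rightarrow> bool) \<Rightarrow> (nat \<Rightarrow> nat \<Rightarrow> real) \<Rightarrow> nat \<Rightarrow> (nat \<Rightarrow> nat) \<Rightarrow> (nat \<Rightarrow> real) \<Rightarrow> nat \<Rightarrow> bool"
  where "improves P W y st d x \<longleftrightarrow> P y x \<and> st x < 2 \<and> (st x = 0 \<or> d y + W y x < d x)"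

text \<open>The effect of a whole relaxation loop at once. As \<open>y\<close> already counts as
  settled, \<open>d y\<close> stays fixed and the updates of different \<open>x\<close> do not
  interact. With \<open>X\<close> an initial segment of the range, the same formula is the loop
  invariant.\<close>

definition settle_st ::
  "nat set \<Rightarrow> (nat \<Rightarrow> nat \<Rightarrow> bool) \<Rightarrow> (nat \<Rightarrow> nat \<Rightarrow> real) \<Rightarrow> nat \<Rightarrow> (nat \<Rightarrow> nat) \<Rightarrow> (nat \<Rightarrow> real) \<Rightarrow>
   nat \<Rightarrow> nat" where
  "settle_st X P W y st d =
     (\<lambda>x. if x \<in> X \<and> improves P W y (st(y := 2)) d x then 1 else (st(y := 2)) x)"

definition settle_d ::
  "nat set \<Rightarrow> (nat \<Rightarrow> nat \<Rightarrow> bool) \<Rightarrow> (nat \<Rightarrow> nat \<Rightarrow> real) \<Rightarrow> nat \<Rightarrow> (nat \<Rightarrow> nat) \<Rightarrow> (nat \<Rightarrow> real) \<Rightarrow>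
   nat \<Rightarrow> real" where
  "settle_d X P W y st d =
     (\<lambda>x. if x \<in> X \<and> improves P W y (st(y := 2)) d x then d y + W y x else d x)"

lemma settle_outside:
  assumes "x \<notin> X" "y \<in> X"
  shows "settle_st X P W y st d x = st x" "settle_d X P W y st d x = d x"
  using assms by (auto simp: settle_st_def settle_d_def)

lemma settle_eq_2_iff: "settle_st X P W y st d x = 2 \<longleftrightarrow> st x = 2 \<or> x = y"
  by (auto simp: settle_st_def improves_def)

lemma settle_d_settled: "st x = 2 \<or> x = y \<Longrightarrow> settle_d X P W y st d x = d x"
  by (auto simp: settle_d_def improves_def)

text \<open>\<open>S x a\<close> stands for "some walk to \<open>x\<close> has cost
  \<open>a\<close>" and is closed under relaxation. The order between settled and tentative labels
  rests on non-negative weights: no label obtained from the minimal \<open>y\<close> falls below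
  \<open>d y\<close>, which is at least every settled label.\<close>

lemma side_inv_settle:
  assumes inv: "side_inv X P W S src c st d" and y: "y \<in> X" "st y = 1"
    and min: "\<And>x. x \<in> X \<Longrightarrow> st x = 1 \<Longrightarrow> d y \<le> d x"
    and W: "\<And>x. x \<in> X \<Longrightarrow> P y x \<Longrightarrow> 0 \<le> W y x"
    and S: "\<And>x a. x \<in> X \<Longrightarrow> P y x \<Longrightarrow> S y a \<Longrightarrow> S x (a + W y x)"
  shows "side_inv X P W S src c (settle_st X P W y st d) (settle_d X P W y st d)"
proof -
  let ?st = "settle_st X P W y st d" and ?d = "settle_d X P W y st d"
  let ?imp = "improves P W y (st(y := 2)) d"
  have le2: "st x \<le> 2" and snd: "st x \<noteq> 0 \<Longrightarrow> S x (d x)" if "x \<in> X" for x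
    using inv that by (auto simp: side_inv_def)
  have clos: "st x \<noteq> 0" "d x \<le> d z + W z x" if "z \<in> X" "x \<in> X" "st z = 2" "P z x" for z x
    using inv that by (auto simp: side_inv_def)
  have ord: "d z \<le> d x" if "z \<in> X" "x \<in> X" "st z = 2" "st x = 1" for z x
    using inv that by (auto simp: side_inv_def)
  have st0: "?st x \<noteq> 0" if "st x \<noteq> 0" for x using that by (auto simp: settle_st_def)
  have dle: "?d x \<le> d x" if "st x \<noteq> 0" for x
    using that by (auto simp: settle_d_def improves_def)
  have st1: "d y \<le> ?d x" if x: "?st x = 1" "x \<in> X" for x
  proof (cases "?imp x")
    case True
    then show ?thesis using W[of x] x by (simp add: settle_d_def improves_def)
  next
    case False
    then have "st x = 1" using x by (auto simp: settle_st_def split: if_splits)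
    then show ?thesis using False min[OF x(2)] by (simp add: settle_d_def)
  qed
  have zy: "d z \<le> d y" if "z \<in> X" "st z = 2" for z using ord[of z y] that y by auto
  show ?thesis
    unfolding side_inv_def
  proof (intro conjI ballI impI)
    fix x assume x: "x \<in> X"
    show "?st x \<le> 2" using le2[OF x] by (auto simp: settle_st_def)
    show "S x (?d x)" if "?st x \<noteq> 0"
    proof (cases "?imp x")
      case True
      then show ?thesis using S[OF x] snd[OF y(1)] y x by (simp add: settle_d_def improves_def)
    next
      case False
      then have "st x \<noteq> 0" using that y by (auto simp: settle_st_def split: if_splits)
      then show ?thesis using False snd[OF x] by (simp add: settle_d_def)
    qed
  next
    show "src \<in> X" using inv by (simp add: side_inv_def)
    have "st src \<noteq> 0" "d src \<le> c" using inv by (simp_all add: side_inv_def)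
    then show "?st src \<noteq> 0" "?d src \<le> c" using st0 dle[of src] by auto
  next
    fix z x assume zx: "z \<in> X" "x \<in> X" and "?st z = 2 \<and> P z x"
    then have z: "st z = 2 \<or> z = y" "P z x" by (auto simp: settle_eq_2_iff)
    show "?st x \<noteq> 0"
      using z clos(1)[OF zx] st0[of x] y zx by (cases "z = y") (auto simp: settle_st_def improves_def)
    have "?d x \<le> d z + W z x"
    proof (cases "z = y")
      case False
      then show ?thesis using z clos[OF zx] dle[of x] by fastforce
    next
      case True
      show ?thesis
      \<comment> \<open>A settled \<open>x\<close> is not relaxed, but \<open>d x \<le> d y\<close>
        because \<open>y\<close> was tentative, and the weight is non-negative.\<close>
      proof (cases "st x = 2")
        case True
        then show ?thesis using \<open>z = y\<close> zy[OF zx(2)] W[OF zx(2)] z by (auto simp: settle_d_settled)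
      next
        case False
        then show ?thesis using \<open>z = y\<close> z(2) zx le2[OF zx(2)] W[OF zx(2)]
          by (auto simp: settle_d_def improves_def)
      qed
    qed
    then show "?d x \<le> ?d z + W z x" using z(1) by (simp add: settle_d_settled)
  next
    fix z x assume zx: "z \<in> X" "x \<in> X" and "?st z = 2 \<and> ?st x = 1"
    then have z: "st z = 2 \<or> z = y" "?st x = 1" by (auto simp: settle_eq_2_iff)
    then show "?d z \<le> ?d x" using st1[OF z(2) zx(2)] zy[OF zx(1)] by (auto simp: settle_d_settled)
  qed
qed

text \<open>One pair of arrays holds both searches, the forward one on \<open>{0..<n}\<close> and
  the backward one on \<open>{n..<n + n}\<close>. The bound on the number of rounds rests on the
  last two conjuncts.\<close>

definition lockstep_inv ::
  "nat \<Rightarrow> (nat \<Rightarrow> nat \<Rightarrow> bool) \<Rightarrow> (nat \<Rightarrow> nat \<Rightarrow> real) \<Rightarrow> (nat \<Rightarrow> real \<Rightarrow> bool) \<Rightarrow>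
   nat \<Rightarrow> real \<Rightarrow> nat \<Rightarrow> (nat \<Rightarrow> nat) \<Rightarrow> (nat \<Rightarrow> real) \<Rightarrow> bool" where
  "lockstep_inv n P W S v c u st d \<longleftrightarrow>
     side_inv {0..<n} P W S v c st d \<and> side_inv {n..<n + n} P W S (n + u) 0 st d \<and>
     (\<forall>x\<in>{0..<n}. \<forall>y\<in>{n..<n + n}. st x = 2 \<and> st y = 2 \<longrightarrow> d x + d y < 0) \<and>
     card {x\<in>{0..<n}. st x = 2} = card {x\<in>{n..<n + n}. st x = 2}"

lemma lockstep_invD:
  assumes "lockstep_inv n P W S v c u st d"
  shows "side_inv {0..<n} P W S v c st d" "side_inv {n..<n + n} P W S (n + u) 0 st d"
    "x \<in> {0..<n} \<Longrightarrow> y \<in> {n..<n + n} \<Longrightarrow> st x = 2 \<Longrightarrow> st y = 2 \<Longrightarrow> d x + d y < 0"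
    "card {x\<in>{0..<n}. st x = 2} = card {x\<in>{n..<n + n}. st x = 2}"
  using assms unfolding lockstep_inv_def by blast+

lemma side_inv_cong:
  assumes "side_inv X P W S src c st d" "\<And>x. x \<in> X \<Longrightarrow> st' x = st x" "\<And>x. x \<in> X \<Longrightarrow> d' x = d x"
  shows "side_inv X P W S src c st' d'"
  using assms unfolding side_inv_def by (auto 0 3)

lemma card_settle:
  assumes "finite X" "y \<in> X" "st y = 1"
  shows "card {x\<in>X. settle_st Y P W y st d x = 2} = Suc (card {x\<in>X. st x = 2})"
proof -
  have "{x\<in>X. settle_st Y P W y st d x = 2} = insert y {x\<in>X. st x = 2}"
    using assms by (auto simp: settle_eq_2_iff)
  then show ?thesis using assms by simp
qed

text \<open>The index ranges are disjoint, so the two settlings do not interfere. Knowing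
  \<open>d z + d y < 0\<close> suffices for all new pairs, since \<open>d z\<close> and
  \<open>d y\<close> become the largest settled labels of their sides.\<close>

lemma lockstep_inv_settle:
  assumes inv: "lockstep_inv n P W S v c u st d"
    and y: "y \<in> {n..<n + n}" "st y = 1" and ymin: "\<And>x. x \<in> {n..<n + n} \<Longrightarrow> st x = 1 \<Longrightarrow> d y \<le> d x"
    and z: "z \<in> {0..<n}" "st z = 1" and zmin: "\<And>x. x \<in> {0..<n} \<Longrightarrow> st x = 1 \<Longrightarrow> d z \<le> d x"
    and neg: "d z + d y < 0"
    and W: "\<And>y x. y < n + n \<Longrightarrow> x < n + n \<Longrightarrow> P y x \<Longrightarrow> 0 \<le> W y x"
    and S: "\<And>y x a. y < n + n \<Longrightarrow> x < n + n \<Longrightarrow> P y x \<Longrightarrow> S y a \<Longrightarrow> S x (a + W y x)"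
    and st1: "st1 = settle_st {n..<n + n} P W y st d" and d1: "d1 = settle_d {n..<n + n} P W y st d"
    and st2: "st2 = settle_st {0..<n} P W z st1 d1" and d2: "d2 = settle_d {0..<n} P W z st1 d1"
  shows "lockstep_inv n P W S v c u st2 d2"
    and "card {x\<in>{0..<n}. st2 x = 2} = Suc (card {x\<in>{0..<n}. st x = 2})"
proof -
  let ?O = "{0..<n}" and ?I = "{n..<n + n}"
  have iO: "side_inv ?O P W S v c st d" and iI: "side_inv ?I P W S (n + u) 0 st d"
    and pairs: "\<And>x y. x \<in> ?O \<Longrightarrow> y \<in> ?I \<Longrightarrow> st x = 2 \<Longrightarrow> st y = 2 \<Longrightarrow> d x + d y < 0"
    and card: "card {x\<in>?O. st x = 2} = card {x\<in>?I. st x = 2}"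
    using inv by (auto simp: lockstep_inv_def)
  have I1: "side_inv ?I P W S (n + u) 0 st1 d1"
    unfolding st1 d1 by (rule side_inv_settle[OF iI y ymin]) (use y W S in auto)
  have same1: "st1 x = st x" "d1 x = d x" if "x \<in> ?O" for x
    using that y by (auto simp: st1 d1 settle_outside)
  have O1: "side_inv ?O P W S v c st1 d1" by (rule side_inv_cong[OF iO]) (use same1 in auto)
  have "st1 z = 1" using same1 z by simp
  have O2: "side_inv ?O P W S v c st2 d2"
    unfolding st2 d2 by (rule side_inv_settle[OF O1]) (use z same1 zmin W S in auto)
  have same2: "st2 x = st1 x" "d2 x = d1 x" if "x \<in> ?I" for x
    using that z by (auto simp: st2 d2 settle_outside)
  have I2: "side_inv ?I P W S (n + u) 0 st2 d2" by (rule side_inv_cong[OF I1]) (use same2 in auto)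
  have cardO: "card {x\<in>?O. st2 x = 2} = Suc (card {x\<in>?O. st x = 2})"
  proof -
    have "card {x\<in>?O. st2 x = 2} = Suc (card {x\<in>?O. st1 x = 2})"
      unfolding st2 by (rule card_settle) (use z \<open>st1 z = 1\<close> in auto)
    moreover have "{x\<in>?O. st1 x = 2} = {x\<in>?O. st x = 2}" using same1 by auto
    ultimately show ?thesis by simp
  qed
  have cardI: "card {x\<in>?I. st2 x = 2} = Suc (card {x\<in>?I. st x = 2})"
  proof -
    have "card {x\<in>?I. st1 x = 2} = Suc (card {x\<in>?I. st x = 2})"
      unfolding st1 by (rule card_settle) (use y in auto)
    moreover have "{x\<in>?I. st2 x = 2} = {x\<in>?I. st1 x = 2}" using same2 by auto
    ultimately show ?thesis by simp
  qed
  have "d2 a + d2 b < 0" if ab: "a \<in> ?O" "b \<in> ?I" "st2 a = 2" "st2 b = 2" for a b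
  proof -
    have a: "st a = 2 \<or> a = z" "d2 a = d a"
      using ab same1[of a] by (auto simp: st2 d2 settle_eq_2_iff settle_d_settled)
    have b: "st b = 2 \<or> b = y" "d2 b = d b"
      using ab same2[of b] by (auto simp: st1 d1 settle_eq_2_iff settle_d_settled)
    have "d a \<le> d z" using a ab z iO by (auto simp: side_inv_def)
    moreover have "d b \<le> d y" using b ab y iI by (auto simp: side_inv_def)
    ultimately show ?thesis using a b neg by simp
  qed
  then show "lockstep_inv n P W S v c u st2 d2"
    unfolding lockstep_inv_def using O2 I2 cardO cardI card by auto
  show "card {x\<in>?O. st2 x = 2} = Suc (card {x\<in>?O. st x = 2})" by (fact cardO)
qed

subsection \<open>The search program\<close>

abbreviation seq_com (infixr ";;" 60) where "c ;; d \<equiv> Seq c d"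
abbreviation "TOr b c \<equiv> TNot (TAnd (TNot b) (TNot c))"
abbreviation "Nonzero e \<equiv> NLess (NConst 0) e"
abbreviation "Zero e \<equiv> TNot (Nonzero e)"

text \<open>A scan instead of a priority queue: settling a vertex looks at \<open>n\<close> matrix
  entries anyway.\<close>

definition find_min :: com where
  "find_min =
     NAssign ''f'' (NConst 0) ;;
     For ''x'' (NVar ''lo'') (NAdd (NVar ''lo'') (NVar ''nn''))
       (If (TAnd (TAnd (Nonzero (NArr ''st'' (NVar ''x''))) (NLess (NArr ''st'' (NVar ''x'')) (NConst 2)))
                 (TOr (Zero (NVar ''f'')) (RLess (RArr ''d'' (NVar ''x'')) (RArr ''d'' (NVar ''y'')))))
          (NAssign ''f'' (NConst 1) ;; NAssign ''y'' (NVar ''x''))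
          Skip)"

definition settle :: com where
  "settle =
     NStore ''st'' (NVar ''y'') (NConst 2) ;;
     For ''x'' (NVar ''lo'') (NAdd (NVar ''lo'') (NVar ''nn''))
       (NAssign ''i'' (NAdd (NArr ''off'' (NVar ''y'')) (NVar ''x'')) ;;
        If (TAnd (TAnd (Nonzero (NArr ''P'' (NVar ''i''))) (NLess (NArr ''st'' (NVar ''x'')) (NConst 2)))
                 (TOr (Zero (NArr ''st'' (NVar ''x'')))
                      (RLess (RAdd (RArr ''d'' (NVar ''y'')) (RArr ''W'' (NVar ''i''))) (RArr ''d'' (NVar ''x'')))))
          (NStore ''st'' (NVar ''x'') (NConst 1) ;;
           RStore ''d'' (NVar ''x'') (RAdd (RArr ''d'' (NVar ''y'')) (RArr ''W'' (NVar ''i''))))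
          Skip)"

text \<open>When the test fails, \<open>r\<close> is the least tentative distance of the backward
  search, or minus that of the forward search if the former has no tentative vertex. If neither has
  one, the value of \<open>r\<close> is arbitrary and \<open>threshold\<close> holds
  vacuously.\<close>

definition advance :: com where
  "advance =
     NAssign ''lo'' (NConst 0) ;; find_min ;; NAssign ''fo'' (NVar ''f'') ;; NAssign ''yo'' (NVar ''y'') ;;
     NAssign ''lo'' (NVar ''nn'') ;; find_min ;;
     If (TAnd (TAnd (Nonzero (NVar ''fo'')) (Nonzero (NVar ''f'')))
              (RLess (RAdd (RArr ''d'' (NVar ''yo'')) (RArr ''d'' (NVar ''y''))) (RConst 0)))
       (settle ;; NAssign ''lo'' (NConst 0) ;; NAssign ''y'' (NVar ''yo'') ;; settle)
       (NAssign ''go'' (NConst 0) ;;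
        If (Nonzero (NVar ''f'')) (RAssign ''r'' (RArr ''d'' (NVar ''y'')))
          (RAssign ''r'' (RSub (RConst 0) (RArr ''d'' (NVar ''yo'')))))"

lemma find_min_spec:
  assumes "X = {nvar s ''lo''..<nvar s ''lo'' + nvar s ''nn''}"
  shows "\<exists>t. runs find_min s (3 + 6 * nvar s ''nn'') t \<and> frame find_min s t \<and>
    (if nvar t ''f'' = 0 then \<forall>x\<in>X. narr s ''st'' x \<noteq> 1
     else nvar t ''y'' \<in> X \<and> narr s ''st'' (nvar t ''y'') = 1 \<and>
       (\<forall>x\<in>X. narr s ''st'' x = 1 \<longrightarrow> rarr s ''d'' (nvar t ''y'') \<le> rarr s ''d'' x))"
proof -
  let ?lo = "nvar s ''lo''" and ?nn = "nvar s ''nn''"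
  let ?c = "If (TAnd (TAnd (Nonzero (NArr ''st'' (NVar ''x''))) (NLess (NArr ''st'' (NVar ''x'')) (NConst 2)))
                 (TOr (Zero (NVar ''f'')) (RLess (RArr ''d'' (NVar ''x'')) (RArr ''d'' (NVar ''y'')))))
          (NAssign ''f'' (NConst 1) ;; NAssign ''y'' (NVar ''x'')) Skip"
  let ?F = "For ''x'' (NVar ''lo'') (NAdd (NVar ''lo'') (NVar ''nn'')) ?c"
  let ?s = "s\<lparr>nvar := (nvar s)(''f'' := 0)\<rparr>"
  let ?I = "\<lambda>i t. if nvar t ''f'' = 0 then \<forall>x\<in>{?lo..<i}. narr s ''st'' x \<noteq> 1
     else nvar t ''y'' \<in> {?lo..<i} \<and> narr s ''st'' (nvar t ''y'') = 1 \<and>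
       (\<forall>x\<in>{?lo..<i}. narr s ''st'' x = 1 \<longrightarrow> rarr s ''d'' (nvar t ''y'') \<le> rarr s ''d'' x)"
  have "\<exists>t. runs ?F ?s (2 + (steps ?c + 2) * (?lo + ?nn - ?lo)) t \<and> ?I (?lo + ?nn) t \<and> frame ?F ?s t"
  proof (rule For_rule_const[where I = ?I])
    fix i t
    assume fr: "frame ?F ?s t" and i: "?lo \<le> i" "i < ?lo + ?nn" "nvar t ''x'' = i" and I: "?I i t"
    have eq: "narr t ''st'' = narr s ''st''" "rarr t ''d'' = rarr s ''d''"
      using fr by (simp_all add: frame_def)
    have set: "{?lo..<Suc i} = insert i {?lo..<i}" using i by auto
    show "?I (Suc i) ((run ?c t)\<lparr>nvar := (nvar (run ?c t))(''x'' := Suc i)\<rparr>)"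
    proof (cases "narr s ''st'' i = 1 \<and> (nvar t ''f'' = 0 \<or> rarr s ''d'' i < rarr s ''d'' (nvar t ''y''))")
      case True
      then have "run ?c t = t\<lparr>nvar := (nvar t)(''f'' := 1, ''y'' := i)\<rparr>"
        using eq i by auto
      then show ?thesis using True I unfolding set by (fastforce split: if_splits)
    next
      case False
      then have "\<not> tval (TAnd (TAnd (Nonzero (NArr ''st'' (NVar ''x''))) (NLess (NArr ''st'' (NVar ''x'')) (NConst 2)))
                 (TOr (Zero (NVar ''f'')) (RLess (RArr ''d'' (NVar ''x'')) (RArr ''d'' (NVar ''y''))))) t"
        using eq i by (simp; linarith)
      then have rc: "run ?c t = t" by (simp only: run.simps if_False)
      show ?thesis using False I unfolding set rc by (auto split: if_splits)
    qed
  qed (auto simp: frame_def)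
  then obtain t where t: "runs ?F ?s (2 + (steps ?c + 2) * (?lo + ?nn - ?lo)) t" "?I (?lo + ?nn) t" by blast
  have "runs (NAssign ''f'' (NConst 0)) s 1 ?s"
    using runs_run[of "NAssign ''f'' (NConst 0)" s] by simp
  from runs_Seq[OF this t(1)] have "runs find_min s (3 + 6 * ?nn) t"
    unfolding find_min_def by (rule runs_mono) simp
  then show ?thesis using t(2) runs_frame unfolding assms by blast
qed

lemma settle_spec:
  assumes X: "X = {nvar s ''lo''..<nvar s ''lo'' + nvar s ''nn''}"
    and P: "\<And>x. P (nvar s ''y'') x \<longleftrightarrow> narr s ''P'' (narr s ''off'' (nvar s ''y'') + x) \<noteq> 0"
    and W: "\<And>x. W (nvar s ''y'') x = rarr s ''W'' (narr s ''off'' (nvar s ''y'') + x)"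
  shows "\<exists>t. runs settle s (3 + 7 * nvar s ''nn'') t \<and> frame settle s t \<and>
    narr t ''st'' = settle_st X P W (nvar s ''y'') (narr s ''st'') (rarr s ''d'') \<and>
    rarr t ''d'' = settle_d X P W (nvar s ''y'') (narr s ''st'') (rarr s ''d'')"
proof -
  let ?lo = "nvar s ''lo''" and ?nn = "nvar s ''nn''" and ?y = "nvar s ''y''"
  let ?st = "narr s ''st''" and ?d = "rarr s ''d''"
  let ?b = "TAnd (TAnd (Nonzero (NArr ''P'' (NVar ''i''))) (NLess (NArr ''st'' (NVar ''x'')) (NConst 2)))
                 (TOr (Zero (NArr ''st'' (NVar ''x'')))
                      (RLess (RAdd (RArr ''d'' (NVar ''y'')) (RArr ''W'' (NVar ''i''))) (RArr ''d'' (NVar ''x''))))"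
  let ?c = "NAssign ''i'' (NAdd (NArr ''off'' (NVar ''y'')) (NVar ''x'')) ;;
        If ?b
          (NStore ''st'' (NVar ''x'') (NConst 1) ;;
           RStore ''d'' (NVar ''x'') (RAdd (RArr ''d'' (NVar ''y'')) (RArr ''W'' (NVar ''i''))))
          Skip"
  let ?F = "For ''x'' (NVar ''lo'') (NAdd (NVar ''lo'') (NVar ''nn'')) ?c"
  let ?s = "s\<lparr>narr := (narr s)(''st'' := ?st(?y := 2))\<rparr>"
  let ?I = "\<lambda>i t. narr t ''st'' = settle_st {?lo..<i} P W ?y ?st ?d \<and>
    rarr t ''d'' = settle_d {?lo..<i} P W ?y ?st ?d"
  have "\<exists>t. runs ?F ?s (2 + (steps ?c + 2) * (?lo + ?nn - ?lo)) t \<and> ?I (?lo + ?nn) t \<and> frame ?F ?s t"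
  proof (rule For_rule_const[where I = ?I])
    show "?I ?lo (?s\<lparr>nvar := (nvar ?s)(''x'' := ?lo)\<rparr>)"
      by (auto simp: settle_st_def settle_d_def)
    fix i t
    assume fr: "frame ?F ?s t" and i: "?lo \<le> i" "i < ?lo + ?nn" "nvar t ''x'' = i" and I: "?I i t"
    have eq: "narr t ''off'' = narr s ''off''" "narr t ''P'' = narr s ''P''" "rarr t ''W'' = rarr s ''W''"
      "nvar t ''y'' = ?y"
      using fr by (simp_all add: frame_def)
    have sti: "narr t ''st'' i = (?st(?y := 2)) i" "rarr t ''d'' i = ?d i"
      using I by (auto simp: settle_st_def settle_d_def)
    have dy: "rarr t ''d'' ?y = ?d ?y" using I by (simp add: settle_d_settled)
    let ?imp = "improves P W ?y (?st(?y := 2)) ?d i"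
    let ?t = "t\<lparr>nvar := (nvar t)(''i'' := narr s ''off'' ?y + i)\<rparr>"
    have b: "tval ?b ?t \<longleftrightarrow> ?imp"
      using eq sti dy i P W by (auto simp: improves_def)
    have rc: "run ?c t = (if ?imp then ?t\<lparr>narr := (narr t)(''st'' := (narr t ''st'')(i := 1)),
        rarr := (rarr t)(''d'' := (rarr t ''d'')(i := ?d ?y + W ?y i))\<rparr> else ?t)"
    proof -
      have "run ?c t = run (If ?b (NStore ''st'' (NVar ''x'') (NConst 1) ;;
           RStore ''d'' (NVar ''x'') (RAdd (RArr ''d'' (NVar ''y'')) (RArr ''W'' (NVar ''i'')))) Skip) ?t"
        using eq i by simp
      also have "\<dots> = (if ?imp then run (NStore ''st'' (NVar ''x'') (NConst 1) ;;
           RStore ''d'' (NVar ''x'') (RAdd (RArr ''d'' (NVar ''y'')) (RArr ''W'' (NVar ''i'')))) ?t else ?t)"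
        unfolding run.simps(7) b by simp
      finally show ?thesis using eq i dy W by simp
    qed
    have set: "{?lo..<Suc i} = insert i {?lo..<i}" using i by auto
    show "?I (Suc i) ((run ?c t)\<lparr>nvar := (nvar (run ?c t))(''x'' := Suc i)\<rparr>)"
      using I unfolding rc set by (auto simp: settle_st_def settle_d_def fun_eq_iff)
  qed (auto simp: frame_def)
  then obtain t where t: "runs ?F ?s (2 + (steps ?c + 2) * (?lo + ?nn - ?lo)) t" "?I (?lo + ?nn) t" by blast
  have "runs (NStore ''st'' (NVar ''y'') (NConst 2)) s 1 ?s"
    using runs_run[of "NStore ''st'' (NVar ''y'') (NConst 2)" s] by simp
  from runs_Seq[OF this t(1)] have "runs settle s (3 + 7 * ?nn) t"
    unfolding settle_def by (rule runs_mono) simp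
  then show ?thesis using t(2) runs_frame unfolding X by blast
qed

text \<open>The arrays \<open>P\<close> (presence) and \<open>W\<close> (weight) hold a matrix with row offsets \<open>off\<close>.\<close>

definition mat_P :: "state \<Rightarrow> nat \<Rightarrow> nat \<Rightarrow> bool" where
  "mat_P s y x \<longleftrightarrow> narr s ''P'' (narr s ''off'' y + x) \<noteq> 0"

definition mat_W :: "state \<Rightarrow> nat \<Rightarrow> nat \<Rightarrow> real" where
  "mat_W s y x = rarr s ''W'' (narr s ''off'' y + x)"

text \<open>These are the conditions under which arcs between the detour vertex and the frontiers
  have non-negative weight once they are shifted by \<open>r\<close>.\<close>

definition threshold :: "nat \<Rightarrow> real \<Rightarrow> (nat \<Rightarrow> nat) \<Rightarrow> (nat \<Rightarrow> real) \<Rightarrow> bool" where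
  "threshold n r st d \<longleftrightarrow>
     (\<forall>x\<in>{0..<n}. st x = 1 \<longrightarrow> 0 \<le> d x + r) \<and> (\<forall>x\<in>{n..<n + n}. st x = 1 \<longrightarrow> 0 \<le> d x - r)"

text \<open>A round either adds one settled vertex to each side or stops; the first alternative is
  the progress that bounds the number of rounds.\<close>

lemma advance_spec:
  assumes n: "nvar s ''nn'' = n"
    and inv: "lockstep_inv n (mat_P s) (mat_W s) S v c u (narr s ''st'') (rarr s ''d'')"
    and W: "\<And>y x. y < n + n \<Longrightarrow> x < n + n \<Longrightarrow> mat_P s y x \<Longrightarrow> 0 \<le> mat_W s y x"
    and S: "\<And>y x a. y < n + n \<Longrightarrow> x < n + n \<Longrightarrow> mat_P s y x \<Longrightarrow> S y a \<Longrightarrow> S x (a + mat_W s y x)"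
  shows "\<exists>t. runs advance s (20 + 26 * n) t \<and>
    lockstep_inv n (mat_P s) (mat_W s) S v c u (narr t ''st'') (rarr t ''d'') \<and>
    (nvar t ''go'' = nvar s ''go'' \<and>
       card {x\<in>{0..<n}. narr t ''st'' x = 2} = Suc (card {x\<in>{0..<n}. narr s ''st'' x = 2}) \<or>
     nvar t ''go'' = 0 \<and> threshold n (rvar t ''r'') (narr t ''st'') (rarr t ''d''))"
proof -
  let ?st = "narr s ''st''" and ?d = "rarr s ''d''" and ?P = "mat_P s" and ?W = "mat_W s"
  let ?O = "{0..<n}" and ?I = "{n..<n + n}"
  let ?A = "NAssign ''lo'' (NConst 0)"
  let ?s0 = "run ?A s"
  have r0: "runs ?A s 1 ?s0" by (rule runs_assign)
  have eq0: "narr ?s0 = narr s" "rarr ?s0 = rarr s" "nvar ?s0 ''nn'' = n" "nvar ?s0 ''lo'' = 0"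
    using n by simp_all
  obtain s1 where s1: "runs find_min ?s0 (3 + 6 * n) s1" "frame find_min ?s0 s1"
    and f1: "if nvar s1 ''f'' = 0 then \<forall>x\<in>?O. ?st x \<noteq> 1
     else nvar s1 ''y'' \<in> ?O \<and> ?st (nvar s1 ''y'') = 1 \<and>
       (\<forall>x\<in>?O. ?st x = 1 \<longrightarrow> ?d (nvar s1 ''y'') \<le> ?d x)"
    using find_min_spec[of ?O ?s0] unfolding eq0 add_0 by blast
  let ?fo = "nvar s1 ''f''" and ?yo = "nvar s1 ''y''"
  let ?B1 = "NAssign ''fo'' (NVar ''f'')" and ?B2 = "NAssign ''yo'' (NVar ''y'')"
    and ?B3 = "NAssign ''lo'' (NVar ''nn'')"
  let ?s2 = "run ?B3 (run ?B2 (run ?B1 s1))"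
  have r1: "runs ?B1 s1 1 (run ?B1 s1)" by (rule runs_assign)
  have r2: "runs ?B2 (run ?B1 s1) 1 (run ?B2 (run ?B1 s1))" by (rule runs_assign)
  have r3: "runs ?B3 (run ?B2 (run ?B1 s1)) 1 ?s2" by (rule runs_assign)
  have eq2: "narr ?s2 = narr s" "rarr ?s2 = rarr s" "nvar ?s2 ''nn'' = n" "nvar ?s2 ''lo'' = n"
    "nvar ?s2 ''go'' = nvar s ''go''" "nvar ?s2 ''fo'' = ?fo" "nvar ?s2 ''yo'' = ?yo"
    using s1(2) n by (simp_all add: frame_def find_min_def fun_eq_iff)
  obtain s3 where s3: "runs find_min ?s2 (3 + 6 * n) s3" "frame find_min ?s2 s3"
    and f3: "if nvar s3 ''f'' = 0 then \<forall>x\<in>?I. ?st x \<noteq> 1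
     else nvar s3 ''y'' \<in> ?I \<and> ?st (nvar s3 ''y'') = 1 \<and>
       (\<forall>x\<in>?I. ?st x = 1 \<longrightarrow> ?d (nvar s3 ''y'') \<le> ?d x)"
    using find_min_spec[of ?I ?s2] unfolding eq2 by blast
  let ?fi = "nvar s3 ''f''" and ?yi = "nvar s3 ''y''"
  have eq3: "narr s3 = narr s" "rarr s3 = rarr s" "nvar s3 ''nn'' = n" "nvar s3 ''lo'' = n"
    "nvar s3 ''go'' = nvar s ''go''" "nvar s3 ''fo'' = ?fo" "nvar s3 ''yo'' = ?yo"
    using s3(2) eq2 by (simp_all add: frame_def find_min_def fun_eq_iff)
  let ?b = "TAnd (TAnd (Nonzero (NVar ''fo'')) (Nonzero (NVar ''f'')))
              (RLess (RAdd (RArr ''d'' (NVar ''yo'')) (RArr ''d'' (NVar ''y''))) (RConst 0))"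
  let ?C = "settle ;; NAssign ''lo'' (NConst 0) ;; NAssign ''y'' (NVar ''yo'') ;; settle"
  let ?D = "NAssign ''go'' (NConst 0) ;;
        If (Nonzero (NVar ''f'')) (RAssign ''r'' (RArr ''d'' (NVar ''y'')))
          (RAssign ''r'' (RSub (RConst 0) (RArr ''d'' (NVar ''yo''))))"
  have b: "tval ?b s3 \<longleftrightarrow> ?fo \<noteq> 0 \<and> ?fi \<noteq> 0 \<and> ?d ?yo + ?d ?yi < 0" using eq3 by auto
  have fin: "runs advance s (20 + 26 * n) t" if "runs (If ?b ?C ?D) s3 (1 + (8 + 14 * n)) t" for t
    unfolding advance_def
    by (rule runs_mono[OF runs_Seq[OF r0 runs_Seq[OF s1(1) runs_Seq[OF r1 runs_Seq[OF r2
      runs_Seq[OF r3 runs_Seq[OF s3(1) that]]]]]]]) simp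
  show ?thesis
  proof (cases "tval ?b s3")
    case True
    then have neg: "?d ?yo + ?d ?yi < 0" and fo: "?fo \<noteq> 0" and fi: "?fi \<noteq> 0" using b by auto
    have yi: "?yi \<in> ?I" "?st ?yi = 1" "\<And>x. x \<in> ?I \<Longrightarrow> ?st x = 1 \<Longrightarrow> ?d ?yi \<le> ?d x"
      using f3 fi by auto
    have yo: "?yo \<in> ?O" "?st ?yo = 1" "\<And>x. x \<in> ?O \<Longrightarrow> ?st x = 1 \<Longrightarrow> ?d ?yo \<le> ?d x"
      using f1 fo by auto
    obtain s4 where s4: "runs settle s3 (3 + 7 * n) s4" "frame settle s3 s4"
      and st4: "narr s4 ''st'' = settle_st ?I ?P ?W ?yi ?st ?d"
      and d4: "rarr s4 ''d'' = settle_d ?I ?P ?W ?yi ?st ?d"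
      using settle_spec[of ?I s3 ?P ?W] unfolding eq3 mat_P_def mat_W_def by blast
    let ?E1 = "NAssign ''lo'' (NConst 0)" and ?E2 = "NAssign ''y'' (NVar ''yo'')"
    let ?s5 = "run ?E2 (run ?E1 s4)"
    have r4: "runs ?E1 s4 1 (run ?E1 s4)" by (rule runs_assign)
    have r5: "runs ?E2 (run ?E1 s4) 1 ?s5" by (rule runs_assign)
    have eq5: "nvar ?s5 ''nn'' = n" "nvar ?s5 ''lo'' = 0" "nvar ?s5 ''y'' = ?yo"
      "narr ?s5 ''st'' = settle_st ?I ?P ?W ?yi ?st ?d" "rarr ?s5 ''d'' = settle_d ?I ?P ?W ?yi ?st ?d"
      "narr ?s5 ''P'' = narr s ''P''" "narr ?s5 ''off'' = narr s ''off''" "rarr ?s5 ''W'' = rarr s ''W''"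
      "nvar ?s5 ''go'' = nvar s ''go''"
      using s4(2) st4 d4 eq3 by (simp_all add: frame_def settle_def)
    obtain s6 where s6: "runs settle ?s5 (3 + 7 * n) s6" "frame settle ?s5 s6"
      and st6: "narr s6 ''st'' = settle_st ?O ?P ?W ?yo (narr s4 ''st'') (rarr s4 ''d'')"
      and d6: "rarr s6 ''d'' = settle_d ?O ?P ?W ?yo (narr s4 ''st'') (rarr s4 ''d'')"
      using settle_spec[of ?O ?s5 ?P ?W] unfolding eq5 add_0 mat_P_def mat_W_def st4 d4 by blast
    note L = lockstep_inv_settle[OF inv yi yo neg W S st4 d4 st6 d6]
    have "nvar s6 ''go'' = nvar s ''go''" using s6(2) eq5 by (simp add: frame_def settle_def)
    moreover have "runs (If ?b ?C ?D) s3 (1 + (8 + 14 * n)) s6"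
      using True by (intro runs_If runs_mono[OF runs_Seq[OF s4(1) runs_Seq[OF r4 runs_Seq[OF r5 s6(1)]]]]) auto
    ultimately show ?thesis using fin L by blast
  next
    case False
    let ?t = "run ?D s3"
    have D: "runs ?D s3 (steps ?D) ?t" by (rule runs_run) simp
    have R: "runs (If ?b ?C ?D) s3 (1 + (8 + 14 * n)) ?t"
      by (rule runs_If, use False in blast, rule runs_mono[OF D]) simp
    have same: "narr ?t = narr s" "rarr ?t = rarr s" "nvar ?t ''go'' = 0"
      "rvar ?t ''r'' = (if ?fi \<noteq> 0 then ?d ?yi else - ?d ?yo)" using eq3 by simp_all
    have thr: "threshold n (rvar ?t ''r'') ?st ?d"
    proof (cases "?fi = 0")
      case True
      then show ?thesis using f1 f3 unfolding same threshold_def by (auto split: if_splits)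
    next
      case fi: False
      \<comment> \<open>The failed test leaves two possibilities: there is no tentative forward
        vertex, or the two minima have a non-negative sum.\<close>
      then have "\<forall>x\<in>?O. ?st x = 1 \<longrightarrow> 0 \<le> ?d x + ?d ?yi"
        using False f1 unfolding b by (auto split: if_splits)
      then show ?thesis using f3 fi unfolding same threshold_def by auto
    qed
    show ?thesis
      by (rule exI[of _ ?t], unfold same(1,2), intro conjI disjI2 fin[OF R] inv thr same(3))
  qed
qed

definition explore :: com where
  "explore = While (Nonzero (NVar ''go'')) advance"

text \<open>\<open>J\<close> bounds the settled vertices in every state that satisfies the
  invariant, and so it bounds the rounds without any reference to the execution.\<close>

lemma explore_spec:
  assumes n: "nvar s ''nn'' = n" and go: "nvar s ''go'' \<noteq> 0"
    and inv: "lockstep_inv n (mat_P s) (mat_W s) S v c u (narr s ''st'') (rarr s ''d'')"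
    and W: "\<And>y x. y < n + n \<Longrightarrow> x < n + n \<Longrightarrow> mat_P s y x \<Longrightarrow> 0 \<le> mat_W s y x"
    and S: "\<And>y x a. y < n + n \<Longrightarrow> x < n + n \<Longrightarrow> mat_P s y x \<Longrightarrow> S y a \<Longrightarrow> S x (a + mat_W s y x)"
    and J: "\<And>st d. lockstep_inv n (mat_P s) (mat_W s) S v c u st d \<Longrightarrow> card {x\<in>{0..<n}. st x = 2} \<le> J"
  shows "\<exists>t. runs explore s (1 + (21 + 26 * n) * (J + 2)) t \<and>
    lockstep_inv n (mat_P s) (mat_W s) S v c u (narr t ''st'') (rarr t ''d'') \<and>
    threshold n (rvar t ''r'') (narr t ''st'') (rarr t ''d'')"
proof -
  let ?L = "lockstep_inv n (mat_P s) (mat_W s) S v c u"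
  let ?c = "\<lambda>t. card {x\<in>{0..<n}. narr t ''st'' x = 2}"
  \<comment> \<open>The stopping round settles nothing, so the measure drops to 0 together with
    \<open>go\<close>; the offset 2 keeps it positive as long as \<open>go\<close> is set.\<close>
  define m where "m t = (if nvar t ''go'' = 0 then 0 else J + 2 - ?c t)" for t :: state
  define I where "I t \<longleftrightarrow> ?L (narr t ''st'') (rarr t ''d'') \<and>
    (nvar t ''go'' = 0 \<longrightarrow> threshold n (rvar t ''r'') (narr t ''st'') (rarr t ''d''))" for t :: state
  have "\<exists>t. runs explore s (1 + (1 + (20 + 26 * n)) * m s) t \<and> I t \<and>
      \<not> tval (Nonzero (NVar ''go'')) t"
    unfolding explore_def
  proof (rule While_rule[where I = I and measr = m])
    show "I s" using inv go by (simp add: I_def)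
  next
    fix t assume fr: "frame (While (Nonzero (NVar ''go'')) advance) s t" and I: "I t"
      and go: "tval (Nonzero (NVar ''go'')) t"
    have eq: "nvar t ''nn'' = n" "mat_P t = mat_P s" "mat_W t = mat_W s"
      using fr n by (simp_all add: frame_def advance_def find_min_def settle_def mat_P_def mat_W_def fun_eq_iff)
    from advance_spec[OF eq(1), of S v c u] I W S obtain t' where t': "runs advance t (20 + 26 * n) t'"
      "?L (narr t' ''st'') (rarr t' ''d'')"
      "nvar t' ''go'' = nvar t ''go'' \<and> ?c t' = Suc (?c t) \<or>
        nvar t' ''go'' = 0 \<and> threshold n (rvar t' ''r'') (narr t' ''st'') (rarr t' ''d'')"
      unfolding eq I_def by blast
    moreover have "?c t \<le> J" "?c t' \<le> J" using J I t'(2) unfolding I_def by blast+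
    ultimately show "\<exists>t'. runs advance t (20 + 26 * n) t' \<and> I t' \<and> m t' < m t"
      using go by (intro exI[of _ t']) (auto simp: I_def m_def)
  qed
  then obtain t where t: "runs explore s (1 + (1 + (20 + 26 * n)) * m s) t" "I t"
    "\<not> tval (Nonzero (NVar ''go'')) t" by blast
  have "m s \<le> J + 2" by (simp add: m_def)
  then have "(1 + (20 + 26 * n)) * m s \<le> (1 + (20 + 26 * n)) * (J + 2)" by (rule mult_le_mono2)
  then have "runs explore s (1 + (21 + 26 * n) * (J + 2)) t" by (intro runs_mono[OF t(1)]) simp
  with t show ?thesis by (auto simp: I_def)
qed

subsection \<open>Emitting arcs\<close>

definition arc_at :: "state \<Rightarrow> nat \<Rightarrow> nat \<times> nat \<times> real \<times> bool" where
  "arc_at s i = (narr s ''tail'' i, narr s ''head'' i, rarr s ''weight'' i, narr s ''neg'' i \<noteq> 0)"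

text \<open>Arcs are only appended. They are recorded as a set of quadruples, since neither their
  numbers nor their multiplicities matter later.\<close>

definition emitted :: "(nat \<times> nat \<times> real \<times> bool) set \<Rightarrow> state \<Rightarrow> state \<Rightarrow> bool" where
  "emitted A s t \<longleftrightarrow> nvar s ''m'' \<le> nvar t ''m'' \<and> (\<forall>i<nvar s ''m''. arc_at t i = arc_at s i) \<and>
     arc_at t ` {nvar s ''m''..<nvar t ''m''} = A"

lemma emitted_trans:
  assumes "emitted A s t" "emitted B t u"
  shows "emitted (A \<union> B) s u"
proof -
  have m: "nvar s ''m'' \<le> nvar t ''m''" "nvar t ''m'' \<le> nvar u ''m''"
    using assms by (auto simp: emitted_def)
  then have "{nvar s ''m''..<nvar u ''m''} = {nvar s ''m''..<nvar t ''m''} \<union> {nvar t ''m''..<nvar u ''m''}"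
    by auto
  moreover have "arc_at u ` {nvar s ''m''..<nvar t ''m''} = arc_at t ` {nvar s ''m''..<nvar t ''m''}"
    using assms(2) by (intro image_cong) (auto simp: emitted_def)
  ultimately have "arc_at u ` {nvar s ''m''..<nvar u ''m''} = A \<union> B"
    using assms by (simp add: image_Un emitted_def)
  with m show ?thesis using assms by (auto simp: emitted_def)
qed

lemma emitted_empty:
  assumes "nvar t ''m'' = nvar s ''m''" "narr t ''tail'' = narr s ''tail''" "narr t ''head'' = narr s ''head''"
    "narr t ''neg'' = narr s ''neg''" "rarr t ''weight'' = rarr s ''weight''"
  shows "emitted {} s t"
  using assms by (auto simp: emitted_def arc_at_def)

definition emit :: "nexp \<Rightarrow> nexp \<Rightarrow> rexp \<Rightarrow> nat \<Rightarrow> com" where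
  "emit a b c g =
     NStore ''tail'' (NVar ''m'') a ;; NStore ''head'' (NVar ''m'') b ;; RStore ''weight'' (NVar ''m'') c ;;
     NStore ''neg'' (NVar ''m'') (NConst g) ;; NAssign ''m'' (NAdd (NVar ''m'') (NConst 1))"

lemma loop_free_emit [simp]: "loop_free (emit a b c g)" "steps (emit a b c g) = 5"
  by (simp_all add: emit_def)

lemma mod_emit [simp]:
  "mod_nvar (emit a b c g) = {''m''}" "mod_rvar (emit a b c g) = {}"
  "mod_narr (emit a b c g) = {''tail'', ''head'', ''neg''}" "mod_rarr (emit a b c g) = {''weight''}"
  by (auto simp: emit_def)

text \<open>The arguments are evaluated between the stores, hence the assumptions about all states
  in the frame. Arguments that read \<open>tail\<close>, \<open>head\<close> or
  \<open>weight\<close> directly would in general violate them and are copied to scalars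
  beforehand.\<close>

lemma emitted_emit:
  assumes a: "\<And>t. frame (emit a b c g) s t \<Longrightarrow> nval a t = va"
    and b: "\<And>t. frame (emit a b c g) s t \<Longrightarrow> nval b t = vb"
    and c: "\<And>t. frame (emit a b c g) s t \<Longrightarrow> rval c t = vc"
  shows "emitted {(va, vb, vc, g \<noteq> 0)} s (run (emit a b c g) s)"
proof -
  let ?s1 = "s\<lparr>narr := (narr s)(''tail'' := (narr s ''tail'')(nvar s ''m'' := va))\<rparr>"
  let ?s2 = "?s1\<lparr>narr := (narr ?s1)(''head'' := (narr s ''head'')(nvar s ''m'' := vb))\<rparr>"
  have "nval a s = va" "nval b ?s1 = vb" "rval c ?s2 = vc"
    by (intro a b c; simp add: frame_def)+
  then have "run (emit a b c g) s = ?s2\<lparr>nvar := (nvar s)(''m'' := Suc (nvar s ''m'')),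
      narr := (narr ?s2)(''neg'' := (narr s ''neg'')(nvar s ''m'' := g)),
      rarr := (rarr s)(''weight'' := (rarr s ''weight'')(nvar s ''m'' := vc))\<rparr>"
    by (simp add: emit_def)
  then show ?thesis by (simp add: emitted_def arc_at_def)
qed

definition emit_if :: "test \<Rightarrow> nexp \<Rightarrow> nexp \<Rightarrow> rexp \<Rightarrow> nat \<Rightarrow> com" where
  "emit_if q a b c g = If q (emit a b c g) Skip"

lemma loop_free_emit_if [simp]: "loop_free (emit_if q a b c g)" "steps (emit_if q a b c g) = 7"
  by (simp_all add: emit_if_def)

lemma mod_emit_if [simp]:
  "mod_nvar (emit_if q a b c g) = {''m''}" "mod_rvar (emit_if q a b c g) = {}"
  "mod_narr (emit_if q a b c g) = {''tail'', ''head'', ''neg''}" "mod_rarr (emit_if q a b c g) = {''weight''}"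
  by (auto simp: emit_if_def)

lemma emitted_emit_if:
  assumes q: "tval q s \<longleftrightarrow> vq" and g: "g \<noteq> 0 \<longleftrightarrow> vg"
    and a: "\<And>t. frame (emit_if q a b c g) s t \<Longrightarrow> nval a t = va"
    and b: "\<And>t. frame (emit_if q a b c g) s t \<Longrightarrow> nval b t = vb"
    and c: "\<And>t. frame (emit_if q a b c g) s t \<Longrightarrow> rval c t = vc"
  shows "emitted (if vq then {(va, vb, vc, vg)} else {}) s (run (emit_if q a b c g) s)"
proof -
  have fr: "frame (emit a b c g) s t \<Longrightarrow> frame (emit_if q a b c g) s t" for t by (simp add: frame_def)
  have "emitted {(va, vb, vc, g \<noteq> 0)} s (run (emit a b c g) s)"
    by (rule emitted_emit) (use a b c fr in blast)+
  then show ?thesis using q g emitted_empty[of s s] by (simp add: emit_if_def)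
qed

text \<open>Up to four arcs for each \<open>x\<close>: out of \<open>z\<close>, into
  \<open>z\<close>, \<open>e\<close> merged with a later negative arc at \<open>x\<close>, and the
  negative arc at \<open>x\<close> merged with the way to \<open>z\<close>. The first two are
  guarded by the sign of their weight, not by status 1: the frontier passes by
  \<open>threshold\<close>, and other reached vertices may pass as well because their labels also
  come from walks. If \<open>na\<close> is 0, truncated subtraction makes \<open>h\<close> and
  \<open>q\<close> refer to arc 0, but then the guards fail. The new negative arcs start at
  \<open>u\<close> or at a vertex with a negative arc, never at \<open>z\<close>.\<close>

definition detour_arcs :: com where
  "detour_arcs =
     emit_if (TAnd (Nonzero (NArr ''st'' (NVar ''x''))) (TNot (RLess (RAdd (RArr ''d'' (NVar ''x'')) (RVar ''r'')) (RConst 0))))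
       (NVar ''z'') (NVar ''x'') (RAdd (RArr ''d'' (NVar ''x'')) (RVar ''r'')) 0 ;;
     emit_if (TAnd (Nonzero (NArr ''st'' (NAdd (NVar ''nn'') (NVar ''x''))))
         (TNot (RLess (RSub (RArr ''d'' (NAdd (NVar ''nn'') (NVar ''x''))) (RVar ''r'')) (RConst 0))))
       (NVar ''x'') (NVar ''z'') (RSub (RArr ''d'' (NAdd (NVar ''nn'') (NVar ''x''))) (RVar ''r'')) 0 ;;
     NAssign ''h'' (NArr ''head'' (NSub (NArr ''na'' (NVar ''x'')) (NConst 1))) ;;
     RAssign ''q'' (RArr ''weight'' (NSub (NArr ''na'' (NVar ''x'')) (NConst 1))) ;;
     emit_if (TAnd (Nonzero (NArr ''na'' (NVar ''x''))) (Nonzero (NArr ''st'' (NVar ''x''))))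
       (NVar ''u'') (NVar ''h'') (RAdd (RArr ''d'' (NVar ''x'')) (RVar ''q'')) 1 ;;
     emit_if (TAnd (Nonzero (NArr ''na'' (NVar ''x''))) (Nonzero (NArr ''st'' (NAdd (NVar ''nn'') (NVar ''h'')))))
       (NVar ''x'') (NVar ''z'') (RSub (RAdd (RVar ''q'') (RArr ''d'' (NAdd (NVar ''nn'') (NVar ''h'')))) (RVar ''r'')) 1"

definition detour_set ::
  "nat \<Rightarrow> nat \<Rightarrow> nat \<Rightarrow> real \<Rightarrow> (nat \<Rightarrow> nat) \<Rightarrow> (nat \<Rightarrow> real) \<Rightarrow> (nat \<Rightarrow> nat) \<Rightarrow> (nat \<Rightarrow> nat) \<Rightarrow>
   (nat \<Rightarrow> real) \<Rightarrow> nat \<Rightarrow> (nat \<times> nat \<times> real \<times> bool) set" where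
  "detour_set n z u r st d na hh w x =
     (if st x \<noteq> 0 \<and> 0 \<le> d x + r then {(z, x, d x + r, False)} else {}) \<union>
     (if st (n + x) \<noteq> 0 \<and> 0 \<le> d (n + x) - r then {(x, z, d (n + x) - r, False)} else {}) \<union>
     (if na x \<noteq> 0 \<and> st x \<noteq> 0 then {(u, hh (na x - 1), d x + w (na x - 1), True)} else {}) \<union>
     (if na x \<noteq> 0 \<and> st (n + hh (na x - 1)) \<noteq> 0
      then {(x, z, w (na x - 1) + d (n + hh (na x - 1)) - r, True)} else {})"

lemma loop_free_detour_arcs [simp]: "loop_free detour_arcs" "steps detour_arcs = 30"
  by (simp_all add: detour_arcs_def)

lemma mod_detour_arcs [simp]:
  "mod_nvar detour_arcs = {''m'', ''h''}" "mod_rvar detour_arcs = {''q''}"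
  "mod_narr detour_arcs = {''tail'', ''head'', ''neg''}" "mod_rarr detour_arcs = {''weight''}"
  by (auto simp: detour_arcs_def)

lemma emitted_detour_arcs:
  assumes head: "\<And>i. i < m \<Longrightarrow> narr s ''head'' i = hh i" "\<And>i. i < m \<Longrightarrow> rarr s ''weight'' i = w i"
    and m: "m \<le> nvar s ''m''" and na: "narr s ''na'' (nvar s ''x'') \<noteq> 0 \<Longrightarrow> narr s ''na'' (nvar s ''x'') - 1 < m"
  shows "emitted (detour_set (nvar s ''nn'') (nvar s ''z'') (nvar s ''u'') (rvar s ''r'') (narr s ''st'')
    (rarr s ''d'') (narr s ''na'') hh w (nvar s ''x'')) s (run detour_arcs s)"
proof -
  let ?st = "narr s ''st''" and ?d = "rarr s ''d''" and ?na = "narr s ''na''" and ?x = "nvar s ''x''"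
    and ?n = "nvar s ''nn''" and ?z = "nvar s ''z''" and ?u = "nvar s ''u''" and ?r = "rvar s ''r''"
  let ?a = "?na ?x - 1"
  define c1 where "c1 = emit_if (TAnd (Nonzero (NArr ''st'' (NVar ''x''))) (TNot (RLess (RAdd (RArr ''d'' (NVar ''x'')) (RVar ''r'')) (RConst 0))))
       (NVar ''z'') (NVar ''x'') (RAdd (RArr ''d'' (NVar ''x'')) (RVar ''r'')) 0"
  define c2 where "c2 = emit_if (TAnd (Nonzero (NArr ''st'' (NAdd (NVar ''nn'') (NVar ''x''))))
         (TNot (RLess (RSub (RArr ''d'' (NAdd (NVar ''nn'') (NVar ''x''))) (RVar ''r'')) (RConst 0))))
       (NVar ''x'') (NVar ''z'') (RSub (RArr ''d'' (NAdd (NVar ''nn'') (NVar ''x''))) (RVar ''r'')) 0"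
  define c3 where "c3 = (NAssign ''h'' (NArr ''head'' (NSub (NArr ''na'' (NVar ''x'')) (NConst 1))) ;;
     RAssign ''q'' (RArr ''weight'' (NSub (NArr ''na'' (NVar ''x'')) (NConst 1))))"
  define c4 where "c4 = emit_if (TAnd (Nonzero (NArr ''na'' (NVar ''x''))) (Nonzero (NArr ''st'' (NVar ''x''))))
       (NVar ''u'') (NVar ''h'') (RAdd (RArr ''d'' (NVar ''x'')) (RVar ''q'')) 1"
  define c5 where "c5 = emit_if (TAnd (Nonzero (NArr ''na'' (NVar ''x''))) (Nonzero (NArr ''st'' (NAdd (NVar ''nn'') (NVar ''h'')))))
       (NVar ''x'') (NVar ''z'') (RSub (RAdd (RVar ''q'') (RArr ''d'' (NAdd (NVar ''nn'') (NVar ''h'')))) (RVar ''r'')) 1"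
  define s1 where "s1 = run c1 s"
  define s2 where "s2 = run c2 s1"
  define s3 where "s3 = run c3 s2"
  define s4 where "s4 = run c4 s3"
  have run: "run detour_arcs s = run c5 s4"
    unfolding s4_def s3_def s2_def s1_def c1_def c2_def c3_def c4_def c5_def detour_arcs_def by simp
  have e1: "emitted (if ?st ?x \<noteq> 0 \<and> 0 \<le> ?d ?x + ?r then {(?z, ?x, ?d ?x + ?r, False)} else {}) s s1"
    unfolding s1_def c1_def by (rule emitted_emit_if) (auto simp: frame_def)
  have f1: "frame c1 s s1" unfolding s1_def by (rule run_frame) (simp add: c1_def)
  then have eq1: "narr s1 ''st'' = ?st" "rarr s1 ''d'' = ?d" "narr s1 ''na'' = ?na" "nvar s1 ''x'' = ?x"
    "nvar s1 ''nn'' = ?n" "nvar s1 ''z'' = ?z" "nvar s1 ''u'' = ?u" "rvar s1 ''r'' = ?r"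
    by (simp_all add: frame_def c1_def)
  have e2: "emitted (if ?st (?n + ?x) \<noteq> 0 \<and> 0 \<le> ?d (?n + ?x) - ?r
      then {(?x, ?z, ?d (?n + ?x) - ?r, False)} else {}) s1 s2"
    unfolding s2_def c2_def by (rule emitted_emit_if) (auto simp: frame_def eq1)
  have f2: "frame c2 s1 s2" unfolding s2_def by (rule run_frame) (simp add: c2_def)
  then have eq2: "narr s2 ''st'' = ?st" "rarr s2 ''d'' = ?d" "narr s2 ''na'' = ?na" "nvar s2 ''x'' = ?x"
    "nvar s2 ''nn'' = ?n" "nvar s2 ''z'' = ?z" "nvar s2 ''u'' = ?u" "rvar s2 ''r'' = ?r"
    by (simp_all add: frame_def c2_def eq1)
  note e12 = emitted_trans[OF e1 e2]
  \<comment> \<open>Emission only appends, so the entries of the input arc \<open>?a\<close>, whose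
    number is below \<open>m\<close>, are intact.\<close>
  have "arc_at s2 ?a = arc_at s ?a" if "?na ?x \<noteq> 0"
    using e12 na[OF that] m by (auto simp: emitted_def)
  then have hq2: "narr s2 ''head'' ?a = hh ?a" "rarr s2 ''weight'' ?a = w ?a" if "?na ?x \<noteq> 0"
    using that head na by (auto simp: arc_at_def)
  have eq3: "narr s3 = narr s2" "rarr s3 = rarr s2" "nvar s3 ''x'' = ?x" "nvar s3 ''nn'' = ?n"
    "nvar s3 ''z'' = ?z" "nvar s3 ''u'' = ?u" "rvar s3 ''r'' = ?r" "nvar s3 ''m'' = nvar s2 ''m''"
    "nvar s3 ''h'' = narr s2 ''head'' ?a" "rvar s3 ''q'' = rarr s2 ''weight'' ?a"
    unfolding s3_def c3_def by (simp_all add: eq2)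
  have e3: "emitted {} s2 s3" by (rule emitted_empty) (simp_all add: eq3)
  let ?h = "nvar s3 ''h''" and ?q = "rvar s3 ''q''"
  have e4: "emitted (if ?na ?x \<noteq> 0 \<and> ?st ?x \<noteq> 0 then {(?u, ?h, ?d ?x + ?q, True)} else {}) s3 s4"
    unfolding s4_def c4_def by (rule emitted_emit_if) (auto simp: frame_def eq2 eq3(1-8))
  have f4: "frame c4 s3 s4" unfolding s4_def by (rule run_frame) (simp add: c4_def)
  then have eq4: "narr s4 ''st'' = ?st" "rarr s4 ''d'' = ?d" "narr s4 ''na'' = ?na" "nvar s4 ''x'' = ?x"
    "nvar s4 ''nn'' = ?n" "nvar s4 ''z'' = ?z" "nvar s4 ''u'' = ?u" "rvar s4 ''r'' = ?r"
    "nvar s4 ''h'' = ?h" "rvar s4 ''q'' = ?q"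
    by (simp_all add: frame_def c4_def eq2 eq3(1-8))
  have e5: "emitted (if ?na ?x \<noteq> 0 \<and> ?st (?n + ?h) \<noteq> 0
      then {(?x, ?z, ?q + ?d (?n + ?h) - ?r, True)} else {}) s4 (run c5 s4)"
    unfolding c5_def by (rule emitted_emit_if) (auto simp: frame_def eq4)
  have hq: "?h = hh ?a" "?q = w ?a" if "?na ?x \<noteq> 0" using hq2 that eq3(9,10) by auto
  have "detour_set ?n ?z ?u ?r ?st ?d ?na hh w ?x =
      ((if ?st ?x \<noteq> 0 \<and> 0 \<le> ?d ?x + ?r then {(?z, ?x, ?d ?x + ?r, False)} else {}) \<union>
      (if ?st (?n + ?x) \<noteq> 0 \<and> 0 \<le> ?d (?n + ?x) - ?r then {(?x, ?z, ?d (?n + ?x) - ?r, False)} else {})) \<union> {} \<union>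
      (if ?na ?x \<noteq> 0 \<and> ?st ?x \<noteq> 0 then {(?u, ?h, ?d ?x + ?q, True)} else {}) \<union>
      (if ?na ?x \<noteq> 0 \<and> ?st (?n + ?h) \<noteq> 0 then {(?x, ?z, ?q + ?d (?n + ?h) - ?r, True)} else {})"
    unfolding detour_set_def using hq by (cases "?na ?x = 0") simp_all
  then show ?thesis
    using emitted_trans[OF emitted_trans[OF emitted_trans[OF e12 e3] e4] e5] unfolding run by (simp only:)
qed

subsection \<open>Searches around a negative arc\<close>

lemma mem_if_singleton: "x \<in> (if b then {y} else {}) \<longleftrightarrow> b \<and> x = y"
  by simp

locale neg_digraph = wf_digraph G for G :: "(nat, nat) pre_digraph" +
  fixes w :: "nat \<Rightarrow> real" and N :: "nat set" and n m :: nat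
  assumes verts_G: "verts G = {..<n}" and arcs_G: "arcs G = {..<m}" and N_arcs: "N \<subseteq> arcs G"
    and nonneg: "\<And>a. a \<in> arcs G - N \<Longrightarrow> 0 \<le> w a"
    and unique: "\<And>v. v \<in> negative_vertices G N \<Longrightarrow> \<exists>!a. a \<in> out_arcs G v \<inter> N"
begin

lemma tail_N: "a \<in> N \<Longrightarrow> tail G a \<in> negative_vertices G N"
  using N_arcs by (auto simp: negative_vertices_def out_arcs_def)

lemma inj_on_tail: "inj_on (tail G) N"
proof (rule inj_onI)
  fix a b assume ab: "a \<in> N" "b \<in> N" "tail G a = tail G b"
  then show "a = b" using unique[OF tail_N[OF ab(1)]] N_arcs by (auto simp: out_arcs_def)
qed

lemma tail_image_N: "tail G ` N = negative_vertices G N"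
  using tail_N by (auto simp: negative_vertices_def out_arcs_def)

lemma card_N: "card (negative_vertices G N) = card N"
  using card_image[OF inj_on_tail] by (simp add: tail_image_N)

lemma finite_N: "finite N"
  using N_arcs arcs_G finite_subset by auto

lemma ends_less: "a < m \<Longrightarrow> tail G a < n" "a < m \<Longrightarrow> head G a < n"
  using tail_in_verts head_in_verts verts_G arcs_G by auto

lemma N_less: "a \<in> N \<Longrightarrow> a < m" "a \<in> N \<Longrightarrow> tail G a < n" "a \<in> N \<Longrightarrow> head G a < n"
  using N_arcs arcs_G ends_less by auto

abbreviation cost :: "nat list \<Rightarrow> real" where "cost p \<equiv> sum_list (map w p)"

abbreviation nwalk :: "nat \<Rightarrow> nat list \<Rightarrow> nat \<Rightarrow> bool" where
  "nwalk x p y \<equiv> awalk x p y \<and> set p \<inter> N = {}"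

text \<open>The incidence relation behind \<open>betweenness\<close>, read from the side of the
  vertex; this prepares the double counting.\<close>

definition between_pairs :: "nat \<Rightarrow> (nat \<times> nat) set" where
  "between_pairs v = {(x, y) \<in> verts G \<times> verts G. dist_zero G w N x v + dist_minus G w N v y < 0}"

text \<open>On the doubled vertex set, \<open>x < n\<close> is a vertex of the search out of the head of \<open>e\<close> (whose
  distances start with the weight of \<open>e\<close>), and \<open>n + x\<close> one of the reverse search into its tail.\<close>

definition search_dist :: "nat \<Rightarrow> nat \<Rightarrow> real \<Rightarrow> bool" where
  "search_dist e x c \<longleftrightarrow>
     (if x < n then \<exists>p. nwalk (head G e) p x \<and> w e + cost p = c
      else \<exists>p. nwalk (x - n) p (tail G e) \<and> cost p = c)"

lemma search_dist_out: "x < n \<Longrightarrow> search_dist e x c \<longleftrightarrow> (\<exists>p. nwalk (head G e) p x \<and> w e + cost p = c)"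
  by (simp add: search_dist_def)

lemma search_dist_in: "search_dist e (n + x) c \<longleftrightarrow> (\<exists>p. nwalk x p (tail G e) \<and> cost p = c)"
  by (simp add: search_dist_def)

text \<open>The forward walk starts with \<open>e\<close>, and the first position is the only one
  where \<open>dist_minus\<close> admits an arc of \<open>N\<close>. The backward walk avoids
  \<open>N\<close>, as \<open>dist_zero\<close> demands.\<close>

lemma between_pairsI:
  assumes e: "e \<in> N" and x: "x < n" "search_dist e x c" and y: "y < n" "search_dist e (n + y) d"
    and neg: "c + d < 0"
  shows "(y, x) \<in> between_pairs (tail G e)"
proof -
  from x obtain p where p: "nwalk (head G e) p x" "w e + cost p = c" by (auto simp: search_dist_out)
  from y obtain q where q: "nwalk y q (tail G e)" "cost q = d" by (auto simp: search_dist_in)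
  have "dist_zero G w N y (tail G e) \<le> ereal d"
    unfolding dist_zero_def using q by (auto simp: awalk_cost_def intro!: INF_lower2[of q])
  moreover have "dist_minus G w N (tail G e) x \<le> ereal c"
    unfolding dist_minus_def using p e N_arcs
    by (auto simp: awalk_cost_def awalk_Cons_iff intro!: INF_lower2[of "e # p"])
  ultimately have "dist_zero G w N y (tail G e) + dist_minus G w N (tail G e) x \<le> ereal d + ereal c"
    by (rule add_mono)
  also have "\<dots> < 0" using neg by simp
  finally show ?thesis using x y by (simp add: between_pairs_def verts_G)
qed

text \<open>The settled vertices of the two sides are equal in number and pair up injectively to
  elements of \<open>between_pairs\<close>, so their number squared is at most its size.\<close>

lemma lockstep_card:
  assumes e: "e \<in> N" and inv: "lockstep_inv n P W (search_dist e) v c u st d"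
  shows "card {x\<in>{0..<n}. st x = 2} \<le> floor_sqrt (card (between_pairs (tail G e)))"
proof -
  let ?O = "{x\<in>{0..<n}. st x = 2}" and ?I = "{x\<in>{n..<n + n}. st x = 2}"
  let ?B = "between_pairs (tail G e)"
  have "(\<lambda>(x, y). (y - n, x)) ` (?O \<times> ?I) \<subseteq> ?B"
  proof clarify
    fix x y assume xy: "x \<in> {0..<n}" "st x = 2" "y \<in> {n..<n + n}" "st y = 2"
    have "search_dist e x (d x)" "search_dist e y (d y)" "d x + d y < 0"
      using side_invD(2)[OF lockstep_invD(1)[OF inv] xy(1)]
        side_invD(2)[OF lockstep_invD(2)[OF inv] xy(3)] lockstep_invD(3)[OF inv xy(1,3)] xy(2,4) by auto
    then show "(y - n, x) \<in> ?B" using between_pairsI[OF e, of x "d x" "y - n" "d y"] xy by auto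
  qed
  moreover have "inj_on (\<lambda>(x, y). (y - n, x)) (?O \<times> ?I)" by (auto simp: inj_on_def)
  moreover have "finite ?B"
    by (rule finite_subset[of _ "verts G \<times> verts G"]) (auto simp: between_pairs_def verts_G)
  ultimately have "card (?O \<times> ?I) \<le> card ?B" using card_inj_on_le by blast
  moreover have "card ?I = card ?O" using lockstep_invD(4)[OF inv] by simp
  ultimately have "(card ?O)\<^sup>2 \<le> card ?B" by (simp add: card_cartesian_product power2_eq_square)
  then show ?thesis by (simp add: le_floor_sqrt_iff)
qed

text \<open>The output is written in place: \<open>n\<close> and \<open>m\<close> grow, while
  \<open>nn\<close> and \<open>mm\<close> keep the sizes of the input.\<close>

definition graph_stored :: "state \<Rightarrow> bool" where
  "graph_stored s \<longleftrightarrow> nvar s ''nn'' = n \<and> nvar s ''mm'' = m \<and> m \<le> nvar s ''m'' \<and>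
     (\<forall>i<m. arc_at s i = (tail G i, head G i, w i, i \<in> N))"

text \<open>Together the two conjuncts make an entry the minimum over parallel arcs. The two
  diagonal blocks hold the graph of the arcs outside \<open>N\<close> and its reverse.\<close>

definition matrix_stored :: "state \<Rightarrow> bool" where
  "matrix_stored s \<longleftrightarrow>
     (\<forall>y<n + n. \<forall>x<n + n. mat_P s y x \<longrightarrow> (\<exists>a \<in> arcs G - N. mat_W s y x = w a \<and>
        (y = tail G a \<and> x = head G a \<or> y = n + head G a \<and> x = n + tail G a))) \<and>
     (\<forall>a \<in> arcs G - N. mat_P s (tail G a) (head G a) \<and> mat_W s (tail G a) (head G a) \<le> w a \<and>
        mat_P s (n + head G a) (n + tail G a) \<and> mat_W s (n + head G a) (n + tail G a) \<le> w a)"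

text \<open>The entry \<open>na x\<close> is one more than the negative arc at \<open>x\<close>, and 0 if there is none.\<close>

definition negs_stored :: "state \<Rightarrow> bool" where
  "negs_stored s \<longleftrightarrow> (\<forall>a\<in>N. narr s ''na'' (tail G a) = Suc a) \<and>
     (\<forall>x. narr s ''na'' x \<noteq> 0 \<longrightarrow> narr s ''na'' x - 1 \<in> N \<and> tail G (narr s ''na'' x - 1) = x)"

definition prepared :: "state \<Rightarrow> bool" where
  "prepared s \<longleftrightarrow> graph_stored s \<and> matrix_stored s \<and> negs_stored s"

lemma graph_stored_emitted:
  assumes "graph_stored s" "emitted A s t" "nvar t ''nn'' = nvar s ''nn''" "nvar t ''mm'' = nvar s ''mm''"
  shows "graph_stored t"
  using assms by (auto simp: graph_stored_def emitted_def)

text \<open>Relaxation prolongs a walk, at its end in the forward search and at its front in the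
  backward search.\<close>

lemma matrix_closed:
  assumes s: "matrix_stored s" and e: "e \<in> N" and yx: "y < n + n" "x < n + n" "mat_P s y x"
  shows "0 \<le> mat_W s y x" "search_dist e y c \<Longrightarrow> search_dist e x (c + mat_W s y x)"
proof -
  from s yx obtain a where a: "a \<in> arcs G - N" "mat_W s y x = w a"
    "y = tail G a \<and> x = head G a \<or> y = n + head G a \<and> x = n + tail G a"
    unfolding matrix_stored_def by blast
  then show "0 \<le> mat_W s y x" using nonneg by simp
  assume c: "search_dist e y c"
  from a(3) show "search_dist e x (c + mat_W s y x)"
  proof
    assume yx: "y = tail G a \<and> x = head G a"
    then have lt: "y < n" "x < n" using a(1) ends_less arcs_G by auto
    with c obtain p where "nwalk (head G e) p y" "w e + cost p = c" by (auto simp: search_dist_out)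
    then have "nwalk (head G e) (p @ [a]) x \<and> w e + cost (p @ [a]) = c + w a"
      using yx a(1) by (auto intro!: awalk_appendI arc_implies_awalk)
    then show ?thesis using lt a(2) unfolding search_dist_out[OF lt(2)] a(2) by blast
  next
    assume yx: "y = n + head G a \<and> x = n + tail G a"
    with c obtain p where "nwalk (head G a) p (tail G e)" "cost p = c" by (auto simp: search_dist_in)
    then have *: "nwalk (tail G a) (a # p) (tail G e) \<and> cost (a # p) = c + w a"
      using yx a(1) by (auto simp: awalk_Cons_iff)
    have "search_dist e (n + tail G a) (c + w a)" unfolding search_dist_in using * by blast
    then show ?thesis using yx a(2) by simp
  qed
qed

definition sound_arc :: "(nat \<Rightarrow> nat) \<Rightarrow> (nat \<Rightarrow> real) \<Rightarrow> nat \<times> nat \<times> real \<times> bool \<Rightarrow> bool" where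
  "sound_arc base \<phi> = (\<lambda>(a, b, c, g).
     (\<exists>p. awalk (base a) p (base b) \<and> cost p = c + \<phi> b - \<phi> a) \<and>
     (g \<longrightarrow> a \<in> negative_vertices G N) \<and> (\<not> g \<longrightarrow> 0 \<le> c))"

text \<open>\<open>bypassed\<close> in terms of arc quadruples: it does not mention the final graph
  and is monotone in \<open>A\<close>, so it survives all later emissions.\<close>

definition bypass_arcs :: "(nat \<times> nat \<times> real \<times> bool) set \<Rightarrow> nat \<Rightarrow> nat \<Rightarrow> real \<Rightarrow> bool" where
  "bypass_arcs A e z r \<longleftrightarrow>
     (\<forall>x p. nwalk x p (tail G e) \<longrightarrow>
        (\<exists>p1 p2 y c. p = p1 @ p2 \<and> awalk x p1 y \<and> (y, z, c, False) \<in> A \<and> c \<le> cost p2 - r) \<or>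
        (\<forall>a\<in>N. head G a = x \<longrightarrow> (\<exists>c. (tail G a, z, c, True) \<in> A \<and> c \<le> w a + cost p - r))) \<and>
     (\<forall>y p. nwalk (head G e) p y \<longrightarrow>
        (\<exists>p1 p2 x c. p = p1 @ p2 \<and> awalk x p2 y \<and> (z, x, c, False) \<in> A \<and> c \<le> w e + cost p1 + r) \<or>
        (\<forall>a\<in>N. tail G a = y \<longrightarrow> (\<exists>c. (tail G e, head G a, c, True) \<in> A \<and> c \<le> w e + cost p + w a)))"

text \<open>Closure under relaxation passes the bound on the label from a settled vertex to the next
  vertex of the walk. The first tentative vertex, if there is one, is where the walk leaves the
  settled region.\<close>

lemma nwalk_out:
  assumes inv: "side_inv {0..<n} (mat_P s) (mat_W s) S v c0 st d" and mat: "matrix_stored s"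
    and "nwalk x p y" "st x \<noteq> 0" "d x \<le> c"
  shows "(\<exists>p1 p2 x'. p = p1 @ p2 \<and> awalk x' p2 y \<and> st x' = 1 \<and> d x' \<le> c + cost p1) \<or>
    st y \<noteq> 0 \<and> d y \<le> c + cost p"
  using assms(3-)
proof (induction p arbitrary: x c)
  case Nil
  then show ?case by (auto simp: awalk_Nil_iff)
next
  case (Cons a p)
  then have a: "a \<in> arcs G - N" "tail G a = x" "nwalk (head G a) p y" by (auto simp: awalk_Cons_iff)
  then have lt: "x < n" "head G a < n" using ends_less arcs_G by auto
  have "st x \<le> 2" using side_invD(1)[OF inv] lt by simp
  then consider "st x = 1" | "st x = 2" using Cons.prems(2) by linarith
  then show ?case
  proof cases
    case 1
    then show ?thesis using Cons.prems by (intro disjI1 exI[of _ "[]"] exI[of _ "a # p"] exI[of _ x]) auto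
  next
    case 2
    have W: "mat_P s x (head G a)" "mat_W s x (head G a) \<le> w a"
      using mat a(1,2) by (auto simp: matrix_stored_def)
    then have "st (head G a) \<noteq> 0" "d (head G a) \<le> d x + mat_W s x (head G a)"
      using side_invD(6,7)[OF inv, of x "head G a"] lt 2 by auto
    then have "d (head G a) \<le> c + w a" using W Cons.prems(3) by simp
    from Cons.IH[OF a(3) \<open>st (head G a) \<noteq> 0\<close> this] show ?thesis
    proof
      assume "\<exists>p1 p2 x'. p = p1 @ p2 \<and> awalk x' p2 y \<and> st x' = 1 \<and> d x' \<le> c + w a + cost p1"
      then obtain p1 p2 x' where "p = p1 @ p2" "awalk x' p2 y" "st x' = 1" "d x' \<le> c + w a + cost p1"
        by blast
      then show ?thesis by (intro disjI1 exI[of _ "a # p1"] exI[of _ p2] exI[of _ x']) auto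
    qed auto
  qed
qed

text \<open>The mirror image of \<open>nwalk_out\<close>, following the walk from its end.\<close>

lemma nwalk_in:
  assumes inv: "side_inv {n..<n + n} (mat_P s) (mat_W s) S v c0 st d" and mat: "matrix_stored s"
    and "nwalk x p y" "st (n + y) \<noteq> 0" "d (n + y) \<le> c"
  shows "(\<exists>p1 p2 y'. p = p1 @ p2 \<and> awalk x p1 y' \<and> st (n + y') = 1 \<and> d (n + y') \<le> c + cost p2) \<or>
    st (n + x) \<noteq> 0 \<and> d (n + x) \<le> c + cost p"
  using assms(3-)
proof (induction p arbitrary: y c rule: rev_induct)
  case Nil
  then show ?case by (auto simp: awalk_Nil_iff)
next
  case (snoc a p)
  then have a: "a \<in> arcs G - N" "head G a = y" "nwalk x p (tail G a)"
    by (auto simp: awalk_append_iff awalk_Cons_iff awalk_Nil_iff)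
  then have lt: "y < n" "tail G a < n" using ends_less arcs_G by auto
  have "st (n + y) \<le> 2" using side_invD(1)[OF inv] lt by simp
  then consider "st (n + y) = 1" | "st (n + y) = 2" using snoc.prems(2) by linarith
  then show ?case
  proof cases
    case 1
    then show ?thesis using snoc.prems by (intro disjI1 exI[of _ "p @ [a]"] exI[of _ "[]"] exI[of _ y]) auto
  next
    case 2
    have W: "mat_P s (n + y) (n + tail G a)" "mat_W s (n + y) (n + tail G a) \<le> w a"
      using mat a(1,2) by (auto simp: matrix_stored_def)
    then have "st (n + tail G a) \<noteq> 0" "d (n + tail G a) \<le> d (n + y) + mat_W s (n + y) (n + tail G a)"
      using side_invD(6,7)[OF inv, of "n + y" "n + tail G a"] lt 2 by auto
    then have "d (n + tail G a) \<le> c + w a" using W snoc.prems(3) by simp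
    from snoc.IH[OF a(3) \<open>st (n + tail G a) \<noteq> 0\<close> this] show ?thesis
    proof
      assume "\<exists>p1 p2 y'. p = p1 @ p2 \<and> awalk x p1 y' \<and> st (n + y') = 1 \<and> d (n + y') \<le> c + w a + cost p2"
      then obtain p1 p2 y' where "p = p1 @ p2" "awalk x p1 y'" "st (n + y') = 1"
        "d (n + y') \<le> c + w a + cost p2" by blast
      then show ?thesis by (intro disjI1 exI[of _ p1] exI[of _ "p2 @ [a]"] exI[of _ y']) auto
    qed auto
  qed
qed

text \<open>This does not need that the distances are shortest: closure of the settled vertices under
  relaxation suffices.\<close>

lemma detour_set_bypass:
  assumes e: "e \<in> N" and s: "matrix_stored s" "negs_stored s"
    and inv: "lockstep_inv n (mat_P s) (mat_W s) (search_dist e) (head G e) (w e) (tail G e) st d"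
    and thr: "threshold n r st d"
    and A: "A = (\<Union>x<n. detour_set n z (tail G e) r st d (narr s ''na'') (head G) w x)"
  shows "bypass_arcs A e z r"
proof -
  have iO: "side_inv {0..<n} (mat_P s) (mat_W s) (search_dist e) (head G e) (w e) st d"
    and iI: "side_inv {n..<n + n} (mat_P s) (mat_W s) (search_dist e) (n + tail G e) 0 st d"
    using lockstep_invD(1,2)[OF inv] by auto
  have na: "narr s ''na'' (tail G a) = Suc a" "tail G a < n" "head G a < n" if "a \<in> N" for a
    using s(2) that N_arcs arcs_G ends_less by (auto simp: negs_stored_def)
  show ?thesis
    unfolding bypass_arcs_def
  proof (intro conjI allI impI)
    fix x p assume p: "nwalk x p (tail G e)"
    have "st (n + tail G e) \<noteq> 0" "d (n + tail G e) \<le> 0" using side_invD(4,5)[OF iI] by auto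
    from nwalk_in[OF iI s(1) p this]
    show "(\<exists>p1 p2 y c. p = p1 @ p2 \<and> awalk x p1 y \<and> (y, z, c, False) \<in> A \<and> c \<le> cost p2 - r) \<or>
        (\<forall>a\<in>N. head G a = x \<longrightarrow> (\<exists>c. (tail G a, z, c, True) \<in> A \<and> c \<le> w a + cost p - r))"
    proof
      assume "\<exists>p1 p2 y'. p = p1 @ p2 \<and> awalk x p1 y' \<and> st (n + y') = 1 \<and> d (n + y') \<le> 0 + cost p2"
      then obtain p1 p2 y where y: "p = p1 @ p2" "awalk x p1 y" "st (n + y) = 1" "d (n + y) \<le> cost p2"
        by auto
      then have "y < n" using awalk_last_in_verts verts_G by auto
      then have "0 \<le> d (n + y) - r" using thr y(3) by (auto simp: threshold_def)
      then have "(y, z, d (n + y) - r, False) \<in> A"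
        unfolding A using y(3) \<open>y < n\<close> by (intro UN_I[of y]) (auto simp: detour_set_def)
      moreover have "d (n + y) - r \<le> cost p2 - r" using y by simp
      ultimately show ?thesis using y(1,2) by blast
    next
      assume x: "st (n + x) \<noteq> 0 \<and> d (n + x) \<le> 0 + cost p"
      then have "(tail G a, z, w a + d (n + x) - r, True) \<in> A" if "a \<in> N" "head G a = x" for a
        unfolding A using na[OF that(1)] that(2) by (intro UN_I[of "tail G a"]) (auto simp: detour_set_def)
      moreover have "w a + d (n + x) - r \<le> w a + cost p - r" for a using x by simp
      ultimately show ?thesis by blast
    qed
  next
    fix y p assume p: "nwalk (head G e) p y"
    have "st (head G e) \<noteq> 0" "d (head G e) \<le> w e" using side_invD(4,5)[OF iO] by auto
    from nwalk_out[OF iO s(1) p this]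
    show "(\<exists>p1 p2 x c. p = p1 @ p2 \<and> awalk x p2 y \<and> (z, x, c, False) \<in> A \<and> c \<le> w e + cost p1 + r) \<or>
        (\<forall>a\<in>N. tail G a = y \<longrightarrow> (\<exists>c. (tail G e, head G a, c, True) \<in> A \<and> c \<le> w e + cost p + w a))"
    proof
      assume "\<exists>p1 p2 x'. p = p1 @ p2 \<and> awalk x' p2 y \<and> st x' = 1 \<and> d x' \<le> w e + cost p1"
      then obtain p1 p2 x where x: "p = p1 @ p2" "awalk x p2 y" "st x = 1" "d x \<le> w e + cost p1" by blast
      then have "x < n" using awalk_hd_in_verts verts_G by auto
      then have "0 \<le> d x + r" using thr x(3) by (auto simp: threshold_def)
      then have "(z, x, d x + r, False) \<in> A"
        unfolding A using x(3) \<open>x < n\<close> by (intro UN_I[of x]) (auto simp: detour_set_def)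
      moreover have "d x + r \<le> w e + cost p1 + r" using x by simp
      ultimately show ?thesis using x(1,2) by blast
    next
      assume y: "st y \<noteq> 0 \<and> d y \<le> w e + cost p"
      then have "(tail G e, head G a, d y + w a, True) \<in> A" if "a \<in> N" "tail G a = y" for a
        unfolding A using na[OF that(1)] that(2) by (intro UN_I[of "tail G a"]) (auto simp: detour_set_def)
      moreover have "d y + w a \<le> w e + cost p + w a" for a using y by simp
      ultimately show ?thesis by blast
    qed
  qed
qed

text \<open>Every label of a reached vertex is the cost of a walk. Reading \<open>z\<close> as a
  copy of the tail of \<open>e\<close> with potential \<open>r\<close> undoes the shift in the
  weights.\<close>

lemma detour_set_sound:
  assumes e: "e \<in> N" and s: "negs_stored s"
    and inv: "lockstep_inv n P W (search_dist e) v c u st d"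
    and x: "x < n" and ar: "ar \<in> detour_set n z (tail G e) r st d (narr s ''na'') (head G) w x"
    and base: "\<And>x. x < n \<Longrightarrow> base x = x \<and> \<phi> x = 0" "base z = tail G e" "\<phi> z = r"
  shows "sound_arc base \<phi> ar" "fst ar \<in> insert z {..<n}" "fst (snd ar) \<in> insert z {..<n}"
proof -
  have e_lt: "tail G e < n" "head G e < n" "e \<in> arcs G" using e N_arcs arcs_G ends_less by auto
  have out: "\<exists>p. awalk (tail G e) p y \<and> cost p = d y" if y: "y < n" "st y \<noteq> 0" for y
  proof -
    have "search_dist e y (d y)" using side_invD(2)[OF lockstep_invD(1)[OF inv], of y] that by auto
    then obtain p where "awalk (head G e) p y" "w e + cost p = d y" unfolding search_dist_out[OF y(1)] by blast
    then show ?thesis using e_lt by (intro exI[of _ "e # p"]) (auto simp: awalk_Cons_iff)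
  qed
  have inn: "\<exists>p. awalk y p (tail G e) \<and> cost p = d (n + y)" if "y < n" "st (n + y) \<noteq> 0" for y
  proof -
    have "search_dist e (n + y) (d (n + y))"
      using side_invD(2)[OF lockstep_invD(2)[OF inv], of "n + y"] that by auto
    then show ?thesis unfolding search_dist_in by blast
  qed
  define a where "a = narr s ''na'' x - 1"
  have a: "a \<in> N" "tail G a = x" "head G a < n" "a \<in> arcs G" if "narr s ''na'' x \<noteq> 0"
  proof -
    show "a \<in> N" "tail G a = x" using s that unfolding a_def negs_stored_def by blast+
    then show "head G a < n" "a \<in> arcs G" using N_less arcs_G by auto
  qed
  from ar consider
      (1) "st x \<noteq> 0" "0 \<le> d x + r" "ar = (z, x, d x + r, False)"
    | (2) "st (n + x) \<noteq> 0" "0 \<le> d (n + x) - r" "ar = (x, z, d (n + x) - r, False)"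
    | (3) "narr s ''na'' x \<noteq> 0" "st x \<noteq> 0" "ar = (tail G e, head G a, d x + w a, True)"
    | (4) "narr s ''na'' x \<noteq> 0" "st (n + head G a) \<noteq> 0" "ar = (x, z, w a + d (n + head G a) - r, True)"
    unfolding detour_set_def Un_iff mem_if_singleton a_def by blast
  then have "sound_arc base \<phi> ar \<and> fst ar \<in> insert z {..<n} \<and> fst (snd ar) \<in> insert z {..<n}"
  proof cases
    case 1
    then show ?thesis using out[OF x] base(1)[OF x] base(2,3) x by (auto simp: sound_arc_def)
  next
    case 2
    then show ?thesis using inn[OF x] base(1)[OF x] base(2,3) x by (auto simp: sound_arc_def)
  next
    case 3
    note a = a[OF 3(1)]
    obtain p where "awalk (tail G e) p x" "cost p = d x" using out[OF x 3(2)] by blast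
    then have "awalk (tail G e) (p @ [a]) (head G a) \<and> cost (p @ [a]) = d x + w a"
      using a by (auto intro!: awalk_appendI arc_implies_awalk)
    then have "\<exists>q. awalk (tail G e) q (head G a) \<and> cost q = d x + w a" by blast
    then show ?thesis using base(1)[OF e_lt(1)] base(1)[OF a(3)] a e_lt tail_N[OF e] 3(3)
      unfolding sound_arc_def by auto
  next
    case 4
    note a = a[OF 4(1)]
    obtain p where "awalk (head G a) p (tail G e)" "cost p = d (n + head G a)" using inn[OF a(3) 4(2)] by blast
    then have "awalk x (a # p) (tail G e) \<and> cost (a # p) = w a + d (n + head G a)"
      using a by (auto simp: awalk_Cons_iff)
    then have "\<exists>q. awalk x q (tail G e) \<and> cost q = w a + d (n + head G a)" by blast
    then show ?thesis using base(1)[OF x] base(2,3) x tail_N[OF a(1)] a(2) 4(3)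
      unfolding sound_arc_def by auto
  qed
  then show "sound_arc base \<phi> ar" "fst ar \<in> insert z {..<n}" "fst (snd ar) \<in> insert z {..<n}" by auto
qed

end

subsection \<open>Processing one negative arc\<close>

definition search_vars :: com where
  "search_vars =
     NAssign ''u'' (NArr ''tail'' (NVar ''e'')) ;; NAssign ''v'' (NArr ''head'' (NVar ''e'')) ;;
     NAssign ''z'' (NVar ''n'') ;; NAssign ''n'' (NAdd (NVar ''n'') (NConst 1))"

text \<open>Distances of earlier searches may stay, because \<open>side_inv\<close> restricts
  \<open>d\<close> only at vertices of nonzero status.\<close>

definition search_clear :: com where
  "search_clear = For ''x'' (NConst 0) (NAdd (NVar ''nn'') (NVar ''nn'')) (NStore ''st'' (NVar ''x'') (NConst 0))"

definition search_init :: com where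
  "search_init =
     NStore ''st'' (NVar ''v'') (NConst 1) ;; RStore ''d'' (NVar ''v'') (RArr ''weight'' (NVar ''e'')) ;;
     NStore ''st'' (NAdd (NVar ''nn'') (NVar ''u'')) (NConst 1) ;;
     RStore ''d'' (NAdd (NVar ''nn'') (NVar ''u'')) (RConst 0) ;;
     NAssign ''go'' (NConst 1)"

definition detours :: com where
  "detours = For ''x'' (NConst 0) (NVar ''nn'') detour_arcs"

definition process :: com where
  "process = search_vars ;; search_clear ;; search_init ;; explore ;; detours"

lemmas process_defs = process_def search_vars_def search_clear_def search_init_def explore_def
  advance_def find_min_def settle_def detours_def

lemma search_clear_spec:
  "\<exists>t. runs search_clear s (2 + 3 * (nvar s ''nn'' + nvar s ''nn'')) t \<and> frame search_clear s t \<and>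
     (\<forall>x<nvar s ''nn'' + nvar s ''nn''. narr t ''st'' x = 0)"
proof -
  let ?c = "NStore ''st'' (NVar ''x'') (NConst 0)"
  let ?F = "For ''x'' (NConst 0) (NAdd (NVar ''nn'') (NVar ''nn'')) ?c"
  let ?n = "nvar s ''nn'' + nvar s ''nn''"
  have "\<exists>t. runs ?F s (2 + (steps ?c + 2) * (?n - 0)) t \<and> (\<forall>x<?n. narr t ''st'' x = 0) \<and> frame ?F s t"
    by (rule For_rule_const[where I = "\<lambda>i t. \<forall>x<i. narr t ''st'' x = 0"]) (auto simp: frame_def less_Suc_eq)
  moreover have "(steps ?c + 2) * (?n - 0) = 3 * ?n" by simp
  ultimately show ?thesis unfolding search_clear_def by metis
qed

lemma detours_spec:
  assumes head: "\<And>i. i < m \<Longrightarrow> narr s ''head'' i = hh i" "\<And>i. i < m \<Longrightarrow> rarr s ''weight'' i = w i"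
    and m: "m \<le> nvar s ''m''"
    and na: "\<And>x. narr s ''na'' x \<noteq> 0 \<Longrightarrow> narr s ''na'' x - 1 < m"
  shows "\<exists>t. runs detours s (2 + 32 * nvar s ''nn'') t \<and> frame detours s t \<and>
    emitted (\<Union>x<nvar s ''nn''. detour_set (nvar s ''nn'') (nvar s ''z'') (nvar s ''u'') (rvar s ''r'')
      (narr s ''st'') (rarr s ''d'') (narr s ''na'') hh w x) s t"
proof -
  let ?D = "detour_set (nvar s ''nn'') (nvar s ''z'') (nvar s ''u'') (rvar s ''r'')
      (narr s ''st'') (rarr s ''d'') (narr s ''na'') hh w"
  let ?F = "For ''x'' (NConst 0) (NVar ''nn'') detour_arcs"
  let ?n = "nvar s ''nn''"
  have "\<exists>t. runs ?F s (2 + (steps detour_arcs + 2) * (?n - 0)) t \<and> emitted (\<Union>x<?n. ?D x) s t \<and> frame ?F s t"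
  proof (rule For_rule_const[where I = "\<lambda>i t. emitted (\<Union>x<i. ?D x) s t"])
    show "emitted (\<Union>x<0. ?D x) s (s\<lparr>nvar := (nvar s)(''x'' := 0)\<rparr>)"
      using emitted_empty[of "s\<lparr>nvar := (nvar s)(''x'' := 0)\<rparr>" s] by simp
    fix i t
    assume fr: "frame ?F s t" and i: "nvar t ''x'' = i" and I: "emitted (\<Union>x<i. ?D x) s t"
    have eq: "nvar t ''nn'' = ?n" "nvar t ''z'' = nvar s ''z''" "nvar t ''u'' = nvar s ''u''"
      "rvar t ''r'' = rvar s ''r''" "narr t ''st'' = narr s ''st''" "rarr t ''d'' = rarr s ''d''"
      "narr t ''na'' = narr s ''na''"
      using fr by (simp_all add: frame_def)
    have arcs: "arc_at t j = arc_at s j" if "j < m" for j using I m that by (auto simp: emitted_def)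
    have "emitted (?D i) t (run detour_arcs t)"
      using emitted_detour_arcs[of m t hh w] arcs head m na I
      unfolding eq i by (auto simp: arc_at_def emitted_def)
    from emitted_trans[OF I this] have "emitted (\<Union>x<Suc i. ?D x) s (run detour_arcs t)"
      by (simp add: lessThan_Suc Un_commute)
    from emitted_trans[OF this emitted_empty]
    show "emitted (\<Union>x<Suc i. ?D x) s ((run detour_arcs t)\<lparr>nvar := (nvar (run detour_arcs t))(''x'' := Suc i)\<rparr>)"
      by simp
  qed (auto simp: frame_def)
  then show ?thesis by (auto simp: detours_def)
qed

context neg_digraph
begin

lemma lockstep_inv_init:
  assumes e: "e \<in> N" and st: "\<And>x. x < n + n \<Longrightarrow> st x = (if x = head G e \<or> x = n + tail G e then 1 else 0)"
    and d: "d (head G e) = w e" "d (n + tail G e) = 0"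
  shows "lockstep_inv n P W (search_dist e) (head G e) (w e) (tail G e) st d"
proof -
  have lt: "tail G e < n" "head G e < n" using N_less e by auto
  have "search_dist e (head G e) (w e)"
    unfolding search_dist_out[OF lt(2)] using lt verts_G by (intro exI[of _ "[]"]) (auto simp: awalk_Nil_iff)
  moreover have "search_dist e (n + tail G e) 0"
    unfolding search_dist_in using lt verts_G by (intro exI[of _ "[]"]) (auto simp: awalk_Nil_iff)
  moreover have "{x \<in> {0..<n}. st x = 2} = {}" "{x \<in> {n..<n + n}. st x = 2} = {}" using st by auto
  moreover from this have "card {x \<in> {0..<n}. st x = 2} = card {x \<in> {n..<n + n}. st x = 2}"
    by (simp only:)
  ultimately show ?thesis
    unfolding lockstep_inv_def side_inv_def using st d lt by (auto split: if_splits)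
qed

text \<open>Soundness is claimed for all \<open>base\<close> and \<open>\<phi>\<close> with the
  right values at old vertices and at the new one, because these functions are extended with every
  further negative arc.\<close>

lemma process_spec:
  assumes prep: "prepared s" and e: "e \<in> N" "nvar s ''e'' = e" and z: "n \<le> nvar s ''n''"
    and K: "K = 64 * ((n + 1) * (floor_sqrt (card (between_pairs (tail G e))) + 2))"
  shows "\<exists>t r A. runs process s K t \<and> emitted A s t \<and> prepared t \<and> nvar t ''n'' = Suc (nvar s ''n'') \<and>
    bypass_arcs A e (nvar s ''n'') r \<and>
    (\<forall>ar\<in>A. fst ar \<in> insert (nvar s ''n'') {..<n} \<and> fst (snd ar) \<in> insert (nvar s ''n'') {..<n} \<and>
      (\<forall>base \<phi>. (\<forall>x<n. base x = x \<and> \<phi> x = 0) \<and> base (nvar s ''n'') = tail G e \<and> \<phi> (nvar s ''n'') = r \<longrightarrow>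
        sound_arc base \<phi> ar))"
proof -
  let ?u = "tail G e" and ?v = "head G e" and ?z = "nvar s ''n''"
  define J where "J = floor_sqrt (card (between_pairs (tail G e)))"
  have lt: "e < m" "?u < n" "?v < n" using N_less e by auto
  have gs: "nvar s ''nn'' = n" "m \<le> nvar s ''m''" "\<And>i. i < m \<Longrightarrow> arc_at s i = (tail G i, head G i, w i, i \<in> N)"
    and mat: "matrix_stored s" and negs: "negs_stored s"
    using prep by (auto simp: prepared_def graph_stored_def)
  have te: "narr s ''tail'' e = ?u" "narr s ''head'' e = ?v" "rarr s ''weight'' e = w e"
    using gs(3)[OF lt(1)] by (auto simp: arc_at_def)
  define s1 where "s1 = run search_vars s"
  have "runs search_vars s (steps search_vars) s1"
    unfolding s1_def by (rule runs_run) (simp add: search_vars_def)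
  then have r1: "runs search_vars s 4 s1" by (simp add: search_vars_def eval_nat_numeral)
  have eq1: "narr s1 = narr s" "rarr s1 = rarr s" "rvar s1 = rvar s" "nvar s1 ''u'' = ?u" "nvar s1 ''v'' = ?v"
    "nvar s1 ''z'' = ?z" "nvar s1 ''n'' = Suc ?z" "nvar s1 ''nn'' = n" "nvar s1 ''e'' = e"
    "nvar s1 ''m'' = nvar s ''m''" "nvar s1 ''mm'' = nvar s ''mm''"
    using e te gs unfolding s1_def search_vars_def by simp_all
  obtain s2 where r2: "runs search_clear s1 (2 + 3 * (n + n)) s2" and f2: "frame search_clear s1 s2"
    and st2: "\<And>x. x < n + n \<Longrightarrow> narr s2 ''st'' x = 0"
    using search_clear_spec[of s1] unfolding eq1 by blast
  have eq2: "rarr s2 = rarr s" "rvar s2 = rvar s" "nvar s2 ''u'' = ?u" "nvar s2 ''v'' = ?v"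
    "nvar s2 ''z'' = ?z" "nvar s2 ''n'' = Suc ?z" "nvar s2 ''nn'' = n" "nvar s2 ''e'' = e"
    "nvar s2 ''m'' = nvar s ''m''" "nvar s2 ''mm'' = nvar s ''mm''"
    "\<And>a. a \<noteq> ''st'' \<Longrightarrow> narr s2 a = narr s a"
    using f2 eq1 by (simp_all add: frame_def search_clear_def fun_eq_iff)
  define s3 where "s3 = run search_init s2"
  have "runs search_init s2 (steps search_init) s3"
    unfolding s3_def by (rule runs_run) (simp add: search_init_def)
  then have r3: "runs search_init s2 5 s3" by (simp add: search_init_def eval_nat_numeral)
  have eq3: "narr s3 ''st'' = (narr s2 ''st'')(?v := 1, n + ?u := 1)"
    "rarr s3 ''d'' = (rarr s ''d'')(?v := w e, n + ?u := 0)" "nvar s3 ''go'' = 1"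
    "nvar s3 ''u'' = ?u" "nvar s3 ''z'' = ?z" "nvar s3 ''n'' = Suc ?z" "nvar s3 ''nn'' = n"
    "nvar s3 ''m'' = nvar s ''m''" "nvar s3 ''mm'' = nvar s ''mm''"
    "\<And>a. a \<noteq> ''st'' \<Longrightarrow> narr s3 a = narr s a" "\<And>a. a \<noteq> ''d'' \<Longrightarrow> rarr s3 a = rarr s a"
    using eq2 te unfolding s3_def search_init_def by simp_all
  have mat3: "mat_P s3 = mat_P s" "mat_W s3 = mat_W s"
    using eq3 by (simp_all add: fun_eq_iff mat_P_def mat_W_def)
  have ne: "?v \<noteq> n + ?u" using lt by simp
  have inv3: "lockstep_inv n (mat_P s) (mat_W s) (search_dist e) ?v (w e) ?u (narr s3 ''st'') (rarr s3 ''d'')"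
    by (rule lockstep_inv_init[OF e(1)]) (use st2 ne in \<open>auto simp: eq3\<close>)
  obtain s4 where r4: "runs explore s3 (1 + (21 + 26 * n) * (J + 2)) s4"
    and inv: "lockstep_inv n (mat_P s) (mat_W s) (search_dist e) ?v (w e) ?u (narr s4 ''st'') (rarr s4 ''d'')"
    and thr: "threshold n (rvar s4 ''r'') (narr s4 ''st'') (rarr s4 ''d'')"
    using explore_spec[of s3 n "search_dist e" ?v "w e" ?u J] matrix_closed[OF mat e(1)]
      lockstep_card[OF e(1)] inv3 eq3(3,7) unfolding mat3 J_def by auto
  have f4: "frame explore s3 s4" using runs_frame[OF r4] .
  have eq4: "nvar s4 ''u'' = ?u" "nvar s4 ''z'' = ?z" "nvar s4 ''n'' = Suc ?z" "nvar s4 ''nn'' = n"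
    "nvar s4 ''m'' = nvar s ''m''" "nvar s4 ''mm'' = nvar s ''mm''"
    "\<And>a. a \<noteq> ''st'' \<Longrightarrow> narr s4 a = narr s a" "\<And>a. a \<noteq> ''d'' \<Longrightarrow> rarr s4 a = rarr s a"
    using f4 eq3 by (simp_all add: frame_def process_defs)
  have e4: "emitted {} s s4" by (rule emitted_empty) (simp_all add: eq4)
  define A where "A = (\<Union>x<n. detour_set n ?z ?u (rvar s4 ''r'') (narr s4 ''st'') (rarr s4 ''d'')
      (narr s ''na'') (head G) w x)"
  have "narr s4 ''head'' i = head G i" "rarr s4 ''weight'' i = w i" if "i < m" for i
    using gs(3)[OF that] by (auto simp: arc_at_def eq4)
  moreover have "narr s ''na'' x - 1 < m" if "narr s ''na'' x \<noteq> 0" for x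
    using negs that N_less(1) unfolding negs_stored_def by blast
  ultimately obtain t where r5: "runs detours s4 (2 + 32 * n) t" and f5: "frame detours s4 t"
    and e5: "emitted A s4 t"
    using detours_spec[of m s4 "head G" w] gs(2) unfolding A_def by (auto simp: eq4)
  have eqt: "nvar t ''n'' = Suc ?z" "nvar t ''nn'' = n" "nvar t ''mm'' = nvar s ''mm''"
    "narr t ''na'' = narr s ''na''" "narr t ''P'' = narr s ''P''" "narr t ''off'' = narr s ''off''"
    "rarr t ''W'' = rarr s ''W''"
    using f5 eq4 by (simp_all add: frame_def detours_def)
  have em: "emitted A s t" using emitted_trans[OF e4 e5] by simp
  have "prepared t"
    using prep graph_stored_emitted[OF _ em] eqt gs(1)
    by (auto simp: prepared_def matrix_stored_def negs_stored_def mat_P_def mat_W_def)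
  moreover have "runs process s K t"
  proof -
    \<comment> \<open>\<open>64 = 26 + 38\<close>: the rounds account for 26, clearing the status
      and emitting the detours for \<open>6 + 32\<close> per vertex. The remaining 14 steps are
      absorbed by \<open>n + 1 \<le> X\<close>.\<close>
    define X where "X = (n + 1) * (J + 2)"
    have "n + 1 \<le> X" by (simp add: X_def)
    moreover have "(21 + 26 * n) * (J + 2) \<le> 26 * (n + 1) * (J + 2)" by (rule mult_le_mono1) simp
    then have "(21 + 26 * n) * (J + 2) \<le> 26 * X" by (simp only: X_def mult.assoc)
    moreover have "K = 64 * X" by (simp only: K J_def X_def)
    moreover have "4 + (2 + 3 * (n + n) + (5 + (1 + Y + (2 + 32 * n)))) \<le> 64 * X"
      if "n + 1 \<le> X" "Y \<le> 26 * X" for Y using that by simp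
    ultimately have "4 + (2 + 3 * (n + n) + (5 + (1 + (21 + 26 * n) * (J + 2) + (2 + 32 * n)))) \<le> K"
      by blast
    then show ?thesis
      unfolding process_def
      by (rule runs_mono[OF runs_Seq[OF r1 runs_Seq[OF r2 runs_Seq[OF r3 runs_Seq[OF r4 r5]]]]])
  qed
  moreover have "bypass_arcs A e ?z (rvar s4 ''r'')"
    by (rule detour_set_bypass[OF e(1) mat negs inv thr A_def])
  moreover have "fst ar \<in> insert ?z {..<n} \<and> fst (snd ar) \<in> insert ?z {..<n} \<and>
      (\<forall>base \<phi>. (\<forall>x<n. base x = x \<and> \<phi> x = 0) \<and> base ?z = ?u \<and> \<phi> ?z = rvar s4 ''r'' \<longrightarrow> sound_arc base \<phi> ar)"
    if "ar \<in> A" for ar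
  proof -
    from that obtain x where x: "x < n" "ar \<in> detour_set n ?z ?u (rvar s4 ''r'') (narr s4 ''st'') (rarr s4 ''d'')
      (narr s ''na'') (head G) w x" unfolding A_def by auto
    note ds = detour_set_sound[OF e(1) negs inv x]
    have "sound_arc base \<phi> ar" if "(\<forall>x<n. base x = x \<and> \<phi> x = 0) \<and> base ?z = ?u \<and> \<phi> ?z = rvar s4 ''r''" for base \<phi>
      using ds(1)[of base \<phi>] that by blast
    \<comment> \<open>The ends of \<open>ar\<close> do not depend on \<open>base\<close> and
      \<open>\<phi>\<close>, so any functions with the required values serve;
      \<open>n \<le> ?z\<close> sends \<open>?z\<close> to the second branch.\<close>
    moreover have "fst ar \<in> insert ?z {..<n}" "fst (snd ar) \<in> insert ?z {..<n}"
      using ds(2,3)[of "\<lambda>x. if x < n then x else ?u" "\<lambda>x. if x < n then 0 else rvar s4 ''r''"] z by auto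
    ultimately show ?thesis by blast
  qed
  ultimately show ?thesis using em eqt(1) by blast
qed

end

subsection \<open>Preparing the memory\<close>

definition mat_inv :: "nat \<Rightarrow> (nat \<times> nat \<times> real) set \<Rightarrow> state \<Rightarrow> bool" where
  "mat_inv l M s \<longleftrightarrow> (\<forall>y<l. \<forall>x<l.
     (mat_P s y x \<longrightarrow> (y, x, mat_W s y x) \<in> M) \<and>
     (\<forall>c. (y, x, c) \<in> M \<longrightarrow> mat_P s y x \<and> mat_W s y x \<le> c))"

definition mat_update :: com where
  "mat_update =
     If (TOr (Zero (NArr ''P'' (NVar ''i''))) (RLess (RArr ''weight'' (NVar ''e'')) (RArr ''W'' (NVar ''i''))))
       (NStore ''P'' (NVar ''i'') (NConst 1) ;; RStore ''W'' (NVar ''i'') (RArr ''weight'' (NVar ''e'')))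
       Skip"

lemma mat_update_spec:
  assumes inv: "mat_inv l M s" and off: "\<And>y. y < l \<Longrightarrow> narr s ''off'' y = y * l"
    and yx: "y < l" "x < l" and i: "nvar s ''i'' = narr s ''off'' y + x"
    and c: "rarr s ''weight'' (nvar s ''e'') = c"
  shows "mat_inv l (insert (y, x, c) M) (run mat_update s)"
proof -
  let ?t = "run mat_update s"
  \<comment> \<open>Row offsets are multiples of \<open>l\<close> and columns lie below
    \<open>l\<close>, so division with remainder recovers the position from the index.\<close>
  have idx: "narr s ''off'' y' + x' = narr s ''off'' y + x \<longleftrightarrow> y' = y \<and> x' = x" if "y' < l" "x' < l" for y' x'
  proof
    assume "narr s ''off'' y' + x' = narr s ''off'' y + x"
    then have eq: "y' * l + x' = y * l + x" using off that yx by simp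
    then have "(y' * l + x') div l = (y * l + x) div l" "(y' * l + x') mod l = (y * l + x) mod l" by simp_all
    then show "y' = y \<and> x' = x" using that yx by simp
  qed auto
  have off_t: "narr ?t ''off'' = narr s ''off''" by (simp add: mat_update_def)
  define upd where "upd \<longleftrightarrow> \<not> mat_P s y x \<or> c < mat_W s y x"
  have b: "tval (TOr (Zero (NArr ''P'' (NVar ''i''))) (RLess (RArr ''weight'' (NVar ''e'')) (RArr ''W'' (NVar ''i'')))) s
      \<longleftrightarrow> upd"
    using i c by (auto simp: upd_def mat_P_def mat_W_def)
  have t: "?t = (if upd then s\<lparr>narr := (narr s)(''P'' := (narr s ''P'')(narr s ''off'' y + x := 1)),
      rarr := (rarr s)(''W'' := (rarr s ''W'')(narr s ''off'' y + x := c))\<rparr> else s)"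
    unfolding mat_update_def run.simps(7) b using i c by simp
  have P: "mat_P ?t y' x' \<longleftrightarrow> mat_P s y' x' \<or> y' = y \<and> x' = x" if "y' < l" "x' < l" for y' x'
    using idx[OF that] unfolding t by (auto simp: mat_P_def upd_def)
  have W: "mat_W ?t y' x' = (if upd \<and> y' = y \<and> x' = x then c else mat_W s y' x')" if "y' < l" "x' < l" for y' x'
    using idx[OF that] unfolding t by (auto simp: mat_W_def)
  show ?thesis
    unfolding mat_inv_def
  proof (intro allI impI conjI)
    fix y' x' assume l: "y' < l" "x' < l"
    have old: "mat_P s y' x' \<Longrightarrow> (y', x', mat_W s y' x') \<in> M"
      "\<And>c. (y', x', c) \<in> M \<Longrightarrow> mat_P s y' x' \<and> mat_W s y' x' \<le> c"
      using inv l by (auto simp: mat_inv_def)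
    show "(y', x', mat_W ?t y' x') \<in> insert (y, x, c) M" if "mat_P ?t y' x'"
      using that old(1) unfolding P[OF l] W[OF l] by (auto simp: upd_def)
    fix c' assume c': "(y', x', c') \<in> insert (y, x, c) M"
    then show "mat_P ?t y' x'" using old(2) unfolding P[OF l] by auto
    show "mat_W ?t y' x' \<le> c'"
      using c' old(2)[of c'] unfolding W[OF l] upd_def by auto
  qed
qed

section \<open>The whole program\<close>

definition sizes :: com where
  "sizes = NAssign ''nn'' (NVar ''n'') ;; NAssign ''mm'' (NVar ''m'')"

definition scan_negs :: com where
  "scan_negs = For ''e'' (NConst 0) (NVar ''mm'')
     (If (Nonzero (NArr ''neg'' (NVar ''e'')))
       (NStore ''na'' (NArr ''tail'' (NVar ''e'')) (NAdd (NVar ''e'') (NConst 1)) ;;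
        If (RLess (RArr ''weight'' (NVar ''e'')) (RConst 0)) (NAssign ''any'' (NConst 1)) Skip)
       Skip)"

text \<open>The machine cannot multiply, so the multiples come from repeated addition. The matrix
  itself is never cleared: absent entries are zeros of the initial memory.\<close>

definition offsets :: com where
  "offsets = NAssign ''a'' (NConst 0) ;;
     For ''y'' (NConst 0) (NAdd (NVar ''nn'') (NVar ''nn''))
       (NStore ''off'' (NVar ''y'') (NVar ''a'') ;; NAssign ''a'' (NAdd (NVar ''a'') (NAdd (NVar ''nn'') (NVar ''nn''))))"

definition fill_matrix :: com where
  "fill_matrix = For ''e'' (NConst 0) (NVar ''mm'')
     (If (Nonzero (NArr ''neg'' (NVar ''e''))) Skip
       (NAssign ''i'' (NAdd (NArr ''off'' (NArr ''tail'' (NVar ''e''))) (NArr ''head'' (NVar ''e''))) ;; mat_update ;;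
        NAssign ''i'' (NAdd (NArr ''off'' (NAdd (NVar ''nn'') (NArr ''head'' (NVar ''e''))))
          (NAdd (NVar ''nn'') (NArr ''tail'' (NVar ''e'')))) ;; mat_update))"

definition process_all :: com where
  "process_all = For ''e'' (NConst 0) (NVar ''mm'')
     (If (Nonzero (NArr ''neg'' (NVar ''e''))) process Skip)"

text \<open>If all weights are non-negative, both halves of a subdivided copy may lie outside the
  new negative set, so the copy costs no hop at all.\<close>

definition subdivide_all :: com where
  "subdivide_all = For ''e'' (NConst 0) (NVar ''mm'')
     (NAssign ''u'' (NArr ''tail'' (NVar ''e'')) ;; NAssign ''v'' (NArr ''head'' (NVar ''e'')) ;;
      RAssign ''q'' (RArr ''weight'' (NVar ''e'')) ;;
      If (Nonzero (NArr ''neg'' (NVar ''e'')))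
        (emit (NVar ''u'') (NVar ''n'') (RConst 0) 0 ;; emit (NVar ''n'') (NVar ''v'') (RVar ''q'') 0 ;;
         NAssign ''n'' (NAdd (NVar ''n'') (NConst 1)))
        Skip)"

definition shortcut_program :: com where
  "shortcut_program = sizes ;; scan_negs ;;
     If (Nonzero (NVar ''any'')) (offsets ;; fill_matrix ;; process_all) subdivide_all"

lemma offsets_spec:
  assumes l: "l = nvar s ''nn'' + nvar s ''nn''"
  shows "\<exists>t. runs offsets s (3 + 4 * l) t \<and> frame offsets s t \<and> (\<forall>y<l. narr t ''off'' y = y * l)"
proof -
  let ?c = "NStore ''off'' (NVar ''y'') (NVar ''a'') ;; NAssign ''a'' (NAdd (NVar ''a'') (NAdd (NVar ''nn'') (NVar ''nn'')))"
  let ?F = "For ''y'' (NConst 0) (NAdd (NVar ''nn'') (NVar ''nn'')) ?c"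
  let ?s = "run (NAssign ''a'' (NConst 0)) s"
  let ?I = "\<lambda>i t. nvar t ''a'' = i * l \<and> (\<forall>y<i. narr t ''off'' y = y * l)"
  have "\<exists>t. runs ?F ?s (2 + (steps ?c + 2) * (l - 0)) t \<and> ?I l t \<and> frame ?F ?s t"
  proof (rule For_rule_const[where I = ?I])
    fix i t assume "frame ?F ?s t" and i: "nvar t ''y'' = i" and I: "?I i t"
    then have "nvar t ''nn'' + nvar t ''nn'' = l" using l by (simp add: frame_def)
    then show "?I (Suc i) ((run ?c t)\<lparr>nvar := (nvar (run ?c t))(''y'' := Suc i)\<rparr>)"
      using I i by (auto simp: less_Suc_eq)
  qed (auto simp: frame_def l)
  then obtain t where t: "runs ?F ?s (2 + (steps ?c + 2) * (l - 0)) t" "\<forall>y<l. narr t ''off'' y = y * l" by blast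
  from runs_Seq[OF runs_assign(1) t(1)] have "runs offsets s (3 + 4 * l) t"
    unfolding offsets_def by (rule runs_mono) simp
  then show ?thesis using t(2) runs_frame by blast
qed

context neg_digraph
begin

lemma arc_stored:
  assumes "graph_stored s" "i < m"
  shows "narr s ''tail'' i = tail G i" "narr s ''head'' i = head G i" "rarr s ''weight'' i = w i"
    "narr s ''neg'' i \<noteq> 0 \<longleftrightarrow> i \<in> N"
  using assms by (auto simp: graph_stored_def arc_at_def)

lemma graph_stored_frame:
  assumes "graph_stored s" "nvar t ''nn'' = nvar s ''nn''" "nvar t ''mm'' = nvar s ''mm''"
    "nvar t ''m'' = nvar s ''m''" "narr t ''tail'' = narr s ''tail''" "narr t ''head'' = narr s ''head''"
    "narr t ''neg'' = narr s ''neg''" "rarr t ''weight'' = rarr s ''weight''"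
  shows "graph_stored t"
  using assms by (simp add: graph_stored_def arc_at_def)

lemma scan_negs_spec:
  assumes gs: "graph_stored s" and na: "\<And>x. narr s ''na'' x = 0" and any: "nvar s ''any'' = 0"
  shows "\<exists>t. runs scan_negs s (2 + 8 * m) t \<and> frame scan_negs s t \<and> negs_stored t \<and>
    (nvar t ''any'' \<noteq> 0 \<longleftrightarrow> (\<exists>a\<in>N. w a < 0))"
proof -
  let ?c = "If (Nonzero (NArr ''neg'' (NVar ''e'')))
       (NStore ''na'' (NArr ''tail'' (NVar ''e'')) (NAdd (NVar ''e'') (NConst 1)) ;;
        If (RLess (RArr ''weight'' (NVar ''e'')) (RConst 0)) (NAssign ''any'' (NConst 1)) Skip)
       Skip"
  let ?F = "For ''e'' (NConst 0) (NVar ''mm'') ?c"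
  let ?I = "\<lambda>i t. (\<forall>a\<in>N. a < i \<longrightarrow> narr t ''na'' (tail G a) = Suc a) \<and>
     (\<forall>x. narr t ''na'' x \<noteq> 0 \<longrightarrow> narr t ''na'' x - 1 \<in> N \<and> tail G (narr t ''na'' x - 1) = x) \<and>
     (nvar t ''any'' \<noteq> 0 \<longleftrightarrow> (\<exists>a\<in>N. a < i \<and> w a < 0))"
  have "\<exists>t. runs ?F s (2 + (steps ?c + 2) * (m - 0)) t \<and> ?I m t \<and> frame ?F s t"
  proof (rule For_rule_const[where I = ?I])
    fix i t assume fr: "frame ?F s t" and i: "i < m" "nvar t ''e'' = i" and I: "?I i t"
    have "graph_stored t" by (rule graph_stored_frame[OF gs]) (use fr in \<open>simp_all add: frame_def\<close>)
    note a = arc_stored[OF this i(1)]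
    show "?I (Suc i) ((run ?c t)\<lparr>nvar := (nvar (run ?c t))(''e'' := Suc i)\<rparr>)"
    proof (cases "i \<in> N")
      case True
      have "run ?c t = t\<lparr>nvar := (if w i < 0 then (nvar t)(''any'' := 1) else nvar t),
          narr := (narr t)(''na'' := (narr t ''na'')(tail G i := Suc i))\<rparr>"
        using a True i by simp
      \<comment> \<open>Distinct negative arcs have distinct tails, so the store for
        \<open>i\<close> overwrites no earlier entry.\<close>
      moreover have "tail G a \<noteq> tail G i" if "a \<in> N" "a < i" for a
        using inj_on_tail True that by (auto dest: inj_onD)
      ultimately show ?thesis using I True by (auto simp: less_Suc_eq)
    next
      case False
      then have "run ?c t = t" using a i by simp
      then show ?thesis using I False less_Suc_eq by (simp only: state.simps) (auto simp: less_Suc_eq)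
    qed
  qed (use gs na any in \<open>auto simp: frame_def graph_stored_def\<close>)
  then obtain t where t: "runs ?F s (2 + (steps ?c + 2) * (m - 0)) t" "?I m t" by blast
  have "runs scan_negs s (2 + 8 * m) t"
    unfolding scan_negs_def by (rule runs_mono[OF t(1)]) simp
  moreover have "negs_stored t" "nvar t ''any'' \<noteq> 0 \<longleftrightarrow> (\<exists>a\<in>N. w a < 0)"
    using t(2) N_less(1) unfolding negs_stored_def by blast+
  ultimately show ?thesis using runs_frame by blast
qed

lemma fill_matrix_spec:
  assumes gs: "graph_stored s" and off: "\<And>y. y < n + n \<Longrightarrow> narr s ''off'' y = y * (n + n)"
    and P: "\<And>i. narr s ''P'' i = 0"
  shows "\<exists>t. runs fill_matrix s (2 + 14 * m) t \<and> frame fill_matrix s t \<and> matrix_stored t"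
proof -
  let ?A1 = "NAssign ''i'' (NAdd (NArr ''off'' (NArr ''tail'' (NVar ''e''))) (NArr ''head'' (NVar ''e'')))"
  let ?A2 = "NAssign ''i'' (NAdd (NArr ''off'' (NAdd (NVar ''nn'') (NArr ''head'' (NVar ''e''))))
          (NAdd (NVar ''nn'') (NArr ''tail'' (NVar ''e''))))"
  let ?c = "If (Nonzero (NArr ''neg'' (NVar ''e''))) Skip (?A1 ;; mat_update ;; ?A2 ;; mat_update)"
  let ?F = "For ''e'' (NConst 0) (NVar ''mm'') ?c"
  let ?E = "\<lambda>a. {(tail G a, head G a, w a), (n + head G a, n + tail G a, w a)}"
  let ?M = "\<lambda>i. \<Union>a\<in>{a. a < i \<and> a \<notin> N}. ?E a"
  have lf: "loop_free mat_update" "steps mat_update = 4" by (simp_all add: mat_update_def)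
  have md: "mod_nvar mat_update = {}" "mod_rvar mat_update = {}" "mod_narr mat_update = {''P''}"
    "mod_rarr mat_update = {''W''}"
    by (auto simp: mat_update_def)
  have "\<exists>t. runs ?F s (2 + (steps ?c + 2) * (m - 0)) t \<and> mat_inv (n + n) (?M m) t \<and> frame ?F s t"
  proof (rule For_rule_const[where I = "\<lambda>i. mat_inv (n + n) (?M i)"])
    show "mat_inv (n + n) (?M 0) (s\<lparr>nvar := (nvar s)(''e'' := 0)\<rparr>)"
      using P by (simp add: mat_inv_def mat_P_def)
    fix i t assume fr: "frame ?F s t" and i: "i < m" "nvar t ''e'' = i" and I: "mat_inv (n + n) (?M i) t"
    have gst: "graph_stored t" by (rule graph_stored_frame[OF gs]) (use fr in \<open>simp_all add: frame_def md\<close>)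
    have off_t: "\<And>y. y < n + n \<Longrightarrow> narr t ''off'' y = y * (n + n)" using fr off by (simp add: frame_def md)
    note a = arc_stored[OF gst i(1)]
    have nn: "nvar t ''nn'' = n" using gst by (simp add: graph_stored_def)
    have lt: "tail G i < n" "head G i < n" using ends_less i by auto
    have "mat_inv (n + n) (?M (Suc i)) (run ?c t)"
    proof (cases "i \<in> N")
      case True
      have "{a. a < Suc i \<and> a \<notin> N} = {a. a < i \<and> a \<notin> N}" using True less_Suc_eq by auto
      then show ?thesis using I True a i by simp
    next
      case False
      define t1 where "t1 = run ?A1 t"
      define t2 where "t2 = run mat_update t1"
      define t3 where "t3 = run ?A2 t2"
      have f2: "frame mat_update t1 t2" unfolding t2_def by (rule run_frame) (rule lf)
      have t1: "mat_inv (n + n) (?M i) t1" "narr t1 = narr t" "rarr t1 = rarr t" "nvar t1 ''e'' = i"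
        "nvar t1 ''nn'' = n" "nvar t1 ''i'' = narr t1 ''off'' (tail G i) + head G i"
        using I i a nn by (simp_all add: t1_def mat_inv_def mat_P_def mat_W_def)
      have t2: "mat_inv (n + n) (insert (tail G i, head G i, w i) (?M i)) t2"
        unfolding t2_def by (rule mat_update_spec[OF t1(1)]) (use off_t lt a t1 in auto)
      have eq2: "narr t2 ''off'' = narr t ''off''" "narr t2 ''head'' = narr t ''head''"
        "narr t2 ''tail'' = narr t ''tail''" "rarr t2 ''weight'' = rarr t ''weight''"
        "nvar t2 ''e'' = i" "nvar t2 ''nn'' = n"
        using f2 t1 by (simp_all add: frame_def md)
      have t3: "mat_inv (n + n) (insert (tail G i, head G i, w i) (?M i)) t3"
        "narr t3 ''off'' = narr t ''off''" "rarr t3 ''weight'' = rarr t ''weight''" "nvar t3 ''e'' = i"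
        "nvar t3 ''i'' = narr t3 ''off'' (n + head G i) + (n + tail G i)"
        using t2 eq2 a by (simp_all add: t3_def mat_inv_def mat_P_def mat_W_def)
      have "mat_inv (n + n) (insert (n + head G i, n + tail G i, w i) (insert (tail G i, head G i, w i) (?M i)))
          (run mat_update t3)"
        by (rule mat_update_spec[OF t3(1)]) (use off_t lt a t3 in auto)
      moreover have "run ?c t = run mat_update t3"
        using a False i by (simp add: t3_def t2_def t1_def)
      moreover have "{a. a < Suc i \<and> a \<notin> N} = insert i {a. a < i \<and> a \<notin> N}" using False less_Suc_eq by auto
      ultimately show ?thesis by (simp add: insert_commute)
    qed
    then show "mat_inv (n + n) (?M (Suc i)) ((run ?c t)\<lparr>nvar := (nvar (run ?c t))(''e'' := Suc i)\<rparr>)"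
      by (simp add: mat_inv_def mat_P_def mat_W_def)
  qed (use gs in \<open>auto simp: frame_def graph_stored_def lf md\<close>)
  then obtain t where t: "runs ?F s (2 + (steps ?c + 2) * (m - 0)) t" "mat_inv (n + n) (?M m) t" by blast
  have M: "(y, x, c) \<in> ?M m \<longleftrightarrow> (\<exists>a \<in> arcs G - N. c = w a \<and>
      (y = tail G a \<and> x = head G a \<or> y = n + head G a \<and> x = n + tail G a))" for y x c
    using arcs_G by auto
  have "matrix_stored t"
    unfolding matrix_stored_def
  proof (intro conjI allI impI ballI)
    fix y x assume "y < n + n" "x < n + n" "mat_P t y x"
    then have "(y, x, mat_W t y x) \<in> ?M m" using t(2) by (auto simp: mat_inv_def)
    then show "\<exists>a \<in> arcs G - N. mat_W t y x = w a \<and>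
        (y = tail G a \<and> x = head G a \<or> y = n + head G a \<and> x = n + tail G a)" unfolding M .
  next
    fix a assume a: "a \<in> arcs G - N"
    then have lt: "tail G a < n + n" "head G a < n + n" "n + tail G a < n + n" "n + head G a < n + n"
      using ends_less[of a] arcs_G by auto
    have "(tail G a, head G a, w a) \<in> ?M m" "(n + head G a, n + tail G a, w a) \<in> ?M m"
      unfolding M using a by blast+
    then show "mat_P t (tail G a) (head G a)" "mat_W t (tail G a) (head G a) \<le> w a"
      "mat_P t (n + head G a) (n + tail G a)" "mat_W t (n + head G a) (n + tail G a) \<le> w a"
      using t(2) lt unfolding mat_inv_def by blast+
  qed
  moreover have "runs fill_matrix s (2 + 14 * m) t"
    unfolding fill_matrix_def by (rule runs_mono[OF t(1)]) (simp add: lf)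
  ultimately show ?thesis using runs_frame by blast
qed

subsection \<open>The output graph\<close>

definition new_arcs :: "state \<Rightarrow> (nat \<times> nat \<times> real \<times> bool) set" where
  "new_arcs s = arc_at s ` {m..<nvar s ''m''}"

lemma new_arcs_emitted:
  assumes "emitted A s t" "m \<le> nvar s ''m''"
  shows "new_arcs t = new_arcs s \<union> A"
proof -
  have "{m..<nvar t ''m''} = {m..<nvar s ''m''} \<union> {nvar s ''m''..<nvar t ''m''}"
    using assms by (auto simp: emitted_def)
  moreover have "arc_at t ` {m..<nvar s ''m''} = arc_at s ` {m..<nvar s ''m''}"
    using assms by (intro image_cong) (auto simp: emitted_def)
  ultimately show ?thesis using assms by (simp add: new_arcs_def image_Un emitted_def)
qed

lemma bypass_arcs_mono: "bypass_arcs A e z r \<Longrightarrow> A \<subseteq> B \<Longrightarrow> bypass_arcs B e z r"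
  unfolding bypass_arcs_def by blast

text \<open>\<open>base\<close> and \<open>\<phi>\<close> exist only in the proof, the program does
  not store them. Bounding the ends of the new arcs by the current \<open>n\<close> makes the next
  new vertex fresh.\<close>

definition out_inv :: "nat \<Rightarrow> state \<Rightarrow> bool" where
  "out_inv i s \<longleftrightarrow> graph_stored s \<and> nvar s ''n'' = n + card {a\<in>N. a < i} \<and>
     (\<forall>ar\<in>new_arcs s. fst ar < nvar s ''n'' \<and> fst (snd ar) < nvar s ''n'') \<and>
     (\<exists>base \<phi>. (\<forall>x<n. base x = x \<and> \<phi> x = 0) \<and> (\<forall>ar\<in>new_arcs s. sound_arc base \<phi> ar)) \<and>
     (\<forall>a\<in>N. a < i \<longrightarrow> (\<exists>z r. bypass_arcs (new_arcs s) a z r))"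

lemma loop_var_update:
  fixes t :: state
  defines "t' j \<equiv> t\<lparr>nvar := (nvar t)(''e'' := j)\<rparr>"
  shows "out_inv i t \<Longrightarrow> out_inv i (t' j)" "prepared t \<Longrightarrow> prepared (t' j)"
proof -
  have gs: "graph_stored (t' j) = graph_stored t" and new: "new_arcs (t' j) = new_arcs t"
    and n: "nvar (t' j) ''n'' = nvar t ''n''"
    by (simp_all add: t'_def graph_stored_def arc_at_def new_arcs_def)
  show "out_inv i (t' j)" if "out_inv i t" using that unfolding out_inv_def gs new n .
  have "matrix_stored (t' j) = matrix_stored t" "negs_stored (t' j) = negs_stored t"
    by (simp_all add: t'_def matrix_stored_def negs_stored_def mat_P_def mat_W_def)
  then show "prepared (t' j)" if "prepared t" using that gs by (simp add: prepared_def)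
qed

lemma out_inv_skip:
  assumes "out_inv i s" "i \<notin> N" "emitted {} s t" "nvar t ''n'' = nvar s ''n''" "graph_stored t"
  shows "out_inv (Suc i) t"
proof -
  have "{a\<in>N. a < Suc i} = {a\<in>N. a < i}" using assms(2) less_Suc_eq by auto
  moreover have "new_arcs t = new_arcs s"
    using new_arcs_emitted[OF assms(3)] assms(1) by (simp add: out_inv_def graph_stored_def)
  ultimately show ?thesis using assms(1,2,4,5) by (auto simp: out_inv_def less_Suc_eq)
qed

lemma sound_arc_cong:
  assumes "base' (fst ar) = base (fst ar)" "base' (fst (snd ar)) = base (fst (snd ar))"
    "\<phi>' (fst ar) = \<phi> (fst ar)" "\<phi>' (fst (snd ar)) = \<phi> (fst (snd ar))"
  shows "sound_arc base' \<phi>' ar \<longleftrightarrow> sound_arc base \<phi> ar"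
  using assms by (simp add: sound_arc_def split_beta)

lemma out_inv_step:
  assumes inv: "out_inv i s" and i: "i \<in> N" and em: "emitted A s t" and gs: "graph_stored t"
    and z: "z = nvar s ''n''" "nvar t ''n'' = Suc z" and byp: "bypass_arcs A i z r"
    and A: "\<And>ar. ar \<in> A \<Longrightarrow> fst ar \<in> insert z {..<n} \<and> fst (snd ar) \<in> insert z {..<n}"
      "\<And>ar base \<phi>. ar \<in> A \<Longrightarrow> \<forall>x<n. base x = x \<and> \<phi> x = 0 \<Longrightarrow> base z = tail G i \<Longrightarrow> \<phi> z = r \<Longrightarrow>
        sound_arc base \<phi> ar"
  shows "out_inv (Suc i) t"
proof -
  have "{a\<in>N. a < Suc i} = insert i {a\<in>N. a < i}" using i less_Suc_eq by auto
  moreover have "finite {a\<in>N. a < i}" using finite_N by simp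
  ultimately have card: "card {a\<in>N. a < Suc i} = Suc (card {a\<in>N. a < i})" by simp
  have zn: "z = n + card {a\<in>N. a < i}" using inv z by (simp add: out_inv_def)
  have new: "new_arcs t = new_arcs s \<union> A"
    using new_arcs_emitted[OF em] inv by (simp add: out_inv_def graph_stored_def)
  from inv obtain base \<phi> where b: "\<forall>x<n. base x = x \<and> \<phi> x = 0" "\<forall>ar\<in>new_arcs s. sound_arc base \<phi> ar"
    unfolding out_inv_def by blast
  have old: "fst ar < z" "fst (snd ar) < z" if "ar \<in> new_arcs s" for ar
    using inv that z by (auto simp: out_inv_def)
  \<comment> \<open>All ends of older new arcs are below \<open>z\<close>, so extending both
    functions at \<open>z\<close> does not affect their soundness.\<close>
  let ?b = "base(z := tail G i)" and ?p = "\<phi>(z := r)"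
  have b': "\<forall>x<n. ?b x = x \<and> ?p x = 0" using b zn by auto
  have snd: "sound_arc ?b ?p ar" if "ar \<in> new_arcs t" for ar
  proof (cases "ar \<in> A")
    case True
    then show ?thesis by (rule A(2)[OF _ b']) simp_all
  next
    case False
    then have ar: "ar \<in> new_arcs s" using that new by auto
    then have "sound_arc ?b ?p ar \<longleftrightarrow> sound_arc base \<phi> ar"
      using old[OF ar] by (intro sound_arc_cong) auto
    then show ?thesis using b(2) ar by blast
  qed
  have ends: "fst ar < Suc z \<and> fst (snd ar) < Suc z" if "ar \<in> new_arcs t" for ar
    using that A(1)[of ar] old[of ar] zn unfolding new by auto
  have all: "\<exists>z r. bypass_arcs (new_arcs t) a z r" if a: "a \<in> N" "a < Suc i" for a
  proof (cases "a = i")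
    case True
    then show ?thesis using bypass_arcs_mono[OF byp, of "new_arcs t"] new by blast
  next
    case False
    then obtain z r where "bypass_arcs (new_arcs s) a z r"
      using inv a unfolding out_inv_def less_Suc_eq by blast
    then show ?thesis using bypass_arcs_mono[of "new_arcs s" a z r "new_arcs t"] new by blast
  qed
  have n': "nvar t ''n'' = n + card {a\<in>N. a < Suc i}" using z(2) zn card by simp
  have "\<exists>base \<phi>. (\<forall>x<n. base x = x \<and> \<phi> x = 0) \<and> (\<forall>ar\<in>new_arcs t. sound_arc base \<phi> ar)"
    using b' snd by blast
  then show ?thesis unfolding out_inv_def using gs n' ends all unfolding z(2)[symmetric] by blast
qed

section \<open>Handling all negative arcs\<close>

definition process_time :: "nat \<Rightarrow> nat" where
  "process_time a = 64 * ((n + 1) * (floor_sqrt (card (between_pairs (tail G a))) + 2))"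

lemma mod_process:
  "''mm'' \<notin> mod_nvar process" "''e'' \<notin> mod_nvar process"
  by (simp_all add: process_defs)

lemma process_all_spec:
  assumes prep: "prepared s" and inv: "out_inv 0 s"
  shows "\<exists>t. runs process_all s (2 + (4 * m + (\<Sum>a\<in>N. process_time a))) t \<and> out_inv m t"
proof -
  let ?c = "If (Nonzero (NArr ''neg'' (NVar ''e''))) process Skip"
  let ?F = "For ''e'' (NConst 0) (NVar ''mm'') ?c"
  let ?K = "\<lambda>i. 1 + (if i \<in> N then process_time i else 1)"
  let ?I = "\<lambda>i t. prepared t \<and> out_inv i t"
  have upd: "?I i (t\<lparr>nvar := (nvar t)(''e'' := j)\<rparr>)" if "?I i t" for i j t
    using that loop_var_update by blast
  have "\<exists>t. runs ?F s (2 + (\<Sum>i = 0..<m. ?K i + 2)) t \<and> ?I m t \<and> frame ?F s t"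
  proof (rule For_rule[where I = ?I and K = ?K])
    show "?I 0 (s\<lparr>nvar := (nvar s)(''e'' := 0)\<rparr>)" using prep inv upd by blast
    show "nval (NVar ''mm'') t = m" if "frame ?F s t" for t
      using that prep mod_process by (simp add: frame_def prepared_def graph_stored_def)
    fix i t assume i: "i < m" "nvar t ''e'' = i" and I: "?I i t"
    then have gs: "graph_stored t" by (simp add: prepared_def)
    note a = arc_stored[OF gs i(1)]
    show "\<exists>t'. runs ?c t (?K i) t' \<and> nvar t' ''e'' = i \<and> ?I (Suc i) (t'\<lparr>nvar := (nvar t')(''e'' := Suc i)\<rparr>)"
    proof (cases "i \<in> N")
      case True
      have "n \<le> nvar t ''n''" using I by (simp add: out_inv_def)
      from process_spec[OF _ True i(2) this process_time_def] I
      obtain t' r A where t': "runs process t (process_time i) t'" "emitted A t t'" "prepared t'"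
        "nvar t' ''n'' = Suc (nvar t ''n'')" "bypass_arcs A i (nvar t ''n'') r"
        and A: "\<forall>ar\<in>A. fst ar \<in> insert (nvar t ''n'') {..<n} \<and> fst (snd ar) \<in> insert (nvar t ''n'') {..<n} \<and>
          (\<forall>base \<phi>. (\<forall>x<n. base x = x \<and> \<phi> x = 0) \<and> base (nvar t ''n'') = tail G i \<and> \<phi> (nvar t ''n'') = r \<longrightarrow>
            sound_arc base \<phi> ar)"
        by blast
      have "out_inv (Suc i) t'"
        by (rule out_inv_step[OF _ True t'(2) _ refl t'(4,5)]) (use I t'(3) A in \<open>auto simp: prepared_def\<close>)
      moreover have "nvar t' ''e'' = i" using runs_frame[OF t'(1)] i mod_process by (simp add: frame_def)
      moreover have "runs ?c t (1 + process_time i) t'"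
        by (rule runs_If) (use t'(1) a(4) i True in auto)
      ultimately show ?thesis using t'(3) upd True by auto
    next
      case False
      have "out_inv (Suc i) t"
        by (rule out_inv_skip[OF _ False emitted_empty]) (use I gs in auto)
      moreover have "runs ?c t (1 + 1) t"
        by (rule runs_If) (use a(4) i False runs_run[of Skip t] in auto)
      ultimately show ?thesis using I upd False i by auto
    qed
  qed (auto simp: prep)
  \<comment> \<open>The 4 per arc covers loop test, increment, conditional and
    \<open>Skip\<close>.\<close>
  moreover have "2 + (\<Sum>i = 0..<m. ?K i + 2) \<le> 2 + (4 * m + (\<Sum>a\<in>N. process_time a))"
  proof -
    have "(\<Sum>i = 0..<m. ?K i + 2) \<le> (\<Sum>i = 0..<m. 4 + (if i \<in> N then process_time i else 0))"
      by (rule sum_mono) simp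
    also have "\<dots> = 4 * m + (\<Sum>i = 0..<m. if i \<in> N then process_time i else 0)"
      by (simp add: sum.distrib)
    also have "(\<Sum>i = 0..<m. if i \<in> N then process_time i else 0) = (\<Sum>a\<in>{0..<m} \<inter> N. process_time a)"
      by (simp add: sum.inter_restrict)
    also have "{0..<m} \<inter> N = N" using N_less(1) by auto
    finally show ?thesis by simp
  qed
  ultimately show ?thesis unfolding process_all_def using runs_mono by blast
qed

lemma subdivide_all_spec:
  assumes inv: "out_inv 0 s" and w: "\<And>a. a \<in> N \<Longrightarrow> 0 \<le> w a"
  shows "\<exists>t. runs subdivide_all s (2 + 18 * m) t \<and> out_inv m t"
proof -
  let ?L = "NAssign ''u'' (NArr ''tail'' (NVar ''e'')) ;; NAssign ''v'' (NArr ''head'' (NVar ''e'')) ;;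
      RAssign ''q'' (RArr ''weight'' (NVar ''e''))"
  let ?E1 = "emit (NVar ''u'') (NVar ''n'') (RConst 0) 0" and ?E2 = "emit (NVar ''n'') (NVar ''v'') (RVar ''q'') 0"
    and ?A = "NAssign ''n'' (NAdd (NVar ''n'') (NConst 1))"
  let ?c = "NAssign ''u'' (NArr ''tail'' (NVar ''e'')) ;; NAssign ''v'' (NArr ''head'' (NVar ''e'')) ;;
      RAssign ''q'' (RArr ''weight'' (NVar ''e'')) ;;
      If (Nonzero (NArr ''neg'' (NVar ''e''))) (?E1 ;; ?E2 ;; ?A) Skip"
  let ?F = "For ''e'' (NConst 0) (NVar ''mm'') ?c"
  have upd: "out_inv i (t\<lparr>nvar := (nvar t)(''e'' := j)\<rparr>)" if "out_inv i t" for i j t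
    using that loop_var_update by blast
  have "\<exists>t. runs ?F s (2 + (steps ?c + 2) * (m - 0)) t \<and> out_inv m t \<and> frame ?F s t"
  proof (rule For_rule_const[where I = out_inv])
    show "out_inv 0 (s\<lparr>nvar := (nvar s)(''e'' := 0)\<rparr>)" using inv upd by blast
    show "nval (NVar ''mm'') t = m" if "frame ?F s t" for t
      using that inv by (simp add: frame_def out_inv_def graph_stored_def)
    fix i t assume i: "i < m" "nvar t ''e'' = i" and I: "out_inv i t"
    then have gs: "graph_stored t" by (simp add: out_inv_def)
    note a = arc_stored[OF gs i(1)]
    define t1 where "t1 = run ?L t"
    have eq1: "narr t1 = narr t" "rarr t1 = rarr t" "nvar t1 ''u'' = tail G i" "nvar t1 ''v'' = head G i"
      "rvar t1 ''q'' = w i" "nvar t1 ''n'' = nvar t ''n''" "nvar t1 ''m'' = nvar t ''m''"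
      "nvar t1 ''nn'' = nvar t ''nn''" "nvar t1 ''mm'' = nvar t ''mm''" "nvar t1 ''e'' = i"
      using i a by (simp_all add: t1_def)
    have e1: "emitted {} t t1" by (rule emitted_empty) (simp_all add: eq1)
    have rc: "run ?c t = (if i \<in> N then run ?A (run ?E2 (run ?E1 t1)) else t1)"
    proof -
      have "run ?c t = run (If (Nonzero (NArr ''neg'' (NVar ''e''))) (?E1 ;; ?E2 ;; ?A) Skip) t1"
        by (simp add: t1_def)
      moreover have "tval (Nonzero (NArr ''neg'' (NVar ''e''))) t1 \<longleftrightarrow> i \<in> N" using a(4) eq1 by simp
      ultimately show ?thesis by simp
    qed
    have "out_inv (Suc i) (run ?c t)"
    proof (cases "i \<in> N")
      case False
      then show ?thesis
        unfolding rc using out_inv_skip[OF I False e1 eq1(6) graph_stored_emitted[OF gs e1 eq1(8,9)]] by simp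
    next
      case True
      let ?z = "nvar t ''n''"
      define t2 where "t2 = run ?E1 t1"
      define t3 where "t3 = run ?E2 t2"
      define t4 where "t4 = run ?A t3"
      have e2: "emitted {(tail G i, ?z, 0, (0::nat) \<noteq> 0)} t1 t2"
        unfolding t2_def by (rule emitted_emit) (auto simp: frame_def eq1)
      have f2: "frame ?E1 t1 t2" unfolding t2_def by (rule run_frame) simp
      have eq2: "nvar t2 ''n'' = ?z" "nvar t2 ''v'' = head G i" "rvar t2 ''q'' = w i"
        "nvar t2 ''nn'' = nvar t ''nn''" "nvar t2 ''mm'' = nvar t ''mm''"
        using f2 eq1 by (simp_all add: frame_def)
      have e3: "emitted {(?z, head G i, w i, (0::nat) \<noteq> 0)} t2 t3"
        unfolding t3_def by (rule emitted_emit) (auto simp: frame_def eq2)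
      have f3: "frame ?E2 t2 t3" unfolding t3_def by (rule run_frame) simp
      have eq3: "nvar t3 ''n'' = ?z" "nvar t3 ''nn'' = nvar t ''nn''" "nvar t3 ''mm'' = nvar t ''mm''"
        using f3 eq2 by (simp_all add: frame_def)
      have e4: "emitted {} t3 t4" by (rule emitted_empty) (simp_all add: t4_def)
      have eq4: "nvar t4 ''n'' = Suc ?z" "nvar t4 ''nn'' = nvar t ''nn''" "nvar t4 ''mm'' = nvar t ''mm''"
        using eq3 by (simp_all add: t4_def)
      let ?B = "{(tail G i, ?z, 0, False), (?z, head G i, w i, False)}"
      have em: "emitted ?B t t4"
        using emitted_trans[OF emitted_trans[OF emitted_trans[OF e1 e2] e3] e4] by (simp add: insert_commute)
      have lt: "tail G i < n" "head G i < n" "i \<in> arcs G" using ends_less i arcs_G by auto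
      \<comment> \<open>With \<open>r = 0\<close> the first alternative always applies, at the two
        ends of the negative arc themselves: the given walk is kept whole and one half of the copy
        is attached to it.\<close>
      have "bypass_arcs ?B i ?z 0"
        unfolding bypass_arcs_def
      proof (intro conjI allI impI disjI1)
        fix x p assume "nwalk x p (tail G i)"
        then show "\<exists>p1 p2 y c. p = p1 @ p2 \<and> awalk x p1 y \<and> (y, ?z, c, False) \<in> ?B \<and> c \<le> cost p2 - 0"
          by (intro exI[of _ p] exI[of _ "[]"] exI[of _ "tail G i"] exI[of _ 0]) simp
      next
        fix y p assume "nwalk (head G i) p y"
        then show "\<exists>p1 p2 x c. p = p1 @ p2 \<and> awalk x p2 y \<and> (?z, x, c, False) \<in> ?B \<and> c \<le> w i + cost p1 + 0"
          by (intro exI[of _ "[]"] exI[of _ p] exI[of _ "head G i"] exI[of _ "w i"]) simp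
      qed
      moreover have "sound_arc base \<phi> ar"
        if "ar \<in> ?B" "\<forall>x<n. base x = x \<and> \<phi> x = 0" "base ?z = tail G i" "\<phi> ?z = 0" for ar base \<phi>
      proof -
        have "awalk (tail G i) [] (tail G i)" using lt verts_G by (simp add: awalk_Nil_iff)
        then have "\<exists>p. awalk (tail G i) p (tail G i) \<and> cost p = 0" by (intro exI[of _ "[]"]) simp
        moreover have "\<exists>p. awalk (tail G i) p (head G i) \<and> cost p = w i"
          using arc_implies_awalk[OF lt(3)] by (intro exI[of _ "[i]"]) simp
        ultimately show ?thesis using that lt w[OF True] by (auto simp: sound_arc_def)
      qed
      ultimately have "out_inv (Suc i) t4"
        using lt by (intro out_inv_step[OF I True em graph_stored_emitted[OF gs em eq4(2,3)] refl eq4(1)]) auto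
      then show ?thesis unfolding rc t4_def t3_def t2_def using True by simp
    qed
    then show "out_inv (Suc i) ((run ?c t)\<lparr>nvar := (nvar (run ?c t))(''e'' := Suc i)\<rparr>)" by (rule upd)
  qed auto
  then obtain t where t: "runs ?F s (2 + (steps ?c + 2) * (m - 0)) t" "out_inv m t" by blast
  have "runs subdivide_all s (2 + 18 * m) t"
    unfolding subdivide_all_def by (rule runs_mono[OF t(1)]) simp
  then show ?thesis using t(2) by blast
qed

text \<open>The quadruples turn into arcs of the stored graph. A prefix or suffix of a walk outside
  \<open>N\<close> contributes no hop and completes such an arc to the \<open>reach\<close>
  statements of \<open>bypassed\<close>.\<close>

lemma out_inv_shortcut:
  assumes inv: "out_inv m t"
  shows "shortcut_graph G w N (stored_graph t) (stored_weight t) (stored_neg t)"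
proof -
  let ?G = "stored_graph t" and ?w = "stored_weight t" and ?N = "stored_neg t"
  have gs: "graph_stored t" using inv by (simp add: out_inv_def)
  note old = arc_stored[OF gs]
  have mm: "m \<le> nvar t ''m''" using gs by (simp add: graph_stored_def)
  have "{a\<in>N. a < m} = N" using N_less(1) by auto
  then have n': "nvar t ''n'' = n + card N" using inv by (simp add: out_inv_def)
  obtain base \<phi> where base: "\<And>x. x < n \<Longrightarrow> base x = x \<and> \<phi> x = 0"
    and snd: "\<And>ar. ar \<in> new_arcs t \<Longrightarrow> sound_arc base \<phi> ar" using inv unfolding out_inv_def by blast
  have new: "arc_at t i \<in> new_arcs t" if "i < nvar t ''m''" "\<not> i < m" for i
    using that by (auto simp: new_arcs_def)
  have ends: "fst ar < nvar t ''n'' \<and> fst (snd ar) < nvar t ''n''" if "ar \<in> new_arcs t" for ar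
    using inv that by (auto simp: out_inv_def)
  have sel: "verts ?G = {..<nvar t ''n''}" "arcs ?G = {..<nvar t ''m''}" "tail ?G = narr t ''tail''"
    "head ?G = narr t ''head''" "\<And>i. ?w i = rarr t ''weight'' i"
    "\<And>i. i \<in> ?N \<longleftrightarrow> i < nvar t ''m'' \<and> narr t ''neg'' i \<noteq> 0"
    by (auto simp: stored_graph_def stored_weight_def stored_neg_def)
  have wf': "wf_digraph ?G"
  proof
    fix i assume "i \<in> arcs ?G"
    then have i: "i < nvar t ''m''" by (simp add: sel)
    have "narr t ''tail'' i < nvar t ''n'' \<and> narr t ''head'' i < nvar t ''n''"
    proof (cases "i < m")
      case True
      then show ?thesis using old(1,2)[OF True] ends_less[OF True] n' by simp
    next
      case False
      then show ?thesis using ends[OF new[OF i False]] by (simp add: arc_at_def)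
    qed
    then show "tail ?G i \<in> verts ?G" "head ?G i \<in> verts ?G" by (simp_all add: sel)
  qed
  have ext: "extends_graph G w ?G ?w"
    unfolding extends_graph_def using wf' old mm n' by (auto simp: sel verts_G arcs_G)
  have N1: "?N \<inter> arcs G \<subseteq> N" using old(4) by (auto simp: sel arcs_G)
  have N2: "N \<subseteq> ?N" using old(4) N_less(1) mm by (fastforce simp: sel)
  have ar: "awalk (base (tail G a)) [a] (base (head G a))" if "a < m" for a
    using arc_implies_awalk[of a] that arcs_G base ends_less[OF that] by simp
  show ?thesis
  proof (rule shortcut_graphI[OF wf_digraph_axioms ext N_arcs N2 _ N1])
    show "?N \<subseteq> arcs ?G" by (auto simp: sel)
  next
    fix i assume i: "i \<in> arcs ?G - ?N"
    show "0 \<le> ?w i"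
    proof (cases "i < m")
      case True
      then show ?thesis using old[OF True] i nonneg[of i] arcs_G by (simp add: sel)
    next
      case False
      then show ?thesis using snd[OF new[of i]] i by (auto simp: sel arc_at_def sound_arc_def)
    qed
  next
    fix i assume i: "i \<in> ?N"
    show "tail ?G i \<in> negative_vertices G N"
    proof (cases "i < m")
      case True
      then show ?thesis using old[OF True] i tail_N[of i] by (simp add: sel)
    next
      case False
      then show ?thesis using snd[OF new[of i]] i by (auto simp: sel arc_at_def sound_arc_def)
    qed
  next
    show "base x = x \<and> \<phi> x = 0" if "x \<in> verts G" for x using base that by (simp add: verts_G)
  next
    fix i assume i: "i \<in> arcs ?G"
    show "\<exists>p. awalk (base (tail ?G i)) p (base (head ?G i)) \<and> cost p = ?w i + \<phi> (head ?G i) - \<phi> (tail ?G i)"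
    proof (cases "i < m")
      case True
      then show ?thesis using old[OF True] ar[OF True] base ends_less[OF True]
        by (intro exI[of _ "[i]"]) (simp add: sel)
    next
      case False
      then show ?thesis using snd[OF new[of i]] i by (auto simp: sel arc_at_def sound_arc_def)
    qed
  next
    show "card (verts ?G) = card (verts G) + card (negative_vertices G N)"
      by (simp add: sel n' verts_G card_N)
  next
    fix e assume e: "e \<in> N"
    then obtain z r where byp: "bypass_arcs (new_arcs t) e z r"
      using inv N_less(1) by (auto simp: out_inv_def)
    note tr = reach_trans[OF wf', of ?w ?N]
    have walk: "reach ?G ?w ?N 0 x y (cost p)" if "nwalk x p y" for x p y
    proof -
      have "filter (\<lambda>e. e \<in> N) p = []" using that by (auto simp: filter_empty_conv)
      then show ?thesis using extends_graph_reach[OF ext N1, of x p y] that by simp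
    qed
    have arcr: "reach ?G ?w ?N (if g then 1 else 0) a b c" if "(a, b, c, g) \<in> new_arcs t" for a b c g
    proof -
      from that obtain i where i: "i < nvar t ''m''" "arc_at t i = (a, b, c, g)" by (auto simp: new_arcs_def)
      then show ?thesis using reach_arc[OF wf', of i ?N "if g then 1 else 0" ?w]
        by (auto simp: sel arc_at_def split: if_splits)
    qed
    show "bypassed G w N ?G ?w ?N e"
      unfolding bypassed_def
    proof (intro exI[of _ z] exI[of _ r] conjI allI impI)
      fix x p assume p: "nwalk x p (tail G e)"
      with byp have "(\<exists>p1 p2 y c. p = p1 @ p2 \<and> awalk x p1 y \<and> (y, z, c, False) \<in> new_arcs t \<and> c \<le> cost p2 - r) \<or>
        (\<forall>a\<in>N. head G a = x \<longrightarrow> (\<exists>c. (tail G a, z, c, True) \<in> new_arcs t \<and> c \<le> w a + cost p - r))"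
        unfolding bypass_arcs_def by blast
      then show "reach ?G ?w ?N 0 x z (cost p - r) \<or>
          (\<forall>a\<in>N. head G a = x \<longrightarrow> reach ?G ?w ?N 1 (tail G a) z (w a + cost p - r))"
      proof
        assume "\<exists>p1 p2 y c. p = p1 @ p2 \<and> awalk x p1 y \<and> (y, z, c, False) \<in> new_arcs t \<and> c \<le> cost p2 - r"
        then obtain p1 p2 y c where y: "p = p1 @ p2" "awalk x p1 y" "(y, z, c, False) \<in> new_arcs t" "c \<le> cost p2 - r"
          by blast
        have "nwalk x p1 y" using y p by auto
        from tr[OF walk[OF this] arcr[OF y(3)]] have "reach ?G ?w ?N 0 x z (cost p - r)"
          by (rule reach_mono) (use y in auto)
        then show ?thesis ..
      next
        assume *: "\<forall>a\<in>N. head G a = x \<longrightarrow> (\<exists>c. (tail G a, z, c, True) \<in> new_arcs t \<and> c \<le> w a + cost p - r)"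
        have "reach ?G ?w ?N 1 (tail G a) z (w a + cost p - r)" if "a \<in> N" "head G a = x" for a
        proof -
          from * that obtain c where "(tail G a, z, c, True) \<in> new_arcs t" "c \<le> w a + cost p - r" by blast
          then show ?thesis using reach_mono[OF arcr] by simp
        qed
        then show ?thesis by blast
      qed
    next
      fix y p assume p: "nwalk (head G e) p y"
      with byp have "(\<exists>p1 p2 x c. p = p1 @ p2 \<and> awalk x p2 y \<and> (z, x, c, False) \<in> new_arcs t \<and> c \<le> w e + cost p1 + r) \<or>
        (\<forall>a\<in>N. tail G a = y \<longrightarrow> (\<exists>c. (tail G e, head G a, c, True) \<in> new_arcs t \<and> c \<le> w e + cost p + w a))"
        unfolding bypass_arcs_def by blast
      then show "reach ?G ?w ?N 0 z y (w e + cost p + r) \<or>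
          (\<forall>a\<in>N. tail G a = y \<longrightarrow> reach ?G ?w ?N 1 (tail G e) (head G a) (w e + cost p + w a))"
      proof
        assume "\<exists>p1 p2 x c. p = p1 @ p2 \<and> awalk x p2 y \<and> (z, x, c, False) \<in> new_arcs t \<and> c \<le> w e + cost p1 + r"
        then obtain p1 p2 x c where x: "p = p1 @ p2" "awalk x p2 y" "(z, x, c, False) \<in> new_arcs t"
          "c \<le> w e + cost p1 + r"
          by blast
        have "nwalk x p2 y" using x p by auto
        from tr[OF arcr[OF x(3)] walk[OF this]] have "reach ?G ?w ?N 0 z y (w e + cost p + r)"
          by (rule reach_mono) (use x in auto)
        then show ?thesis ..
      next
        assume *: "\<forall>a\<in>N. tail G a = y \<longrightarrow> (\<exists>c. (tail G e, head G a, c, True) \<in> new_arcs t \<and> c \<le> w e + cost p + w a)"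
        have "reach ?G ?w ?N 1 (tail G e) (head G a) (w e + cost p + w a)" if "a \<in> N" "tail G a = y" for a
        proof -
          from * that obtain c where "(tail G e, head G a, c, True) \<in> new_arcs t" "c \<le> w e + cost p + w a" by blast
          then show ?thesis using reach_mono[OF arcr] by simp
        qed
        then show ?thesis by blast
      qed
    qed
  qed
qed

subsection \<open>Running time\<close>

text \<open>Double counting of pairs and vertices between them. Tails of negative arcs are distinct,
  so no vertex is counted twice for the same pair.\<close>

lemma sum_between_pairs:
  assumes "\<And>x y. x \<in> verts G \<Longrightarrow> y \<in> verts G \<Longrightarrow> real (betweenness G w N x y) \<le> c"
  shows "(\<Sum>a\<in>N. real (card (between_pairs (tail G a)))) \<le> (real n)\<^sup>2 * c"
proof -
  let ?V = "verts G \<times> verts G"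
  have fin: "finite (verts G)" by (simp add: verts_G)
  have "real (card (between_pairs v)) = (\<Sum>p\<in>?V. if p \<in> between_pairs v then 1 else 0)" for v
  proof -
    have "between_pairs v = ?V \<inter> between_pairs v" by (auto simp: between_pairs_def)
    then have "real (card (between_pairs v)) = (\<Sum>p\<in>?V \<inter> between_pairs v. 1)" by simp
    also have "\<dots> = (\<Sum>p\<in>?V. if p \<in> between_pairs v then 1 else 0)"
      using fin by (intro sum.inter_restrict) simp
    finally show ?thesis .
  qed
  then have "(\<Sum>a\<in>N. real (card (between_pairs (tail G a)))) =
      (\<Sum>p\<in>?V. \<Sum>a\<in>N. if p \<in> between_pairs (tail G a) then 1 else 0)"
    by (simp only: sum.swap[of _ ?V])
  also have "\<dots> \<le> (\<Sum>p\<in>?V. c)"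
  proof (rule sum_mono)
    fix p assume "p \<in> ?V"
    then obtain x y where p: "p = (x, y)" "x \<in> verts G" "y \<in> verts G" by auto
    let ?A = "{a \<in> N. p \<in> between_pairs (tail G a)}"
    have "(\<Sum>a\<in>N. if p \<in> between_pairs (tail G a) then 1 else 0) = real (card ?A)"
      using sum.inter_filter[OF finite_N, of "\<lambda>_. 1 :: real" "\<lambda>a. p \<in> between_pairs (tail G a)"] by simp
    also have "card ?A = card (tail G ` ?A)"
      using inj_on_tail by (intro card_image[symmetric]) (auto elim: inj_on_subset)
    also have "\<dots> \<le> betweenness G w N x y"
      unfolding betweenness_def using fin N_less(2) p(1)
      by (intro card_mono) (auto simp: between_pairs_def verts_G)
    finally show "(\<Sum>a\<in>N. if p \<in> between_pairs (tail G a) then 1 else 0) \<le> c"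
      using assms[OF p(2,3)] by simp
  qed
  also have "\<dots> = (real n)\<^sup>2 * c" by (simp add: verts_G power2_eq_square)
  finally show ?thesis .
qed

lemma neg_weight_imp_le:
  assumes bet: "\<And>x y. x \<in> verts G \<Longrightarrow> y \<in> verts G \<Longrightarrow> real (betweenness G w N x y) \<le> real (card N) / b"
    and b: "1 \<le> b" and a: "a \<in> N" "w a < 0"
  shows "b \<le> real (card N)"
proof -
  let ?B = "{v \<in> verts G. dist_zero G w N (tail G a) v + dist_minus G w N v (head G a) < 0}"
  have V: "tail G a \<in> verts G" "head G a \<in> verts G" using N_less a verts_G by auto
  have "search_dist a (head G a) (w a)"
    unfolding search_dist_out[OF N_less(3)[OF a(1)]] using V by (intro exI[of _ "[]"]) (auto simp: awalk_Nil_iff)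
  moreover have "search_dist a (n + tail G a) 0"
    unfolding search_dist_in using V by (intro exI[of _ "[]"]) (auto simp: awalk_Nil_iff)
  ultimately have "(tail G a, head G a) \<in> between_pairs (tail G a)"
    using between_pairsI[OF a(1), of "head G a" "w a" "tail G a" 0] N_less a by auto
  then have "tail G a \<in> ?B" using V by (simp add: between_pairs_def)
  moreover have "finite ?B" by (simp add: verts_G)
  ultimately have "1 \<le> betweenness G w N (tail G a) (head G a)"
    unfolding betweenness_def by (metis One_nat_def Suc_leI card_gt_0_iff empty_iff)
  then have "1 \<le> real (card N) / b" using bet[OF V] by linarith
  then show ?thesis using b by (simp add: field_simps)
qed

lemma sum_process_time:
  assumes bet: "\<And>x y. x \<in> verts G \<Longrightarrow> y \<in> verts G \<Longrightarrow> real (betweenness G w N x y) \<le> real (card N) / b"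
    and b: "1 \<le> b" "b \<le> real (card N)"
  shows "(\<Sum>a\<in>N. real (process_time a)) \<le> 512 * (real (card N) * (real n)\<^sup>2 / sqrt b)"
proof -
  let ?k = "real (card N)"
  define J where "J a = real (floor_sqrt (card (between_pairs (tail G a))))" for a
  \<comment> \<open>Up to a constant factor, \<open>q\<close> is the average number of rounds that
    the bound allows per negative arc. Since \<open>b \<le> k \<le> n\<close>, it is at least 1 and
    thus also covers the fixed cost of a search.\<close>
  define q where "q = real n / sqrt b"
  have "card N \<le> card {..<n}"
    using card_image[OF inj_on_tail] card_mono[of "{..<n}" "tail G ` N"] N_less(2) by auto
  then have kn: "card N \<le> n" by simp
  have n1: "1 \<le> real n" using kn b by linarith
  have sb: "0 < sqrt b" using b by simp
  have "b \<le> real n" using b kn by linarith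
  also have "\<dots> \<le> (real n)\<^sup>2" using n1 by (simp add: power2_eq_square)
  finally have "sqrt b \<le> real n" by (rule real_le_lsqrt[rotated]) (use b n1 in auto)
  then have q1: "1 \<le> q" using sb by (simp add: q_def)
  \<comment> \<open>AM-GM in the form \<open>j \<le> j\<^sup>2 / q + q\<close> replaces Cauchy--Schwarz.\<close>
  have "J a \<le> real (card (between_pairs (tail G a))) / q + q" for a
  proof -
    have "(floor_sqrt (card (between_pairs (tail G a))))\<^sup>2 \<le> card (between_pairs (tail G a))" by simp
    then have sq: "(J a)\<^sup>2 \<le> real (card (between_pairs (tail G a)))"
      unfolding J_def using of_nat_mono by fastforce
    have "0 \<le> J a * q" using q1 by (simp add: J_def)
    then have "J a * q \<le> (J a)\<^sup>2 + q\<^sup>2" using sum_squares_bound[of "J a" q] by linarith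
    then have "J a * q \<le> real (card (between_pairs (tail G a))) + q * q"
      using sq by (simp add: power2_eq_square)
    then show ?thesis using q1 by (simp add: field_simps)
  qed
  then have "(\<Sum>a\<in>N. J a) \<le> (\<Sum>a\<in>N. real (card (between_pairs (tail G a))) / q + q)" by (intro sum_mono)
  also have "\<dots> = (\<Sum>a\<in>N. real (card (between_pairs (tail G a)))) / q + ?k * q"
    by (simp add: sum.distrib sum_divide_distrib)
  also have "\<dots> \<le> (real n)\<^sup>2 * (?k / b) / q + ?k * q"
    using sum_between_pairs[OF bet] q1 by (intro add_right_mono divide_right_mono) auto
  \<comment> \<open>Since \<open>q\<^sup>2 = n\<^sup>2 / b\<close>, this choice of \<open>q\<close>
    balances the two summands.\<close>
  also have "(real n)\<^sup>2 * (?k / b) / q = ?k * q"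
    using sb b n1 by (simp add: q_def field_simps power2_eq_square)
  finally have J: "(\<Sum>a\<in>N. J a) \<le> 2 * (?k * q)" by (simp add: mult.commute)
  have "(\<Sum>a\<in>N. real (process_time a)) = 64 * (real n + 1) * ((\<Sum>a\<in>N. J a) + 2 * ?k)"
    by (simp add: process_time_def J_def sum_distrib_left[symmetric] sum.distrib algebra_simps)
  \<comment> \<open>Uses \<open>n + 1 \<le> 2 * n\<close> and \<open>k \<le> k * q\<close>; the
    constants multiply to \<open>64 * 2 * 4 = 512\<close>.\<close>
  also have "\<dots> \<le> 64 * (2 * real n) * (2 * (?k * q) + 2 * (?k * q))"
  proof (rule mult_mono)
    have "?k \<le> ?k * q" using q1 by (simp add: mult_le_cancel_left1)
    then show "(\<Sum>a\<in>N. J a) + 2 * ?k \<le> 2 * (?k * q) + 2 * (?k * q)" using J by linarith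
    show "0 \<le> (\<Sum>a\<in>N. J a) + 2 * ?k" by (intro add_nonneg_nonneg sum_nonneg) (auto simp: J_def)
  qed (use n1 in auto)
  also have "\<dots> = 512 * (?k * (real n)\<^sup>2 / sqrt b)" by (simp add: q_def power2_eq_square)
  finally show ?thesis .
qed

text \<open>All work outside the searches is linear in the size of the input, and the sum is charged
  only if the searches are run.\<close>

lemma shortcut_program_spec:
  "\<exists>t. runs shortcut_program (load_graph G w N b)
      (27 * (1 + n + m) + (if \<exists>a\<in>N. w a < 0 then \<Sum>a\<in>N. process_time a else 0)) t \<and> out_inv m t"
proof -
  define s0 where "s0 = load_graph G w N b"
  define s1 where "s1 = run sizes s0"
  have "runs sizes s0 (steps sizes) s1" unfolding s1_def by (rule runs_run) (simp add: sizes_def)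
  then have r1: "runs sizes s0 2 s1" by (simp add: sizes_def numeral_2_eq_2)
  have cards: "card (verts G) = n" "card (arcs G) = m" by (simp_all add: verts_G arcs_G)
  have gs1: "graph_stored s1"
    using arcs_G N_arcs by (auto simp: graph_stored_def s1_def sizes_def s0_def load_graph_def arc_at_def cards)
  have eq1: "narr s1 ''na'' x = 0" "nvar s1 ''any'' = 0" "narr s1 ''P'' x = 0" "nvar s1 ''n'' = n"
    "nvar s1 ''m'' = m" "nvar s1 ''nn'' = n" for x
    by (simp_all add: s1_def sizes_def s0_def load_graph_def cards)
  obtain s2 where r2: "runs scan_negs s1 (2 + 8 * m) s2" and f2: "frame scan_negs s1 s2"
    and negs: "negs_stored s2" and any: "nvar s2 ''any'' \<noteq> 0 \<longleftrightarrow> (\<exists>a\<in>N. w a < 0)"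
    using scan_negs_spec[OF gs1 eq1(1,2)] by blast
  have gs2: "graph_stored s2"
    by (rule graph_stored_frame[OF gs1]) (use f2 in \<open>simp_all add: frame_def scan_negs_def\<close>)
  have eq2: "narr s2 ''P'' x = 0" "nvar s2 ''n'' = n" "nvar s2 ''m'' = m" "nvar s2 ''nn'' = n" for x
    using f2 eq1 by (simp_all add: frame_def scan_negs_def)
  have init: "out_inv 0 s" if "graph_stored s" "nvar s ''n'' = n" "nvar s ''m'' = m" for s
  proof -
    have new: "new_arcs s = {}" using that by (simp add: new_arcs_def)
    have "\<exists>base \<phi>. (\<forall>x<n. base x = x \<and> \<phi> x = 0) \<and> (\<forall>ar\<in>{}. sound_arc base \<phi> ar)"
      by (rule exI[of _ "\<lambda>x. x"], rule exI[of _ "\<lambda>x. 0"]) simp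
    then show ?thesis using that unfolding out_inv_def new by simp
  qed
  let ?If = "If (Nonzero (NVar ''any'')) (offsets ;; fill_matrix ;; process_all) subdivide_all"
  have "\<exists>t. runs ?If s2 (1 + (22 + 18 * m + 8 * n + (if \<exists>a\<in>N. w a < 0 then \<Sum>a\<in>N. process_time a else 0))) t \<and>
      out_inv m t"
  proof (cases "\<exists>a\<in>N. w a < 0")
    case False
    then obtain t where t: "runs subdivide_all s2 (2 + 18 * m) t" "out_inv m t"
      using subdivide_all_spec[OF init[OF gs2 eq2(2,3)]] by force
    have "runs ?If s2 (1 + (22 + 18 * m + 8 * n + (if \<exists>a\<in>N. w a < 0 then \<Sum>a\<in>N. process_time a else 0))) t"
      by (rule runs_If) (use any False in simp, rule runs_mono[OF t(1)], simp)
    then show ?thesis using t(2) by blast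
  next
    case True
    obtain s3 where r3: "runs offsets s2 (3 + 4 * (n + n)) s3" and f3: "frame offsets s2 s3"
      and off: "\<And>y. y < n + n \<Longrightarrow> narr s3 ''off'' y = y * (n + n)"
      using offsets_spec[of "n + n" s2] eq2(4) by auto
    have gs3: "graph_stored s3"
      by (rule graph_stored_frame[OF gs2]) (use f3 in \<open>simp_all add: frame_def offsets_def\<close>)
    have eq3: "narr s3 ''P'' x = 0" "nvar s3 ''n'' = n" "nvar s3 ''m'' = m" "narr s3 ''na'' = narr s2 ''na''" for x
      using f3 eq2 by (simp_all add: frame_def offsets_def)
    obtain s4 where r4: "runs fill_matrix s3 (2 + 14 * m) s4" and f4: "frame fill_matrix s3 s4"
      and mat: "matrix_stored s4"
      using fill_matrix_spec[OF gs3 off eq3(1)] by blast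
    have gs4: "graph_stored s4"
      by (rule graph_stored_frame[OF gs3]) (use f4 in \<open>simp_all add: frame_def fill_matrix_def mat_update_def\<close>)
    have eq4: "nvar s4 ''n'' = n" "nvar s4 ''m'' = m" "narr s4 ''na'' = narr s2 ''na''"
      using f4 eq3 by (simp_all add: frame_def fill_matrix_def mat_update_def)
    have "prepared s4" using gs4 mat negs eq4(3) by (simp add: prepared_def negs_stored_def)
    from process_all_spec[OF this init[OF gs4 eq4(1,2)]] obtain t
      where r5: "runs process_all s4 (2 + (4 * m + (\<Sum>a\<in>N. process_time a))) t" and t: "out_inv m t" by blast
    have "runs ?If s2 (1 + (22 + 18 * m + 8 * n + (if \<exists>a\<in>N. w a < 0 then \<Sum>a\<in>N. process_time a else 0))) t"
      by (rule runs_If, rule runs_mono[OF runs_Seq[OF r3 runs_Seq[OF r4 r5]]]) (use any True in simp_all)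
    then show ?thesis using t by blast
  qed
  then obtain t where t: "runs ?If s2 (1 + (22 + 18 * m + 8 * n +
      (if \<exists>a\<in>N. w a < 0 then \<Sum>a\<in>N. process_time a else 0))) t" "out_inv m t" by blast
  have "runs shortcut_program s0 (27 * (1 + n + m) + (if \<exists>a\<in>N. w a < 0 then \<Sum>a\<in>N. process_time a else 0)) t"
    unfolding shortcut_program_def by (rule runs_mono[OF runs_Seq[OF r1 runs_Seq[OF r2 t(1)]]]) simp
  then show ?thesis using t(2) unfolding s0_def by blast
qed

end

theorem theorem3p1:
  shows "\<exists>(P :: com) (C :: real). \<forall>(G :: (nat, nat) pre_digraph) (w :: nat \<Rightarrow> real)
           (N :: nat set) (n :: nat) (m :: nat) (k :: nat) (b :: real).
     wf_digraph G \<and> verts G = {..<n} \<and> arcs G = {..<m} \<and>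
     N \<subseteq> arcs G \<and> (\<forall>e \<in> arcs G - N. 0 \<le> w e) \<and>
     card (negative_vertices G N) = k \<and>
     (\<forall>v \<in> negative_vertices G N. \<exists>!e. e \<in> out_arcs G v \<inter> N) \<and>
     1 \<le> b \<and>
     (\<forall>s \<in> verts G. \<forall>t \<in> verts G. real (betweenness G w N s t) \<le> real k / b)
     \<longrightarrow>
     (\<exists>T t. exec P (load_graph G w N b) T t \<and>
        real T \<le> C * max (real k * real n ^ 2 / sqrt b) (real (1 + n + m)) \<and>
        shortcut_graph G w N (stored_graph t) (stored_weight t) (stored_neg t))"
proof (rule exI[of _ shortcut_program], rule exI[of _ 539], intro allI impI, elim conjE)
  fix G :: "(nat, nat) pre_digraph" and w N n m k and b :: real
  assume wf: "wf_digraph G" and V: "verts G = {..<n}" "arcs G = {..<m}" "N \<subseteq> arcs G"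
    "\<forall>e \<in> arcs G - N. 0 \<le> w e" and k: "card (negative_vertices G N) = k"
    and uniq: "\<forall>v \<in> negative_vertices G N. \<exists>!e. e \<in> out_arcs G v \<inter> N" and b: "1 \<le> b"
    and bet: "\<forall>s \<in> verts G. \<forall>t \<in> verts G. real (betweenness G w N s t) \<le> real k / b"
  interpret neg_digraph G w N n m
    by (intro neg_digraph.intro neg_digraph_axioms.intro wf) (use V uniq in blast)+
  have kN: "k = card N" using k card_N by simp
  have bet': "\<And>x y. x \<in> verts G \<Longrightarrow> y \<in> verts G \<Longrightarrow> real (betweenness G w N x y) \<le> real (card N) / b"
    using bet kN by blast
  let ?S = "if \<exists>a\<in>N. w a < 0 then \<Sum>a\<in>N. process_time a else 0"
  let ?X = "real k * real n ^ 2 / sqrt b" and ?Y = "real (1 + n + m)"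
  obtain T t where T: "exec shortcut_program (load_graph G w N b) T t" "T \<le> 27 * (1 + n + m) + ?S"
    and t: "out_inv m t"
    using shortcut_program_spec[of b] unfolding runs_def by blast
  have "real ?S \<le> 512 * ?X"
  \<comment> \<open>The bound on the sum requires \<open>b \<le> k\<close>, which a negative weight
    guarantees. Without one, \<open>b\<close> may exceed \<open>k\<close>, but then no search is
    run.\<close>
  proof (cases "\<exists>a\<in>N. w a < 0")
    case True
    then have "b \<le> real (card N)" using neg_weight_imp_le[OF bet' b] by blast
    then show ?thesis using True sum_process_time[OF bet' b] by (simp add: kN)
  next
    case False
    then show ?thesis using b by simp
  qed
  moreover have "real T \<le> 27 * ?Y + real ?S" using T(2) of_nat_mono[OF T(2), where 'a = real] by simp
  \<comment> \<open>\<open>539 = 512 + 27\<close>: the searches are charged to the first argument of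
    the maximum, everything linear in the input to the second.\<close>
  moreover have "512 * x + 27 * y \<le> 539 * max x y" for x y :: real
    by (cases "x \<le> y") (simp_all add: max_def)
  then have "512 * ?X + 27 * ?Y \<le> 539 * max ?X ?Y" .
  ultimately have "real T \<le> 539 * max ?X ?Y" by linarith
  then show "\<exists>T t. exec shortcut_program (load_graph G w N b) T t \<and> real T \<le> 539 * max ?X ?Y \<and>
      shortcut_graph G w N (stored_graph t) (stored_weight t) (stored_neg t)"
    using T(1) out_inv_shortcut[OF t] by blast
qed

end
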